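(* Let $W$ be a finite Coxeter group of type $A_n$ ($n\ge 2$), $B_n$ ($n\ge 2$) or $I_2(m)$ ($m\ge 3$), and let $o$ be the following $W$-orbit: in type $A_n$, $o=\{e_1,\dots,e_{n+1}\}$; in type $B_n$, $o=\{\pm e_1,\dots,\pm e_n\}$; in type $I_2(m)$, an orbit consisting of the vertices of a regular $m$-gon. Two distinct almost positive roots, represented by collections $C_1$ and $C_2$ of line segments (their diagrams constructed from $o$), are compatible if and only if no segment in $C_1$ crosses any segment in $C_2$.
   Context: Setting. $(W,S)$ is a finite irreducible Coxeter system of rank $n$, represented as a real reflection group on a Euclidean space $V$ so that only the origin is fixed by $W$. Type $A_n$ is $S_{n+1}$ permuting coordinates of $\mathbb{R}^{n+1}$ modulo the line spanned by $(1,\dots,1)$ (equivalently, project orthogonally to the sum-zero hyperplane); type $B_n$ is the group of signed permutations on $\mathbb{R}^n$; type $I_2(m)$ is the dihedral group of order $2m$. $\Phi$ is a root system for $W$ (a $W$-stable set with exactly two opposite roots normal to each reflecting hyperplane) with simple roots $\alpha_s$ ($s\in S$) and positive roots $\Phi^+$. The almost positive roots are $\Phi_{\ge-1}=\Phi^+\cup\{-\alpha_s:s\in S\}$. $S=S_+\sqcup S_-$ is a bipartition of the Coxeter diagram, $c_\pm=\prod_{s\in S_\pm}s$, $c=c_-c_+$, and $h$ is the order of $c$. Compatibility. For $\varepsilon\in\{+,-\}$ define the involution $\tau_\varepsilon$ on $\Phi_{\ge-1}$ by $\tau_\varepsilon(\alpha)=\alpha$ if $\alpha=-\alpha_s$ with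 $s\in S_{-\varepsilon}$, and $\tau_\varepsilon(\alpha)=c_\varepsilon(\alpha)$ otherwise. Compatibility is the unique $\langle\tau_+,\tau_-\rangle$-invariant binary relation on $\Phi_{\ge-1}$ such that for every $s\in S$, $\beta$ is compatible with $-\alpha_s$ iff $\alpha_s$ has coefficient $0$ in the simple root expansion of $\beta$. Every $\langle\tau_+,\tau_-\rangle$-orbit in $\Phi_{\ge -1}$ contains a negative simple root. Coxeter plane. Let $(c_s)_{s\in S}$ be a positive eigenvector, for the smallest eigenvalue, of the Gram matrix of the unit simple roots $\alpha_s/|\alpha_s|$, and $(\omega_s)$ the basis dual to the unit simple roots. The Coxeter plane is $P=\mathrm{span}(\lambda,\mu)$, $\lambda=\sum_{s\in S_+}c_s\omega_s$, $\mu=\sum_{s\in S_-}c_s\omega_s$; the angle between $\lambda$ and $\mu$ is $\pi/h$. Use polar coordinates on $P$ with $\lambda$ at angle $0$ and $\mu$ at angle $\pi/h$. Diagrams of almost positive roots. In the types considered here the orthogonal projection of $o$ to $P$ is the vertex set of a regular $h$-gon centered at the origin, each vertex having angle $k\pi/h$ for an integer $1\le k\le 2h$. This $h$-gon is enlarged to a regular $(h+2)$-gon with the same distance of vertices to the origin, by subdividing each of the two edges perpendicular to $\mathbb{R}\lambda$ or $\mathbb{R}\mu$ by a new vertex and then making the polygon regular. Explicitly, $x\in o$ with projection at radius $r$ and angle $k\pi/h$ is sent to the point $\hat x$ at radius $r$ and angle $(k+2)\pi/(h+2)$ if $1\le k\le h$, and $(k+4)\pi/(h+2)$ if $h+1\le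 k\le 2h$; the $(h+2)$-gon is the regular $(h+2)$-gon centered at the origin whose vertices include all $\hat x$. The diagram of $-\alpha_s$ is the collection of line segments $\hat x\,\widehat{sx}$ over all $x\in o$ with $sx\ne x$. Let $L'_+$ and $L'_-$ be the lines through the origin at angles $\pi/(h+2)$ and $2\pi/(h+2)$; reflection in $L'_\varepsilon$ preserves the diagrams of $-\alpha_s$ for $s\in S_{-\varepsilon}$. Let $\tau_\varepsilon$ act on segments as reflection in $L'_\varepsilon$. The diagrams of all almost positive roots are uniquely determined by requiring that the diagram of $\tau_\varepsilon(\beta)$ be the image under $\tau_\varepsilon$ of the diagram of $\beta$. Two segments cross if they intersect in a point of the relative interior of both. *)

theory Defs
  imports "HOL-Analysis.Analysis"
begin

text \<open>
  Throughout, \<open>W\<close> is a set of maps on a Euclidean space. The generators of the Coxeter system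
  are the reflections \<open>reflection \<alpha>\<close> for \<open>\<alpha>\<close> in a set of simple roots, which therefore also serves
  as the index set \<open>S\<close>. A bipartition \<open>S = S\<^sub>+ \<union> S\<^sub>-\<close> is given by the two sets \<open>\<Delta>\<^sub>+\<close>, \<open>\<Delta>\<^sub>-\<close> of simple
  roots, written \<open>Dp\<close> and \<open>Dm\<close>. The space \<open>V\<close> is the span of the simple roots.
\<close>

subsection \<open>Reflection groups and root systems\<close>

definition reflection :: "'a::real_inner \<Rightarrow> 'a \<Rightarrow> 'a" where
  "reflection a x = x - (2 * (x \<bullet> a) / (a \<bullet> a)) *\<^sub>R a"

text \<open>A hyperplane with normal \<open>b\<close> is a reflecting hyperplane of \<open>W\<close> iff \<open>reflection b \<in> W\<close>.\<close>

definition root_system :: "('a::real_inner \<Rightarrow> 'a) set \<Rightarrow> 'a set \<Rightarrow> bool" where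
  "root_system W \<Phi> \<longleftrightarrow>
     (\<forall>w\<in>W. w ` \<Phi> = \<Phi>) \<and>
     (\<forall>a\<in>\<Phi>. a \<noteq> 0 \<and> reflection a \<in> W) \<and>
     (\<forall>b. b \<noteq> 0 \<and> reflection b \<in> W \<longrightarrow> (\<exists>a. \<Phi> \<inter> span {b} = {a, - a}))"

definition simple_roots :: "'a::real_inner set \<Rightarrow> 'a set \<Rightarrow> bool" where
  "simple_roots \<Phi> \<Delta> \<longleftrightarrow> \<Delta> \<subseteq> \<Phi> \<and> independent \<Delta> \<and> \<Phi> \<subseteq> span \<Delta> \<and>
     (\<forall>b\<in>\<Phi>. (\<forall>a\<in>\<Delta>. 0 \<le> representation \<Delta> b a) \<or> (\<forall>a\<in>\<Delta>. representation \<Delta> b a \<le> 0))"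

definition positive_roots :: "'a::real_inner set \<Rightarrow> 'a set \<Rightarrow> 'a set" where
  "positive_roots \<Phi> \<Delta> = {b \<in> \<Phi>. \<forall>a\<in>\<Delta>. 0 \<le> representation \<Delta> b a}"

definition almost_positive_roots :: "'a::real_inner set \<Rightarrow> 'a set \<Rightarrow> 'a set" where
  "almost_positive_roots \<Phi> \<Delta> = positive_roots \<Phi> \<Delta> \<union> uminus ` \<Delta>"

definition map_order :: "('a \<Rightarrow> 'a) \<Rightarrow> nat" where
  "map_order f = (LEAST k. 0 < k \<and> f ^^ k = id)"

definition coxeter_edge :: "'a::real_inner \<Rightarrow> 'a \<Rightarrow> bool" where
  "coxeter_edge a b \<longleftrightarrow> map_order (reflection a \<circ> reflection b) \<ge> 3"

definition bipartition :: "'a::real_inner set \<Rightarrow> 'a set \<Rightarrow> 'a set \<Rightarrow> bool" where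
  "bipartition \<Delta> Dp Dm \<longleftrightarrow> \<Delta> = Dp \<union> Dm \<and> Dp \<inter> Dm = {} \<and>
     (\<forall>a\<in>Dp. \<forall>b\<in>Dp. \<not> coxeter_edge a b) \<and> (\<forall>a\<in>Dm. \<forall>b\<in>Dm. \<not> coxeter_edge a b)"

text \<open>The order of the factors is irrelevant when the reflections in question commute.\<close>

definition reflection_prod :: "'a::real_inner set \<Rightarrow> 'a \<Rightarrow> 'a" where
  "reflection_prod D = Finite_Set.fold (\<lambda>a f. reflection a \<circ> f) id D"

definition coxeter_element :: "'a::real_inner set \<Rightarrow> 'a set \<Rightarrow> 'a \<Rightarrow> 'a" where
  "coxeter_element Dp Dm = reflection_prod Dm \<circ> reflection_prod Dp"

definition coxeter_number :: "'a::real_inner set \<Rightarrow> 'a set \<Rightarrow> nat" where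
  "coxeter_number Dp Dm = map_order (coxeter_element Dp Dm)"

subsection \<open>Compatibility\<close>

text \<open>\<open>tau Dp Dm\<close> is \<open>\<tau>\<^sub>+\<close> and \<open>tau Dm Dp\<close> is \<open>\<tau>\<^sub>-\<close>.\<close>

definition tau :: "'a::real_inner set \<Rightarrow> 'a set \<Rightarrow> 'a \<Rightarrow> 'a" where
  "tau D D' b = (if b \<in> uminus ` D' then b else reflection_prod D b)"

definition is_compatibility ::
    "'a::real_inner set \<Rightarrow> 'a set \<Rightarrow> 'a set \<Rightarrow> ('a \<times> 'a) set \<Rightarrow> bool" where
  "is_compatibility \<Phi> Dp Dm R \<longleftrightarrow>
     (let \<Delta> = Dp \<union> Dm; A = almost_positive_roots \<Phi> \<Delta> in
        R \<subseteq> A \<times> A \<and>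
        (\<forall>b\<in>A. \<forall>g\<in>A. (tau Dp Dm b, tau Dp Dm g) \<in> R \<longleftrightarrow> (b, g) \<in> R) \<and>
        (\<forall>b\<in>A. \<forall>g\<in>A. (tau Dm Dp b, tau Dm Dp g) \<in> R \<longleftrightarrow> (b, g) \<in> R) \<and>
        (\<forall>a\<in>\<Delta>. \<forall>b\<in>A. (b, - a) \<in> R \<longleftrightarrow> representation \<Delta> b a = 0))"

definition compatibility :: "'a::real_inner set \<Rightarrow> 'a set \<Rightarrow> 'a set \<Rightarrow> ('a \<times> 'a) set" where
  "compatibility \<Phi> Dp Dm = (THE R. is_compatibility \<Phi> Dp Dm R)"

subsection \<open>The Coxeter plane\<close>

text \<open>For \<open>a \<noteq> 0\<close>, \<open>sgn a\<close> is the unit vector \<open>a / |a|\<close>.\<close>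

definition gram_eigen :: "'a::real_inner set \<Rightarrow> ('a \<Rightarrow> real) \<Rightarrow> real \<Rightarrow> bool" where
  "gram_eigen \<Delta> c l \<longleftrightarrow> (\<exists>a\<in>\<Delta>. c a \<noteq> 0) \<and> (\<forall>a\<in>\<Delta>. (\<Sum>b\<in>\<Delta>. (sgn a \<bullet> sgn b) * c b) = l * c a)"

definition coxeter_eigenvector :: "'a::real_inner set \<Rightarrow> ('a \<Rightarrow> real) \<Rightarrow> bool" where
  "coxeter_eigenvector \<Delta> c \<longleftrightarrow> (\<forall>a\<in>\<Delta>. c a > 0) \<and>
     (\<exists>l. gram_eigen \<Delta> c l \<and> (\<forall>c' l'. gram_eigen \<Delta> c' l' \<longrightarrow> l \<le> l'))"

definition dual_vector :: "'a::real_inner set \<Rightarrow> 'a \<Rightarrow> 'a" where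
  "dual_vector \<Delta> a =
     (THE w. w \<in> span \<Delta> \<and> (\<forall>b\<in>\<Delta>. w \<bullet> sgn b = (if b = a then 1 else 0)))"

definition plane_vector :: "'a::real_inner set \<Rightarrow> ('a \<Rightarrow> real) \<Rightarrow> 'a set \<Rightarrow> 'a" where
  "plane_vector \<Delta> c D = (\<Sum>a\<in>D. c a *\<^sub>R dual_vector \<Delta> a)"

text \<open>
  Orthogonal projection to \<open>P = span {\<lambda>, \<mu>}\<close>, with \<open>P\<close> identified with the complex plane by the
  orthonormal basis \<open>u, v\<close> of \<open>P\<close> for which \<open>\<lambda>\<close> has angle \<open>0\<close> and \<open>\<mu>\<close> has positive imaginary
  part, that is, angle \<open>\<pi>/h\<close> (and not \<open>-\<pi>/h\<close>).
\<close>

definition plane_projection :: "'a::real_inner set \<Rightarrow> 'a set \<Rightarrow> ('a \<Rightarrow> real) \<Rightarrow> 'a \<Rightarrow> complex" where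
  "plane_projection Dp Dm c x =
     (let l = plane_vector (Dp \<union> Dm) c Dp;
          m = plane_vector (Dp \<union> Dm) c Dm;
          u = sgn l;
          v = sgn (m - (m \<bullet> u) *\<^sub>R u)
      in Complex (x \<bullet> u) (x \<bullet> v))"

subsection \<open>Diagrams of almost positive roots\<close>

text \<open>The passage from a vertex of the \<open>h\<close>-gon to a vertex of the \<open>(h+2)\<close>-gon.\<close>

definition enlarge :: "nat \<Rightarrow> complex \<Rightarrow> complex" where
  "enlarge h z =
     (let k = (THE k::nat. 1 \<le> k \<and> k \<le> 2 * h \<and> z = rcis (cmod z) (real k * pi / real h))
      in rcis (cmod z) (real (if k \<le> h then k + 2 else k + 4) * pi / real (h + 2)))"

definition hat :: "'a::real_inner set \<Rightarrow> 'a set \<Rightarrow> ('a \<Rightarrow> real) \<Rightarrow> 'a \<Rightarrow> complex" where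
  "hat Dp Dm c x = enlarge (coxeter_number Dp Dm) (plane_projection Dp Dm c x)"

definition negative_simple_diagram ::
    "'a::real_inner set \<Rightarrow> 'a set \<Rightarrow> ('a \<Rightarrow> real) \<Rightarrow> 'a set \<Rightarrow> 'a \<Rightarrow> complex set set" where
  "negative_simple_diagram Dp Dm c orb a =
     {closed_segment (hat Dp Dm c x) (hat Dp Dm c (reflection a x)) | x.
        x \<in> orb \<and> reflection a x \<noteq> x}"

text \<open>Reflection of the complex plane in the line through the origin at angle \<open>\<theta>\<close>.\<close>

definition line_reflection :: "real \<Rightarrow> complex \<Rightarrow> complex" where
  "line_reflection \<theta> z = cis (2 * \<theta>) * cnj z"

definition is_root_diagram ::
    "'a::real_inner set \<Rightarrow> 'a set \<Rightarrow> 'a set \<Rightarrow> ('a \<Rightarrow> real) \<Rightarrow> 'a set \<Rightarrow> ('a \<Rightarrow> complex set set) \<Rightarrow> bool" where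
  "is_root_diagram \<Phi> Dp Dm c orb F \<longleftrightarrow>
     (let \<Delta> = Dp \<union> Dm; A = almost_positive_roots \<Phi> \<Delta>; h = coxeter_number Dp Dm in
        F \<in> extensional A \<and>
        (\<forall>a\<in>\<Delta>. F (- a) = negative_simple_diagram Dp Dm c orb a) \<and>
        (\<forall>b\<in>A. F (tau Dp Dm b) = (\<lambda>s. line_reflection (pi / real (h + 2)) ` s) ` F b) \<and>
        (\<forall>b\<in>A. F (tau Dm Dp b) = (\<lambda>s. line_reflection (2 * pi / real (h + 2)) ` s) ` F b))"

definition root_diagram ::
    "'a::real_inner set \<Rightarrow> 'a set \<Rightarrow> 'a set \<Rightarrow> ('a \<Rightarrow> real) \<Rightarrow> 'a set \<Rightarrow> 'a \<Rightarrow> complex set set" where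
  "root_diagram \<Phi> Dp Dm c orb = (THE F. is_root_diagram \<Phi> Dp Dm c orb F)"

definition crosses :: "complex set \<Rightarrow> complex set \<Rightarrow> bool" where
  "crosses s t \<longleftrightarrow> rel_interior s \<inter> rel_interior t \<noteq> {}"

subsection \<open>The groups of types A, B and I, with the chosen orbits\<close>

text \<open>
  In type A, \<open>V\<close> is the sum-zero hyperplane, and the class of \<open>e\<^sub>i\<close> modulo \<open>(1,\<dots>,1)\<close> is represented
  by the orthogonal projection of \<open>e\<^sub>i\<close> to it.
\<close>

definition type_A :: "nat \<Rightarrow> (real^'n \<Rightarrow> real^'n) set \<Rightarrow> (real^'n) set \<Rightarrow> bool" where
  "type_A n W orb \<longleftrightarrow> CARD('n) = n + 1 \<and>
     W = {\<lambda>x. \<chi> i. x $ p i | p. bij p} \<and>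
     orb = {axis i 1 - vec (1 / real (n + 1)) | i. True}"

definition type_B :: "nat \<Rightarrow> (real^'n \<Rightarrow> real^'n) set \<Rightarrow> (real^'n) set \<Rightarrow> bool" where
  "type_B n W orb \<longleftrightarrow> CARD('n) = n \<and>
     W = {\<lambda>x. \<chi> i. e i * x $ p i | p e. bij p \<and> (\<forall>i. e i \<in> {1, -1})} \<and>
     orb = {axis i 1 | i. True} \<union> {- axis i 1 | i. True}"

inductive_set generated_by_reflections :: "'a::real_inner set \<Rightarrow> ('a \<Rightarrow> 'a) set"
  for A :: "'a::real_inner set" where
  id: "id \<in> generated_by_reflections A"
| step: "a \<in> A \<Longrightarrow> w \<in> generated_by_reflections A \<Longrightarrow>
           reflection a \<circ> w \<in> generated_by_reflections A"

text \<open>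
  A regular \<open>m\<close>-gon that is an orbit of a dihedral group fixing only the origin is centred at the
  origin.
\<close>

definition regular_polygon_vertices :: "nat \<Rightarrow> 'a::real_inner set \<Rightarrow> bool" where
  "regular_polygon_vertices m X \<longleftrightarrow> (\<exists>u v. norm u = norm v \<and> u \<noteq> 0 \<and> u \<bullet> v = 0 \<and>
     X = {cos (2 * pi * real k / real m) *\<^sub>R u + sin (2 * pi * real k / real m) *\<^sub>R v | k. k < m})"

definition type_I2 :: "nat \<Rightarrow> (real^'n \<Rightarrow> real^'n) set \<Rightarrow> (real^'n) set \<Rightarrow> bool" where
  "type_I2 m W orb \<longleftrightarrow> CARD('n) = 2 \<and>
     (\<exists>a b. a \<noteq> 0 \<and> b \<noteq> 0 \<and> W = generated_by_reflections {a, b}) \<and> card W = 2 * m \<and>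
     (\<exists>x. orb = (\<lambda>w. w x) ` W) \<and> regular_polygon_vertices m orb"

end

theory Submission
  imports Defs
begin

text \<open>
  In all three types, every difference of two elements of the orbit \<open>o\<close> is normal to a reflecting
  hyperplane. Hence the order \<open>x > y \<longleftrightarrow> x - y\<close> is a nonnegative combination of simple roots is total
  on \<open>o = {x\<^sub>0 > \<dots> > x\<^bsub>h-1\<^esub>}\<close>, consecutive elements differ by a multiple of a simple root \<open>s\<^sub>i\<close>, and the
  \<open>s\<^sub>i\<close> alternate between \<open>S\<^sub>+\<close> and \<open>S\<^sub>-\<close>. Thus \<open>W\<close> acts on \<open>o\<close> as a subgroup of the symmetric group of
  degree \<open>h\<close>, in which each simple reflection is a product of commuting adjacent transpositions.

  In the Coxeter plane \<open>c\<^sub>+\<close> and \<open>c\<^sub>-\<close> are the reflections in the lines of \<open>\<mu>\<close> and \<open>\<lambda>\<close>, which places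
  \<open>x\<^sub>0, x\<^sub>1, \<dots>\<close> along a zigzag. With one new vertex at either end this becomes a zigzag
  \<open>u\<^sub>0, \<dots>, u\<^bsub>h+1\<^esub>\<close> through the vertices of the \<open>(h+2)\<close>-gon, \<open>x\<^sub>i\<close> corresponding to \<open>u\<^bsub>i+1\<^esub>\<close>. The diagram of
  \<open>-\<alpha>\<^sub>s\<close> consists of the segments \<open>u\<^bsub>i+1\<^esub> u\<^bsub>i+2\<^esub>\<close> with \<open>s\<^sub>i = s\<close>, and that of a positive root \<open>\<beta>\<close> of the
  segments \<open>u\<^sub>i u\<^bsub>j+2\<^esub>\<close> with \<open>x\<^sub>i - x\<^sub>j\<close> a positive multiple of \<open>\<beta>\<close>. Such a segment crosses \<open>u\<^bsub>k+1\<^esub> u\<^bsub>k+2\<^esub>\<close> iff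
  \<open>i \<le> k < j\<close>, that is, iff \<open>s\<^sub>k\<close> occurs in \<open>x\<^sub>i - x\<^sub>j = (x\<^sub>i - x\<^bsub>i+1\<^esub>) + \<dots> + (x\<^bsub>j-1\<^esub> - x\<^sub>j)\<close>. So noncrossing
  satisfies the axioms of compatibility.
\<close>

subsection \<open>Reflections\<close>

lemma linear_reflection: "linear (reflection a)"
  by (rule linearI) (simp_all add: reflection_def inner_add_left algebra_simps add_divide_distrib)

lemma reflection_fixed: "x \<bullet> a = 0 \<Longrightarrow> reflection a x = x"
  by (simp add: reflection_def)

lemma reflection_self: "reflection a a = - a"
  by (cases "a = 0") (simp_all add: reflection_def scaleR_2)

lemma reflection_adjoint: "reflection a x \<bullet> y = x \<bullet> reflection a y"
  by (simp add: reflection_def inner_diff_left inner_diff_right inner_commute)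

lemma reflection_involution: "reflection a (reflection a x) = x"
  by (cases "a = 0") (simp_all add: reflection_def inner_diff_left algebra_simps flip: scaleR_add_left)

lemma reflection_inner: "reflection a x \<bullet> reflection a y = x \<bullet> y"
  by (simp add: reflection_adjoint reflection_involution)

lemma reflection_scaleR: "k \<noteq> 0 \<Longrightarrow> reflection (k *\<^sub>R a) = reflection a"
  by (rule ext) (simp add: reflection_def field_simps)

text \<open>Expanding the equality of norms gives
  \<open>2 * (x \<bullet> a) = t * (a \<bullet> a)\<close>, which is the coefficient in the
  reflection. Differences of orbit elements are turned into reflections this way.\<close>

lemma reflection_swap:
  assumes "norm x = norm y" "x - y = t *\<^sub>R a" "t \<noteq> 0"
  shows "reflection a x = y"
proof (cases "a = 0")
  case True
  then show ?thesis using assms(2) by (simp add: reflection_def)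
next
  case False
  have y: "y = x - t *\<^sub>R a" using assms(2) by (simp add: algebra_simps)
  have "x \<bullet> x = y \<bullet> y" using assms(1) by (simp add: norm_eq)
  then have "t * (2 * (x \<bullet> a)) = t * (t * (a \<bullet> a))"
    unfolding y by (simp add: inner_diff_left inner_diff_right inner_commute algebra_simps)
  then have "2 * (x \<bullet> a) = t * (a \<bullet> a)" using assms(3) by simp
  then show ?thesis using False by (simp add: reflection_def y)
qed

text \<open>Commutation makes \<open>reflection a\<close> negate \<open>reflection b a\<close>, so
  that vector lies on the line of \<open>a\<close>. Then \<open>a - reflection b a\<close>, a
  multiple of \<open>b\<close>, lies there too; unless \<open>b\<close> does, its coefficient is
  0.\<close>

lemma commuting_reflections:
  assumes "reflection a \<circ> reflection b = reflection b \<circ> reflection a"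
  shows "a \<bullet> b = 0 \<or> b \<in> span {a}"
proof (rule disjCI)
  assume nb: "b \<notin> span {a}"
  define y where "y = reflection b a"
  have "reflection a y = - y"
    using fun_cong[OF assms, of a] linear_neg[OF linear_reflection, of b a]
    by (simp add: y_def reflection_self)
  then have "y + y = (2 * (y \<bullet> a) / (a \<bullet> a)) *\<^sub>R a"
    by (simp add: reflection_def algebra_simps)
  then have "2 *\<^sub>R y \<in> span {a}"
    by (metis scaleR_2 span_base span_scale singletonI)
  then have y: "y \<in> span {a}" using span_scale[of "2 *\<^sub>R y" "{a}" "1/2"] by simp
  have "(2 * (a \<bullet> b) / (b \<bullet> b)) *\<^sub>R b = a - y" by (simp add: y_def reflection_def)
  then have "(2 * (a \<bullet> b) / (b \<bullet> b)) *\<^sub>R b \<in> span {a}"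
    using y by (simp add: span_base span_diff)
  then have "2 * (a \<bullet> b) / (b \<bullet> b) = 0"
    using nb span_scale[of "(2 * (a \<bullet> b) / (b \<bullet> b)) *\<^sub>R b" "{a}" "inverse (2 * (a \<bullet> b) / (b \<bullet> b))"]
    by (metis right_inverse mult.commute scaleR_scaleR scaleR_one)
  then show "a \<bullet> b = 0" by auto
qed

lemma orthogonal_reflections_commute:
  assumes "a \<bullet> b = 0"
  shows "reflection a \<circ> reflection b = reflection b \<circ> reflection a"
  using assms by (intro ext) (simp add: reflection_def inner_diff_left inner_commute algebra_simps)

text \<open>Orthogonality makes the factors commute, so the fold does not depend on an order, and no
  factor changes the inner products with the other roots, so the displacements add up.\<close>

lemma reflection_prod_eq:
  assumes "finite D" and orth: "\<And>a b. a \<in> D \<Longrightarrow> b \<in> D \<Longrightarrow> a \<noteq> b \<Longrightarrow> a \<bullet> b = 0"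
  shows "reflection_prod D x = x - (\<Sum>a\<in>D. (2 * (x \<bullet> a) / (a \<bullet> a)) *\<^sub>R a)"
proof -
  interpret comp_fun_commute_on D "\<lambda>a f. reflection a \<circ> f"
  proof
    fix a b assume "a \<in> D" "b \<in> D"
    then have "reflection a \<circ> reflection b = reflection b \<circ> reflection a"
      using orth orthogonal_reflections_commute by (cases "a = b") auto
    then show "(\<circ>) (reflection b) \<circ> (\<circ>) (reflection a) = (\<circ>) (reflection a) \<circ> (\<circ>) (reflection b)"
      by (simp add: fun_eq_iff)
  qed
  have "finite E \<Longrightarrow> E \<subseteq> D \<Longrightarrow> reflection_prod E x = x - (\<Sum>a\<in>E. (2 * (x \<bullet> a) / (a \<bullet> a)) *\<^sub>R a)" for E
  proof (induction E rule: finite_induct)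
    case empty
    then show ?case by (simp add: reflection_prod_def)
  next
    case (insert a E)
    have "b \<bullet> a = 0" if "b \<in> E" for b
      using orth[of b a] that insert by auto
    then have "(\<Sum>b\<in>E. (2 * (x \<bullet> b) / (b \<bullet> b)) *\<^sub>R b) \<bullet> a = 0"
      by (simp add: inner_sum_left)
    moreover have "reflection_prod (insert a E) x = reflection a (reflection_prod E x)"
      using insert fold_insert[of a E] by (simp add: reflection_prod_def)
    ultimately show ?case
      using insert by (simp add: reflection_def inner_diff_left)
  qed
  then show ?thesis using assms(1) by blast
qed

lemma reflection_prod_empty: "reflection_prod {} = id"
  by (simp add: reflection_prod_def)

lemma reflection_prod_insert:
  assumes "finite D" "a \<notin> D"
    and "\<And>b c. b \<in> insert a D \<Longrightarrow> c \<in> insert a D \<Longrightarrow> b \<noteq> c \<Longrightarrow> b \<bullet> c = 0"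
  shows "reflection_prod (insert a D) x = reflection a (reflection_prod D x)"
proof -
  have "(\<Sum>b\<in>D. (2 * (x \<bullet> b) / (b \<bullet> b)) *\<^sub>R b) \<bullet> a = 0"
    unfolding inner_sum_left using assms(2,3) by (intro sum.neutral) auto
  moreover have "reflection_prod D x = x - (\<Sum>b\<in>D. (2 * (x \<bullet> b) / (b \<bullet> b)) *\<^sub>R b)"
    "reflection_prod (insert a D) x = x - (\<Sum>b\<in>insert a D. (2 * (x \<bullet> b) / (b \<bullet> b)) *\<^sub>R b)"
    using reflection_prod_eq[of D x] reflection_prod_eq[of "insert a D" x] assms by blast+
  ultimately show ?thesis using assms(1,2) by (simp add: reflection_def inner_diff_left)
qed

lemma reflection_prod_isometry:
  assumes "finite D" "\<And>a b. a \<in> D \<Longrightarrow> b \<in> D \<Longrightarrow> a \<noteq> b \<Longrightarrow> a \<bullet> b = 0"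
  shows "reflection_prod D x \<bullet> reflection_prod D y = x \<bullet> y"
  using assms
proof (induction D rule: finite_induct)
  case (insert a D)
  then show ?case by (subst (1 2) reflection_prod_insert) (auto simp: reflection_inner)
qed (simp add: reflection_prod_empty)

lemma reflection_prod_stable:
  assumes "finite D" "\<And>a b. a \<in> D \<Longrightarrow> b \<in> D \<Longrightarrow> a \<noteq> b \<Longrightarrow> a \<bullet> b = 0"
    and "\<And>a x. a \<in> D \<Longrightarrow> x \<in> X \<Longrightarrow> reflection a x \<in> X" "x \<in> X"
  shows "reflection_prod D x \<in> X"
  using assms
proof (induction D rule: finite_induct)
  case (insert a D)
  then show ?case by (subst reflection_prod_insert) auto
qed (simp add: reflection_prod_empty)

text \<open>The displacement of any vector lies in \<open>span T\<close> and is orthogonal to it.\<close>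

lemma isometry_trivial:
  assumes iso: "\<And>x y. g x \<bullet> g y = x \<bullet> y"
    and disp: "\<And>y. g y - y \<in> span T" and fix_T: "\<And>a. a \<in> T \<Longrightarrow> g a = a"
  shows "g = id"
proof
  fix y
  have "orthogonal (g y - y) a" if "a \<in> T" for a
    using iso[of y a] fix_T[OF that] by (simp add: orthogonal_def inner_diff_left)
  then have "orthogonal (g y - y) (g y - y)"
    using disp orthogonal_to_span by blast
  then show "g y = id y" by (simp add: orthogonal_def)
qed

section \<open>Orders of maps\<close>

lemma map_order_finite:
  assumes "0 < k" "f ^^ k = id"
  shows "0 < map_order f" "f ^^ map_order f = id"
  using LeastI[of "\<lambda>k. 0 < k \<and> f ^^ k = id" k] assms unfolding map_order_def by auto

lemma map_order_eqI:
  assumes "0 < h" "f ^^ h = id" "\<And>k. 0 < k \<Longrightarrow> f ^^ k = id \<Longrightarrow> h \<le> k"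
  shows "map_order f = h"
  unfolding map_order_def using assms by (intro Least_equality) auto

text \<open>Pigeonhole on the restrictions of the powers of \<open>f\<close> to \<open>X\<close>:
  two coincide, and injectivity cancels the smaller power.\<close>

lemma inj_finite_orbit_power:
  assumes inj: "inj f" and "finite X" and stable: "f ` X \<subseteq> X"
  obtains k where "0 < k" "\<And>x. x \<in> X \<Longrightarrow> (f ^^ k) x = x"
proof -
  have mem: "(f ^^ k) x \<in> X" if "x \<in> X" for k x
    using that stable by (induction k) auto
  have "range (\<lambda>k. restrict (f ^^ k) X) \<subseteq> PiE X (\<lambda>_. X)"
    using mem by auto
  moreover have "finite (PiE X (\<lambda>_. X))" using \<open>finite X\<close> by (simp add: finite_PiE)
  ultimately have "finite (range (\<lambda>k. restrict (f ^^ k) X))" by (rule finite_subset)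
  then have "\<not> inj (\<lambda>k. restrict (f ^^ k) X)"
    using range_inj_infinite by blast
  then obtain i j where ij: "i < j" "restrict (f ^^ i) X = restrict (f ^^ j) X"
    by (metis (no_types, lifting) injI linorder_neqE_nat)
  have "(f ^^ (j - i)) x = x" if "x \<in> X" for x
  proof -
    have "(f ^^ i) ((f ^^ (j - i)) x) = (f ^^ j) x"
      using ij(1) fun_cong[OF funpow_add[of i "j - i" f], of x] by simp
    also have "\<dots> = (f ^^ i) x"
      using ij(2) that by (metis restrict_apply')
    finally show ?thesis using inj_fn[OF inj, of i] by (simp add: inj_eq)
  qed
  then show thesis using that[of "j - i"] ij by simp
qed

subsection \<open>Chords of a circle and the zigzag of a polygon\<close>

text \<open>For distinct end points, the point is inside the circle iff \<open>s * (1 - s)\<close>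
  is positive, that is, iff it lies strictly between them.\<close>

lemma norm_chord_point:
  fixes A B :: "'a::real_inner"
  assumes "norm A = r" "norm B = r"
  shows "(norm ((1 - s) *\<^sub>R A + s *\<^sub>R B))\<^sup>2 = r\<^sup>2 - s * (1 - s) * (norm (A - B))\<^sup>2"
proof -
  have "A \<bullet> A = r\<^sup>2" "B \<bullet> B = r\<^sup>2" using assms by (auto simp: dot_square_norm)
  then show ?thesis
    unfolding power2_norm_eq_inner
    by (simp add: inner_add_left inner_add_right inner_diff_left inner_diff_right inner_commute
        algebra_simps power2_eq_square)
qed

lemma crosses_iff:
  assumes "A \<noteq> B" "C \<noteq> D"
  shows "crosses (closed_segment A B) (closed_segment C D) \<longleftrightarrow>
    (\<exists>s t. 0 < s \<and> s < 1 \<and> 0 < t \<and> t < 1 \<and>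
      (1 - s) *\<^sub>R A + s *\<^sub>R B = (1 - t) *\<^sub>R C + t *\<^sub>R D)"
  using assms unfolding crosses_def rel_interior_closed_segment
  by (auto simp: in_segment disjoint_iff)

text \<open>\<open>\<lambda>z. Re (z * w)\<close> is a real linear functional with value
  \<open>k\<close> all along \<open>C D\<close>. Inside \<open>A B\<close> it takes strict means of
  two values on one side of \<open>k\<close>, not both equal to \<open>k\<close>.\<close>

lemma not_crosses_one_side:
  assumes "C \<noteq> D" and zero: "Re (C * w) = k" "Re (D * w) = k"
    and side: "Re (A * w) \<ge> k \<and> Re (B * w) > k \<or> Re (A * w) > k \<and> Re (B * w) \<ge> k \<or>
      Re (A * w) \<le> k \<and> Re (B * w) < k \<or> Re (A * w) < k \<and> Re (B * w) \<le> k"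
  shows "\<not> crosses (closed_segment A B) (closed_segment C D)"
\<comment> \<open>A one-point segment is its own relative interior, a case outside
  \<open>crosses_iff\<close>.\<close>
proof (cases "A = B")
  case True
  have "Re (A * w) = k" if "A \<in> open_segment C D"
  proof -
    obtain u where "A = (1 - u) *\<^sub>R C + u *\<^sub>R D" using \<open>A \<in> _\<close> by (auto simp: in_segment)
    then have "Re (A * w) = Re (((1 - u) *\<^sub>R C + u *\<^sub>R D) * w)" by simp
    also have "\<dots> = (1 - u) * Re (C * w) + u * Re (D * w)" by (simp add: algebra_simps)
    finally show ?thesis using zero by (simp add: algebra_simps)
  qed
  then show ?thesis
    using True side \<open>C \<noteq> D\<close> unfolding crosses_def rel_interior_closed_segment by auto
next
  case False
  show ?thesis
  proof
    assume "crosses (closed_segment A B) (closed_segment C D)"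
    then obtain s t where st: "0 < s" "s < 1" 
      "(1 - s) *\<^sub>R A + s *\<^sub>R B = (1 - t) *\<^sub>R C + t *\<^sub>R D"
      using crosses_iff[OF False \<open>C \<noteq> D\<close>] by blast
    have "Re (((1 - s) *\<^sub>R A + s *\<^sub>R B) * w) = Re (((1 - t) *\<^sub>R C + t *\<^sub>R D) * w)"
      using st by simp
    then have "(1 - s) * Re (A * w) + s * Re (B * w) = (1 - t) * Re (C * w) + t * Re (D * w)"
      by (simp add: algebra_simps)
    also have "\<dots> = k" using zero by (simp add: algebra_simps)
    finally have "(1 - s) * (Re (A * w) - k) + s * (Re (B * w) - k) = 0"
      by (simp add: algebra_simps)
    moreover have "0 < 1 - s" using st by simp
    ultimately show False
      using side \<open>0 < s\<close>
      by (smt (verit) mult_pos_pos mult_nonneg_nonneg mult_pos_neg mult_nonneg_nonpos)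
  qed
qed

text \<open>The chord \<open>A B\<close> meets the line through \<open>C\<close> and \<open>D\<close> inside the open disk, hence between
  \<open>C\<close> and \<open>D\<close>.\<close>

lemma crosses_opposite_sides:
  assumes "C \<noteq> D" "w \<noteq> 0" and zero: "Re (C * w) = k" "Re (D * w) = k"
    and sides: "Re (A * w) > k" "Re (B * w) < k"
    and circle: "norm A = r" "norm B = r" "norm C = r" "norm D = r"
  shows "crosses (closed_segment A B) (closed_segment C D)"
proof -
  have "A \<noteq> B" using sides by auto
  define a b where "a = Re (A * w) - k" and "b = k - Re (B * w)"
  define s where "s = a / (a + b)"
  define p where "p = (1 - s) *\<^sub>R A + s *\<^sub>R B"
  have ab: "a > 0" "b > 0" using sides by (auto simp: a_def b_def)
  have s: "0 < s" "s < 1" using ab by (auto simp: s_def)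
  have "Re (p * w) = (1 - s) * Re (A * w) + s * Re (B * w)"
    by (simp add: p_def algebra_simps)
  also have "\<dots> = k + ((1 - s) * a - s * b)" by (simp add: a_def b_def algebra_simps)
  also have "(1 - s) * a - s * b = 0" using ab by (simp add: s_def field_simps)
  finally have p0: "Re (p * w) = k" by simp
  \<comment> \<open>Multiplied by \<open>w\<close>, both \<open>p - C\<close> and
    \<open>D - C\<close> are purely imaginary. Their ratio \<open>t\<close> is therefore real, which
    puts \<open>p\<close> on the line through \<open>C\<close> and \<open>D\<close>.\<close>
  define y1 y2 where "y1 = Im ((p - C) * w)" and "y2 = Im ((D - C) * w)"
  have e1: "(p - C) * w = \<i> * of_real y1" and e2: "(D - C) * w = \<i> * of_real y2"
    using p0 zero by (auto simp: complex_eq_iff y1_def y2_def algebra_simps)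
  have "y2 \<noteq> 0" using e2 \<open>C \<noteq> D\<close> \<open>w \<noteq> 0\<close> by auto
  define t where "t = y1 / y2"
  have "(p - C) * w = of_real t * ((D - C) * w)"
    unfolding e1 e2 t_def using \<open>y2 \<noteq> 0\<close> by (simp add: field_simps)
  then have "p - C = of_real t * (D - C)" using \<open>w \<noteq> 0\<close> by simp
  then have pt: "p = (1 - t) *\<^sub>R C + t *\<^sub>R D"
    by (simp add: scaleR_conv_of_real algebra_simps)
  have "(norm p)\<^sup>2 < r\<^sup>2"
    unfolding p_def norm_chord_point[OF circle(1,2)] using s \<open>A \<noteq> B\<close> by simp
  then have "0 < t * (1 - t) * (norm (C - D))\<^sup>2"
    unfolding pt norm_chord_point[OF circle(3,4)] by simp
  then have "0 < t * (1 - t)" by (simp add: zero_less_mult_iff)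
  then have "0 < t \<and> t < 1" by (auto simp: zero_less_mult_iff)
  then show ?thesis
    using crosses_iff[OF \<open>A \<noteq> B\<close> \<open>C \<noteq> D\<close>] s pt p_def by metis
qed

section \<open>Reflections of the plane in lines\<close>

lemma linear_line_reflection: "linear (line_reflection \<theta>)"
  by (rule linearI) (simp_all add: line_reflection_def algebra_simps)

lemma line_reflection_rcis: "line_reflection \<theta> (rcis r a) = rcis r (2 * \<theta> - a)"
  by (simp add: line_reflection_def rcis_def cis_cnj cis_mult algebra_simps)

lemma inj_line_reflection: "inj (line_reflection \<theta>)"
  by (rule injI) (simp add: line_reflection_def)

lemma line_reflection_segment:
  "line_reflection \<theta> ` closed_segment a b = closed_segment (line_reflection \<theta> a) (line_reflection \<theta> b)"
  by (simp add: closed_segment_linear_image[OF linear_line_reflection])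

lemma crosses_line_reflection:
  "crosses (line_reflection \<theta> ` s) (line_reflection \<theta> ` t) \<longleftrightarrow> crosses s t"
  unfolding crosses_def
  by (simp add: rel_interior_injective_linear_image linear_line_reflection inj_line_reflection
      linear_linear flip: image_Int)

text \<open>The vertices of the \<open>(h+2)\<close>-gon are listed along a zigzag: \<open>i\<close> runs from \<open>0\<close> to \<open>h + 1\<close>,
  consecutive vertices are joined by diagonals of two alternating directions, except for the first
  and the last pair, which span edges. Angles are in units of \<open>\<pi>/(h+2)\<close>.\<close>

definition zigzag_angle :: "bool \<Rightarrow> nat \<Rightarrow> real" where
  "zigzag_angle e i = (if even i = e then real i + 2 else 1 - real i)"

definition zigzag_vertex :: "real \<Rightarrow> nat \<Rightarrow> bool \<Rightarrow> nat \<Rightarrow> complex" where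
  "zigzag_vertex r h e i = rcis r (zigzag_angle e i * pi / real (h + 2))"

text \<open>An end without a partner is fixed: \<open>n\<close> by the minimum, \<open>0\<close> by truncated subtraction.\<close>

definition zigzag_swap :: "nat \<Rightarrow> bool \<Rightarrow> nat \<Rightarrow> nat" where
  "zigzag_swap n e i = (if even i = e then min (Suc i) n else i - 1)"

lemma rcis_add_2pi: "rcis r (a + 2 * pi) = rcis r a"
  by (simp add: rcis_def complex_eq_iff)

lemma rcis_diff_2pi: "rcis r (a - 2 * pi) = rcis r a"
  using rcis_add_2pi[of r "a - 2 * pi"] by simp

text \<open>In units of \<pi>/(h+2) the reflections send an angle \<open>a\<close> to
  \<open>2 - a\<close> and to \<open>4 - a\<close>. The first exchanges \<open>i + 2\<close> with
  \<open>1 - (i + 1)\<close>, the second \<open>1 - i\<close> with \<open>(i + 1) + 2\<close>: in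
  both cases the angles of consecutive vertices.\<close>

lemma line_reflection_zigzag:
  assumes "i \<le> Suc h"
  shows "line_reflection (pi / real (h + 2)) (zigzag_vertex r h e i) =
      zigzag_vertex r h e (zigzag_swap (Suc h) e i)" (is ?thesis1)
    and "line_reflection (2 * pi / real (h + 2)) (zigzag_vertex r h e i) =
      zigzag_vertex r h e (zigzag_swap (Suc h) (\<not> e) i)" (is ?thesis2)
proof -
  define N where "N = real (h + 2)"
  have N: "N > 0" "real h = N - 2" by (auto simp: N_def)
  \<comment> \<open>A shift by a full turn, \<open>2 * N\<close> units, occurs only for the last
    vertex when it has no partner; its sign depends on the reflection.\<close>
  have *: "rcis r (x * pi / N) = rcis r (y * pi / N)" if "x = y \<or> x = y - 2 * N \<or> x = y + 2 * N" for x y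
    using that
  proof (elim disjE)
    assume x: "x = y - 2 * N"
    have "x * pi / N = y * pi / N - 2 * pi" unfolding x using N(1) by (simp add: field_simps)
    then show ?thesis by (simp only: rcis_diff_2pi)
  next
    assume x: "x = y + 2 * N"
    have "x * pi / N = y * pi / N + 2 * pi" unfolding x using N(1) by (simp add: field_simps)
    then show ?thesis by (simp only: rcis_add_2pi)
  qed simp
  have 1: "2 * (pi / N) - x * pi / N = (2 - x) * pi / N"
    "2 * (2 * pi / N) - x * pi / N = (4 - x) * pi / N" for x
    using N by (auto simp: field_simps)
  show ?thesis1
    unfolding zigzag_vertex_def line_reflection_rcis N_def[symmetric] 1
    by (rule *) (cases i; use assms N in \<open>auto simp: zigzag_angle_def zigzag_swap_def min_def le_Suc_eq\<close>)
  show ?thesis2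
    unfolding zigzag_vertex_def line_reflection_rcis N_def[symmetric] 1
    by (rule *) (cases i; use assms N in \<open>auto simp: zigzag_angle_def zigzag_swap_def min_def le_Suc_eq\<close>)
qed

section \<open>Position of the vertices relative to one diagonal of the zigzag\<close>

context
  fixes r :: real and h :: nat and e :: bool and i :: nat
  assumes r: "r > 0" and i: "Suc i < h"
begin

text \<open>Rotation by 1 or 2 units that takes the vertices \<open>i + 1\<close> and
  \<open>i + 2\<close> to opposite angles of size \<open>i + 2\<close>. Their diagonal becomes
  vertical, with real part \<open>chord_height\<close>.\<close>

definition "chord_normal = cis (- (if even (Suc i) = e then 1 else 2) * pi / real (h + 2))"

definition "chord_height = r * cos (real (i + 2) * pi / real (h + 2))"

text \<open>After the rotation the angle of vertex \<open>j\<close> is \<open>Suc j\<close> or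
  \<open>j\<close> up to sign, and the cosine forgets the sign. So the vertices come in pairs of
  equal height, \<open>{i + 1, i + 2}\<close> being one of them.\<close>

lemma zigzag_height:
  "Re (zigzag_vertex r h e j * chord_normal) =
    r * cos (real (if even j = even (Suc i) then Suc j else j) * pi / real (h + 2))"
proof -
  define N where "N = real (h + 2)"
  define m :: real where "m = (if even (Suc i) = e then 1 else 2)"
  have "zigzag_vertex r h e j * chord_normal = rcis r ((zigzag_angle e j - m) * pi / N)"
    by (simp add: zigzag_vertex_def chord_normal_def rcis_def cis_mult diff_divide_distrib algebra_simps
        N_def m_def)
  moreover have "\<bar>zigzag_angle e j - m\<bar> = real (if even j = even (Suc i) then Suc j else j)"
    by (auto simp: zigzag_angle_def m_def)
  then have "cos ((zigzag_angle e j - m) * pi / N) =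
    cos (real (if even j = even (Suc i) then Suc j else j) * pi / N)"
    by (smt (verit) cos_minus minus_divide_left mult_minus_left)
  ultimately show ?thesis by (simp add: N_def)
qed

text \<open>All unsigned angles lie in the interval from 0 to \<pi>, where the cosine is strictly
  decreasing, so the height drops from each pair to the next along the zigzag.\<close>

lemma zigzag_height_sign:
  assumes "j \<le> Suc h"
  shows "j \<le> i \<Longrightarrow> Re (zigzag_vertex r h e j * chord_normal) > chord_height"
    and "j = i + 1 \<or> j = i + 2 \<Longrightarrow> Re (zigzag_vertex r h e j * chord_normal) = chord_height"
    and "j \<ge> i + 3 \<Longrightarrow> Re (zigzag_vertex r h e j * chord_normal) < chord_height"
proof -
  define d where "d = (if even j = even (Suc i) then Suc j else j)"
  have le_pi: "real n * pi / real (h + 2) \<le> pi" if "n \<le> h + 2" for n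
    using mult_right_mono[of "real n" "real (h + 2)" pi] that
    by (simp only: divide_le_eq of_nat_le_iff pi_ge_zero) (simp add: mult.commute)
  have nonneg: "0 \<le> real n * pi / real (h + 2)" for n
    by simp
  have less_iff: "real m * pi / real (h + 2) < real n * pi / real (h + 2) \<longleftrightarrow> m < n" for m n
    by (simp add: divide_less_cancel)
  have "real d * pi / real (h + 2) \<le> pi" "real (i + 2) * pi / real (h + 2) \<le> pi"
    using le_pi[of d] le_pi[of "i + 2"] i assms by (auto simp: d_def)
  then have *: "cos (real d * pi / real (h + 2)) < cos (real (i + 2) * pi / real (h + 2)) \<longleftrightarrow> i + 2 < d"
    "cos (real d * pi / real (h + 2)) > cos (real (i + 2) * pi / real (h + 2)) \<longleftrightarrow> d < i + 2"
    by (simp_all only: cos_mono_less_eq less_iff nonneg)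
  show "j \<le> i \<Longrightarrow> Re (zigzag_vertex r h e j * chord_normal) > chord_height"
    unfolding zigzag_height chord_height_def d_def[symmetric] using r *(2) by (auto simp: d_def)
  show "j \<ge> i + 3 \<Longrightarrow> Re (zigzag_vertex r h e j * chord_normal) < chord_height"
    unfolding zigzag_height chord_height_def d_def[symmetric] using r *(1) by (auto simp: d_def)
  show "j = i + 1 \<or> j = i + 2 \<Longrightarrow> Re (zigzag_vertex r h e j * chord_normal) = chord_height"
    unfolding zigzag_height chord_height_def by auto
qed

lemma zigzag_height_side:
  assumes "j \<le> Suc h"
  shows "j \<le> i + 2 \<Longrightarrow> Re (zigzag_vertex r h e j * chord_normal) \<ge> chord_height"
    and "j \<ge> i + 1 \<Longrightarrow> Re (zigzag_vertex r h e j * chord_normal) \<le> chord_height"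
proof -
  have "j \<le> i \<or> j = i + 1 \<or> j = i + 2 \<or> j \<ge> i + 3" by linarith
  then show "j \<le> i + 2 \<Longrightarrow> Re (zigzag_vertex r h e j * chord_normal) \<ge> chord_height"
    and "j \<ge> i + 1 \<Longrightarrow> Re (zigzag_vertex r h e j * chord_normal) \<le> chord_height"
    using zigzag_height_sign[OF assms] by (elim disjE; simp)+
qed

text \<open>After the rotation the imaginary parts are opposite, and nonzero because
  \<open>0 < i + 2 < h + 2\<close>.\<close>

lemma zigzag_step_distinct: "zigzag_vertex r h e (i + 1) \<noteq> zigzag_vertex r h e (i + 2)"
proof
  assume eq: "zigzag_vertex r h e (i + 1) = zigzag_vertex r h e (i + 2)"
  define N where "N = real (h + 2)"
  have N: "N > 0" "real (i + 2) < N" using i by (auto simp: N_def)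
  have z: "zigzag_vertex r h e j * chord_normal =
      rcis r ((zigzag_angle e j - (if even (Suc i) = e then 1 else 2)) * pi / N)" for j
    by (simp add: zigzag_vertex_def chord_normal_def rcis_def cis_mult diff_divide_distrib algebra_simps
        N_def)
  have "Im (zigzag_vertex r h e (i + 1) * chord_normal) = Im (zigzag_vertex r h e (i + 2) * chord_normal)"
    using eq by simp
  then have "r * sin (real (i + 2) * pi / N) = r * sin (- (real (i + 2) * pi / N))"
    unfolding z by (auto simp: zigzag_angle_def algebra_simps add_divide_distrib diff_divide_distrib split: if_splits)
  moreover have "sin (real (i + 2) * pi / N) > 0"
    using N mult_strict_right_mono[OF N(2) pi_gt_zero]
    by (intro sin_gt_zero) (simp_all only: divide_less_eq, simp_all add: mult.commute)
  ultimately show False using r by simp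
qed

text \<open>The diagonal separates the vertices up to \<open>i\<close> from those from
  \<open>i + 3\<close> on. If \<open>b \<le> i\<close> or \<open>i < a\<close>, both ends of the
  chord are weakly on one side and at least one strictly.\<close>

lemma zigzag_crosses_iff:
  assumes "a < b" "b < h"
  shows "crosses (closed_segment (zigzag_vertex r h e a) (zigzag_vertex r h e (b + 2)))
      (closed_segment (zigzag_vertex r h e (i + 1)) (zigzag_vertex r h e (i + 2))) \<longleftrightarrow> a \<le> i \<and> i < b"
proof -
  let ?z = "zigzag_vertex r h e"
  have zero: "Re (?z (i + 1) * chord_normal) = chord_height" "Re (?z (i + 2) * chord_normal) = chord_height"
    using zigzag_height_sign(2)[of "i + 1"] zigzag_height_sign(2)[of "i + 2"] i by auto
  show ?thesis
  proof (cases "a \<le> i \<and> i < b")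
    case True
    have "crosses (closed_segment (?z a) (?z (b + 2))) (closed_segment (?z (i + 1)) (?z (i + 2)))"
    proof (rule crosses_opposite_sides[OF zigzag_step_distinct _ zero])
      show "chord_normal \<noteq> 0" by (simp add: chord_normal_def)
      show "Re (?z a * chord_normal) > chord_height" using zigzag_height_sign(1)[of a] True assms by auto
      show "Re (?z (b + 2) * chord_normal) < chord_height"
        using zigzag_height_sign(3)[of "b + 2"] True assms by auto
    qed (use r in \<open>auto simp: zigzag_vertex_def\<close>)
    then show ?thesis using True by blast
  next
    case False
    have "Re (?z a * chord_normal) > chord_height \<and> Re (?z (b + 2) * chord_normal) \<ge> chord_height"
      if "b \<le> i"
      using that assms zigzag_height_sign(1)[of a] zigzag_height_side(1)[of "b + 2"] by auto
    moreover have "Re (?z a * chord_normal) \<le> chord_height \<and> Re (?z (b + 2) * chord_normal) < chord_height"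
      if "i < a"
      using that assms zigzag_height_sign(3)[of "b + 2"] zigzag_height_side(2)[of a] by auto
    ultimately show ?thesis
      using False not_crosses_one_side[OF zigzag_step_distinct zero, of "?z a" "?z (b + 2)"]
      by (auto simp: not_le not_less)
  qed
qed

text \<open>Another diagonal of the zigzag shares at most one vertex with this one and lies on one
  side of it. This makes negative simple roots pairwise noncrossing.\<close>

lemma zigzag_steps_not_crosses:
  assumes "Suc k < h" "k \<noteq> i"
  shows "\<not> crosses (closed_segment (zigzag_vertex r h e (k + 1)) (zigzag_vertex r h e (k + 2)))
      (closed_segment (zigzag_vertex r h e (i + 1)) (zigzag_vertex r h e (i + 2)))"
proof -
  let ?z = "zigzag_vertex r h e"
  have zero: "Re (?z (i + 1) * chord_normal) = chord_height" "Re (?z (i + 2) * chord_normal) = chord_height"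
    using zigzag_height_sign(2)[of "i + 1"] zigzag_height_sign(2)[of "i + 2"] i by auto
  have "Re (?z (k + 1) * chord_normal) > chord_height \<and> Re (?z (k + 2) * chord_normal) \<ge> chord_height"
    if "k < i"
    using that assms zigzag_height_sign(1)[of "k + 1"] zigzag_height_side(1)[of "k + 2"] by auto
  moreover have "Re (?z (k + 1) * chord_normal) \<le> chord_height \<and> Re (?z (k + 2) * chord_normal) < chord_height"
    if "i < k"
    using that assms zigzag_height_sign(3)[of "k + 2"] zigzag_height_side(2)[of "k + 1"] by auto
  ultimately show ?thesis
    using assms not_crosses_one_side[OF zigzag_step_distinct zero, of "?z (k + 1)" "?z (k + 2)"]
    by (meson linorder_neqE_nat)
qed

end

subsection \<open>The Coxeter plane\<close>

lemma orthogonal_to_basis_eq_0: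
  assumes "w \<in> span B" "\<And>b. b \<in> B \<Longrightarrow> w \<bullet> b = 0"
  shows "w = 0"
  using assms orthogonal_to_span[of w B w] by (auto simp: orthogonal_def)

lemma inner_sgn_eq: "x \<bullet> sgn a = (x \<bullet> a) / norm a"
  by (simp add: sgn_div_norm divide_inverse_commute)

text \<open>\<open>adjoint g 1\<close> represents the functional \<open>g\<close>, and its component
  in \<open>span \<Delta>\<close> has the same inner products with \<Delta>. The value
  \<open>norm a\<close> compensates for the normalization in \<open>sgn a\<close>. A vector of the
  span is determined by its inner products with the basis, hence uniqueness.\<close>

lemma dual_vector:
  fixes \<Delta> :: "'a::euclidean_space set"
  assumes "independent \<Delta>" "a \<in> \<Delta>"
  shows "dual_vector \<Delta> a \<in> span \<Delta>"
    and "b \<in> \<Delta> \<Longrightarrow> dual_vector \<Delta> a \<bullet> sgn b = (if b = a then 1 else 0)"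
proof -
  have nz: "b \<noteq> 0" if "b \<in> \<Delta>" for b using that assms(1) dependent_zero by blast
  obtain g :: "'a \<Rightarrow> real" where g: "linear g" "\<And>b. b \<in> \<Delta> \<Longrightarrow> g b = (if b = a then norm a else 0)"
    using linear_independent_extend[OF assms(1), of "\<lambda>b. if b = a then norm a else 0"] by auto
  obtain y z where yz: "y \<in> span \<Delta>" "\<And>w. w \<in> span \<Delta> \<Longrightarrow> orthogonal z w" "adjoint g 1 = y + z"
    using orthogonal_subspace_decomp_exists[of \<Delta> "adjoint g 1"] by metis
  have y: "y \<bullet> sgn b = (if b = a then 1 else 0)" if "b \<in> \<Delta>" for b
  proof -
    have "z \<bullet> b = 0" using yz(2)[of b] that by (simp add: orthogonal_def span_base)
    then have "y \<bullet> b = (y + z) \<bullet> b" by (simp add: inner_add_left)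
    also have "\<dots> = b \<bullet> adjoint g 1" by (simp only: yz(3) inner_commute)
    also have "\<dots> = g b" using adjoint_works[OF g(1)] by simp
    finally show ?thesis using g(2)[OF that] nz[OF that] by (auto simp: inner_sgn_eq)
  qed
  have "\<exists>!w. w \<in> span \<Delta> \<and> (\<forall>b\<in>\<Delta>. w \<bullet> sgn b = (if b = a then 1 else 0))"
  proof (rule ex1I[of _ y])
    fix w assume w: "w \<in> span \<Delta> \<and> (\<forall>b\<in>\<Delta>. w \<bullet> sgn b = (if b = a then 1 else 0))"
    have "(w - y) \<bullet> b = 0" if "b \<in> \<Delta>" for b
    proof -
      have "w \<bullet> sgn b = y \<bullet> sgn b" using w y that by auto
      then show ?thesis using nz[OF that] by (simp add: inner_sgn_eq inner_diff_left)
    qed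
    then have "w - y = 0" using w yz(1) by (intro orthogonal_to_basis_eq_0[of _ \<Delta>]) (auto intro: span_diff)
    then show "w = y" by simp
  qed (use yz y in auto)
  from theI'[OF this] show "dual_vector \<Delta> a \<in> span \<Delta>"
    and "b \<in> \<Delta> \<Longrightarrow> dual_vector \<Delta> a \<bullet> sgn b = (if b = a then 1 else 0)"
    unfolding dual_vector_def by auto
qed

section \<open>A basis split into two orthogonal parts\<close>

locale bipartite_basis =
  fixes Dp Dm :: "'a::euclidean_space set"
  assumes indep: "independent (Dp \<union> Dm)"
    and disjoint: "Dp \<inter> Dm = {}"
    and orth_p: "a \<in> Dp \<Longrightarrow> b \<in> Dp \<Longrightarrow> a \<noteq> b \<Longrightarrow> a \<bullet> b = 0"
    and orth_m: "a \<in> Dm \<Longrightarrow> b \<in> Dm \<Longrightarrow> a \<noteq> b \<Longrightarrow> a \<bullet> b = 0"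
begin

text \<open>The two parts play the same role: facts are stated for \<open>Dp\<close> and carried
  over to \<open>Dm\<close> by interpretation.\<close>

lemma swap: "bipartite_basis Dm Dp"
  using indep disjoint orth_p orth_m by unfold_locales (auto simp: Un_commute)

lemma finite_basis: "finite Dp" "finite Dm"
  using independent_imp_finite[OF indep] by auto

lemma basis_nonzero: "a \<in> Dp \<union> Dm \<Longrightarrow> a \<noteq> 0"
  using indep dependent_zero by blast

lemma reflection_prod_Dp: "reflection_prod Dp x = x - (\<Sum>a\<in>Dp. (2 * (x \<bullet> a) / (a \<bullet> a)) *\<^sub>R a)"
  by (rule reflection_prod_eq[OF finite_basis(1) orth_p])

text \<open>A vector of \<open>span Dp\<close>, hence negated by the product of the reflections of
  \<open>Dp\<close>. It will turn out to lie in the Coxeter plane, orthogonal to \<mu>.\<close>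

definition weight_p :: "('a \<Rightarrow> real) \<Rightarrow> 'a" where
  "weight_p c = (\<Sum>a\<in>Dp. c a *\<^sub>R sgn a)"

lemma plane_vector_span: "D \<subseteq> Dp \<union> Dm \<Longrightarrow> plane_vector (Dp \<union> Dm) c D \<in> span (Dp \<union> Dm)"
  unfolding plane_vector_def using dual_vector(1)[OF indep] by (auto intro!: span_sum span_scale)

lemma plane_vector_inner:
  assumes "D \<subseteq> Dp \<union> Dm" "b \<in> Dp \<union> Dm"
  shows "plane_vector (Dp \<union> Dm) c D \<bullet> sgn b = (if b \<in> D then c b else 0)"
proof -
  have "finite D" using assms(1) finite_basis finite_subset by blast
  have "plane_vector (Dp \<union> Dm) c D \<bullet> sgn b = (\<Sum>a\<in>D. c a * (dual_vector (Dp \<union> Dm) a \<bullet> sgn b))"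
    by (simp add: plane_vector_def inner_sum_left)
  also have "\<dots> = (\<Sum>a\<in>D. if a = b then c a else 0)"
    using dual_vector(2)[OF indep _ assms(2)] assms(1) by (intro sum.cong) auto
  also have "\<dots> = (if b \<in> D then c b else 0)"
    using \<open>finite D\<close> by simp
  finally show ?thesis .
qed

lemma weight_p_inner:
  assumes "b \<in> Dp"
  shows "weight_p c \<bullet> sgn b = c b"
proof -
  have "sgn a \<bullet> sgn b = (if a = b then 1 else 0)" if "a \<in> Dp" for a
    using orth_p[OF that assms] basis_nonzero[of a] that
    by (auto simp: sgn_div_norm dot_square_norm power2_eq_square field_simps)
  then have "weight_p c \<bullet> sgn b = (\<Sum>a\<in>Dp. if a = b then c a else 0)"
    unfolding weight_p_def inner_sum_left inner_scaleR_left by (intro sum.cong) auto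
  then show ?thesis using assms finite_basis by simp
qed

lemma reflection_prod_Dp_orthogonal:
  assumes "\<And>a. a \<in> Dp \<Longrightarrow> y \<bullet> a = 0"
  shows "reflection_prod Dp x \<bullet> y = x \<bullet> y"
proof -
  have "(\<Sum>a\<in>Dp. (2 * (x \<bullet> a) / (a \<bullet> a)) *\<^sub>R a) \<bullet> y = 0"
    unfolding inner_sum_left using assms by (intro sum.neutral) (simp add: inner_commute)
  then show ?thesis by (simp add: reflection_prod_Dp inner_diff_left)
qed

lemma reflection_prod_Dp_weight: "reflection_prod Dp x \<bullet> weight_p c = - (x \<bullet> weight_p c)"
proof -
  have "(2 * (x \<bullet> a) / (a \<bullet> a)) * (a \<bullet> weight_p c) = 2 * (c a * (x \<bullet> sgn a))" if "a \<in> Dp" for a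
  proof -
    have "a \<noteq> 0" using that basis_nonzero by blast
    have "weight_p c \<bullet> a = norm a * c a"
      using weight_p_inner[OF that, of c] \<open>a \<noteq> 0\<close> by (simp add: inner_sgn_eq field_simps)
    then show ?thesis using \<open>a \<noteq> 0\<close>
      by (simp add: inner_commute[of a "weight_p c"] inner_sgn_eq dot_square_norm power2_eq_square)
  qed
  then have "(\<Sum>a\<in>Dp. (2 * (x \<bullet> a) / (a \<bullet> a)) *\<^sub>R a) \<bullet> weight_p c = 2 * (\<Sum>a\<in>Dp. c a * (x \<bullet> sgn a))"
    by (simp add: inner_sum_left sum_distrib_left)
  also have "(\<Sum>a\<in>Dp. c a * (x \<bullet> sgn a)) = x \<bullet> weight_p c"
    by (simp add: weight_p_def inner_sum_right)
  finally show ?thesis by (simp add: reflection_prod_Dp inner_diff_left)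
qed

end

section \<open>Action of the two products of reflections on the Coxeter plane\<close>

context bipartite_basis
begin

interpretation m: bipartite_basis Dm Dp by (rule swap)

context
  fixes c :: "'a \<Rightarrow> real" and l :: real
  assumes eigen: "gram_eigen (Dp \<union> Dm) c l"
    and c_pos: "\<And>a. a \<in> Dp \<union> Dm \<Longrightarrow> c a > 0"
    and nonempty: "Dp \<noteq> {}" "Dm \<noteq> {}"
begin

definition "lam = plane_vector (Dp \<union> Dm) c Dp"
definition "mu = plane_vector (Dp \<union> Dm) c Dm"

lemma lam_mu_inner:
  "a \<in> Dp \<Longrightarrow> lam \<bullet> sgn a = c a" "a \<in> Dm \<Longrightarrow> lam \<bullet> sgn a = 0"
  "a \<in> Dp \<Longrightarrow> mu \<bullet> sgn a = 0" "a \<in> Dm \<Longrightarrow> mu \<bullet> sgn a = c a"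
  using plane_vector_inner[of Dp] plane_vector_inner[of Dm] disjoint by (auto simp: lam_def mu_def)

text \<open>The eigenvector equation, read as inner products with the vector that has coordinates
  \<open>c\<close> in the unit simple roots.\<close>

lemma weight_sum_inner: "a \<in> Dp \<union> Dm \<Longrightarrow> (weight_p c + m.weight_p c) \<bullet> sgn a = l * c a"
proof -
  assume a: "a \<in> Dp \<union> Dm"
  have "(weight_p c + m.weight_p c) = (\<Sum>b\<in>Dp \<union> Dm. c b *\<^sub>R sgn b)"
    unfolding weight_p_def m.weight_p_def
    using finite_basis disjoint by (simp add: sum.union_disjoint)
  then have "(weight_p c + m.weight_p c) \<bullet> sgn a = (\<Sum>b\<in>Dp \<union> Dm. (sgn a \<bullet> sgn b) * c b)"
    by (simp add: inner_sum_left mult.commute) (simp add: inner_commute)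
  then show ?thesis using eigen a by (simp add: gram_eigen_def)
qed

lemma weight_span: "weight_p c \<in> span (Dp \<union> Dm)" "m.weight_p c \<in> span (Dp \<union> Dm)"
  unfolding weight_p_def m.weight_p_def sgn_div_norm
  by (auto intro!: span_sum span_scale intro: span_base)

lemma eq_from_inner:
  assumes "v \<in> span (Dp \<union> Dm)" "w \<in> span (Dp \<union> Dm)"
    "\<And>a. a \<in> Dp \<union> Dm \<Longrightarrow> v \<bullet> sgn a = w \<bullet> sgn a"
  shows "v = w"
proof -
  have "(v - w) \<bullet> a = 0" if "a \<in> Dp \<union> Dm" for a
    using assms(3)[OF that] basis_nonzero[OF that] by (simp add: inner_sgn_eq inner_diff_left)
  then have "v - w = 0"
    using assms by (intro orthogonal_to_basis_eq_0[of _ "Dp \<union> Dm"]) (auto intro: span_diff)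
  then show ?thesis by simp
qed

text \<open>By the eigenvector equation both sides have the same inner products with all unit simple
  roots. Together with \<open>weight_p_eq\<close> this places both weight vectors in the Coxeter
  plane.\<close>

lemma weight_m_eq: "m.weight_p c = mu - (1 - l) *\<^sub>R lam"
proof (rule eq_from_inner)
  show "mu - (1 - l) *\<^sub>R lam \<in> span (Dp \<union> Dm)"
    unfolding mu_def lam_def by (intro span_diff span_scale plane_vector_span) auto
next
  fix a assume a: "a \<in> Dp \<union> Dm"
  show "m.weight_p c \<bullet> sgn a = (mu - (1 - l) *\<^sub>R lam) \<bullet> sgn a"
  proof (cases "a \<in> Dp")
    case True
    then show ?thesis
      using weight_sum_inner[OF a] weight_p_inner[OF True, of c]
      by (simp add: inner_add_left inner_diff_left lam_mu_inner algebra_simps)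
  next
    case False
    then have "a \<in> Dm" using a by blast
    then show ?thesis
      using m.weight_p_inner[of a c] by (simp add: inner_diff_left lam_mu_inner)
  qed
qed (rule weight_span)

lemma weight_p_eq: "weight_p c = lam - (1 - l) *\<^sub>R mu"
proof (rule eq_from_inner)
  show "lam - (1 - l) *\<^sub>R mu \<in> span (Dp \<union> Dm)"
    unfolding mu_def lam_def by (intro span_diff span_scale plane_vector_span) auto
next
  fix a assume a: "a \<in> Dp \<union> Dm"
  show "weight_p c \<bullet> sgn a = (lam - (1 - l) *\<^sub>R mu) \<bullet> sgn a"
  proof (cases "a \<in> Dm")
    case True
    then show ?thesis
      using weight_sum_inner[OF a] m.weight_p_inner[OF True, of c]
      by (simp add: inner_add_left inner_diff_left lam_mu_inner algebra_simps)
  next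
    case False
    then have "a \<in> Dp" using a by blast
    then show ?thesis
      using weight_p_inner[of a c] by (simp add: inner_diff_left lam_mu_inner)
  qed
qed (rule weight_span)

lemma lam_weight_m: "lam \<bullet> m.weight_p c = 0"
  unfolding m.weight_p_def by (auto simp: inner_sum_right lam_mu_inner intro!: sum.neutral)

lemma mu_weight_p: "mu \<bullet> weight_p c = 0"
  unfolding weight_p_def by (auto simp: inner_sum_right lam_mu_inner intro!: sum.neutral)

lemma nonzero: "weight_p c \<noteq> 0" "m.weight_p c \<noteq> 0" "lam \<noteq> 0"
proof -
  obtain a b where ab: "a \<in> Dp" "b \<in> Dm" using nonempty by auto
  show "weight_p c \<noteq> 0" using weight_p_inner[OF ab(1), of c] c_pos[of a] ab by auto
  show "m.weight_p c \<noteq> 0" using m.weight_p_inner[OF ab(2), of c] c_pos[of b] ab by auto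
  show "lam \<noteq> 0" using lam_mu_inner(1)[OF ab(1)] c_pos[of a] ab by auto
qed

text \<open>Since \<open>m.weight_p c\<close> differs from \<open>mu\<close> by a multiple of
  \<open>lam\<close> and is orthogonal to \<open>lam\<close>, it is the Gram-Schmidt vector in the
  definition of the projection.\<close>

lemma plane_projection_eq:
  "plane_projection Dp Dm c x = Complex (x \<bullet> sgn lam) (x \<bullet> sgn (m.weight_p c))"
proof -
  have "mu \<bullet> lam = (1 - l) * (lam \<bullet> lam)"
    using lam_weight_m unfolding weight_m_eq by (simp add: inner_diff_right inner_commute)
  then have "(mu \<bullet> sgn lam) *\<^sub>R sgn lam = (1 - l) *\<^sub>R lam"
    using nonzero(3) by (simp add: sgn_div_norm dot_square_norm power2_eq_square)
  then have "mu - (mu \<bullet> sgn lam) *\<^sub>R sgn lam = m.weight_p c" by (simp add: weight_m_eq)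
  then show ?thesis unfolding plane_projection_def Let_def lam_def[symmetric] mu_def[symmetric] by simp
qed

text \<open>The product over \<open>Dm\<close> keeps inner products with \<open>lam\<close> and
  negates those with \<open>m.weight_p c\<close>: it is complex conjugation. The product over
  \<open>Dp\<close> does the same with \<open>mu\<close> and \<open>weight_p c\<close>, so it is the
  reflection in the line of \<open>mu\<close>, and \<theta> is the angle of \<open>mu\<close>. The
  value of \<theta> is determined later, from the orbit.\<close>

lemma coxeter_plane_angle:
  obtains \<theta> where "0 < \<theta>" "\<theta> < pi"
    "\<And>x. plane_projection Dp Dm c (reflection_prod Dm x) = cnj (plane_projection Dp Dm c x)"
    "\<And>x. plane_projection Dp Dm c (reflection_prod Dp x) = cis (2 * \<theta>) * cnj (plane_projection Dp Dm c x)"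
    "\<And>a. a \<in> Dp \<Longrightarrow> 0 < Re (plane_projection Dp Dm c a)"
    "\<And>a. a \<in> Dm \<Longrightarrow> 0 < Re (plane_projection Dp Dm c a * cis (- \<theta>))"
proof -
  let ?pp = "plane_projection Dp Dm c" and ?k = "1 - l" and ?y = "m.weight_p c"
  \<comment> \<open>The projection of \<open>mu\<close>.\<close>
  define z where "z = Complex (?k * norm lam) (norm ?y)"
  define \<theta> where "\<theta> = Arg z"
  have "Im z > 0" using nonzero by (simp add: z_def)
  then have "0 < \<theta> \<and> \<theta> < pi" using Arg_lt_pi unfolding \<theta>_def by blast
  moreover have "z \<noteq> 0" using \<open>Im z > 0\<close> by auto
  have z: "z = rcis (cmod z) \<theta>" by (simp add: \<theta>_def rcis_cmod_Arg)
  have zz: "z / cnj z = cis (2 * \<theta>)"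
  proof -
    have "z / cnj z = rcis (cmod z) \<theta> / rcis (cmod z) (- \<theta>)"
      by (metis z rcis_def complex_cnj_mult complex_cnj_complex_of_real cis_cnj)
    also have "\<dots> = rcis 1 (2 * \<theta>)" using \<open>z \<noteq> 0\<close> by (simp add: rcis_divide)
    finally show ?thesis by (simp add: rcis_def)
  qed
  have Re_pp: "Re (?pp x * cnj z) = x \<bullet> mu" for x
  proof -
    have "mu = ?k *\<^sub>R lam + ?y" by (simp add: weight_m_eq)
    moreover have "norm lam * (x \<bullet> sgn lam) = x \<bullet> lam" "norm ?y * (x \<bullet> sgn ?y) = x \<bullet> ?y"
      using nonzero by (auto simp: inner_sgn_eq)
    ultimately show ?thesis
      by (simp add: plane_projection_eq z_def inner_add_right) (simp add: algebra_simps)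
  qed
  have wp: "weight_p c = (1 - ?k\<^sup>2) *\<^sub>R lam - ?k *\<^sub>R ?y"
    by (simp add: weight_p_eq weight_m_eq power2_eq_square algebra_simps)
      (simp add: mult_2_right flip: scaleR_add_left)
  \<comment> \<open>The coordinates of \<open>weight_p c\<close>. Orthogonality to \<open>mu\<close>
    gives \<open>pq\<close>, by which \<open>Im (?pp x * cnj z)\<close> is a multiple of
    \<open>x \<bullet> weight_p c\<close> and so changes sign.\<close>
  define p q where "p = (1 - ?k\<^sup>2) * norm lam" and "q = - ?k * norm ?y"
  have x_wp: "x \<bullet> weight_p c = p * Re (?pp x) + q * Im (?pp x)" for x
    using nonzero by (simp add: wp plane_projection_eq p_def q_def inner_diff_right inner_sgn_eq)
      (simp add: algebra_simps)
  have "mu \<bullet> ?y = ?y \<bullet> ?y" "mu \<bullet> lam = ?k * (lam \<bullet> lam)"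
    using lam_weight_m arg_cong[OF weight_m_eq, of "\<lambda>v. v \<bullet> ?y"] arg_cong[OF weight_m_eq, of "\<lambda>v. v \<bullet> lam"]
    by (simp_all add: inner_diff_left inner_diff_right inner_commute)
  then have "Re (?pp mu) = Re z" "Im (?pp mu) = Im z"
    using nonzero by (simp_all add: plane_projection_eq z_def inner_sgn_eq dot_square_norm power2_eq_square)
  then have pq: "p * Re z + q * Im z = 0" using x_wp[of mu] mu_weight_p by simp
  have "p \<noteq> 0"
  proof
    assume "p = 0"
    then have "q = 0" using pq \<open>Im z > 0\<close> by simp
    then have "weight_p c \<bullet> weight_p c = 0" using x_wp \<open>p = 0\<close> by simp
    then show False using nonzero by simp
  qed
  have Im_pp: "Im (?pp x * cnj z) = - (Im z / p) * (x \<bullet> weight_p c)" for x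
  proof -
    have q: "q = - p * Re z / Im z" using pq \<open>Im z > 0\<close> by (simp add: field_simps)
    show ?thesis unfolding x_wp q using \<open>p \<noteq> 0\<close> \<open>Im z > 0\<close> by (simp add: field_simps)
  qed
  have inner_zero: "lam \<bullet> a = 0" if "a \<in> Dm" for a
    using lam_mu_inner(2)[OF that] basis_nonzero[of a] that by (auto simp: inner_sgn_eq)
  have inner_zero': "mu \<bullet> a = 0" if "a \<in> Dp" for a
    using lam_mu_inner(3)[OF that] basis_nonzero[of a] that by (auto simp: inner_sgn_eq)
  show thesis
  proof (rule that[of \<theta>])
    show "?pp (reflection_prod Dm x) = cnj (?pp x)" for x
      using m.reflection_prod_Dp_orthogonal[of lam x] inner_zero m.reflection_prod_Dp_weight[of x c]
      by (simp add: plane_projection_eq inner_sgn_eq complex_eq_iff)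
  next
    fix x
    \<comment> \<open>Multiplication by \<open>cnj z\<close> turns the line of \<open>mu\<close>
      into the real axis, where the reflection is conjugation.\<close>
    have "?pp (reflection_prod Dp x) * cnj z = cnj (?pp x * cnj z)"
      unfolding complex_eq_iff Re_pp Im_pp complex_cnj
      using reflection_prod_Dp_orthogonal[of mu x] inner_zero' reflection_prod_Dp_weight[of x c]
        Re_pp[of x] Im_pp[of x]
      by simp
    then have "?pp (reflection_prod Dp x) = z / cnj z * cnj (?pp x)"
      using \<open>z \<noteq> 0\<close> by (simp add: field_simps)
    then show "?pp (reflection_prod Dp x) = cis (2 * \<theta>) * cnj (?pp x)" unfolding zz .
  next
    fix a assume a: "a \<in> Dp"
    have "0 < lam \<bullet> sgn a" using lam_mu_inner(1)[OF a] c_pos[of a] a by auto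
    then have "0 < a \<bullet> lam"
      unfolding inner_commute[of a lam] by (auto simp: inner_sgn_eq zero_less_divide_iff)
    then show "0 < Re (?pp a)"
      using nonzero by (simp add: plane_projection_eq inner_sgn_eq)
  next
    fix a assume a: "a \<in> Dm"
    have "0 < mu \<bullet> sgn a" using lam_mu_inner(4)[OF a] c_pos[of a] a by auto
    then have "0 < Re (?pp a * cnj z)"
      unfolding Re_pp inner_commute[of a mu] by (auto simp: inner_sgn_eq zero_less_divide_iff)
    also have "cnj z = of_real (cmod z) * cis (- \<theta>)"
      by (metis z rcis_def complex_cnj_mult complex_cnj_complex_of_real cis_cnj)
    also have "?pp a * (of_real (cmod z) * cis (- \<theta>)) = of_real (cmod z) * (?pp a * cis (- \<theta>))"
      by (simp add: algebra_simps)
    also have "Re \<dots> = cmod z * Re (?pp a * cis (- \<theta>))" by simp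
    finally show "0 < Re (?pp a * cis (- \<theta>))"
      using norm_not_less_zero[of z] by (simp only: zero_less_mult_iff) blast
  qed (use calculation in auto)
qed

lemma linear_plane_projection: "linear (plane_projection Dp Dm c)"
  by (rule linearI) (simp_all add: plane_projection_eq inner_add_left complex_eq_iff)

end

end

subsection \<open>Orbits labelled along the zigzag\<close>

context bipartite_basis
begin

lemma inner_reflection_prod_Dp: "a \<in> Dp \<Longrightarrow> reflection_prod Dp x \<bullet> a = - (x \<bullet> a)"
proof -
  assume a: "a \<in> Dp"
  have "(\<Sum>b\<in>Dp. (2 * (x \<bullet> b) / (b \<bullet> b)) *\<^sub>R b) \<bullet> a = (\<Sum>b\<in>Dp. if b = a then 2 * (x \<bullet> a) else 0)"
    unfolding inner_sum_left using orth_p a basis_nonzero[of a] by (intro sum.cong) auto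
  then show ?thesis using a finite_basis by (simp add: reflection_prod_Dp inner_diff_left)
qed

lemma linear_reflection_prod_Dp: "linear (reflection_prod Dp)"
  by (rule linearI)
    (simp_all add: reflection_prod_Dp inner_add_left algebra_simps add_divide_distrib sum.distrib
      scaleR_sum_right)

lemma reflection_prod_Dp_involution: "reflection_prod Dp (reflection_prod Dp x) = x"
proof -
  have "reflection_prod Dp (reflection_prod Dp x) =
      reflection_prod Dp x - (\<Sum>a\<in>Dp. (2 * (reflection_prod Dp x \<bullet> a) / (a \<bullet> a)) *\<^sub>R a)"
    by (rule reflection_prod_Dp)
  also have "(\<Sum>a\<in>Dp. (2 * (reflection_prod Dp x \<bullet> a) / (a \<bullet> a)) *\<^sub>R a) =
      - (\<Sum>a\<in>Dp. (2 * (x \<bullet> a) / (a \<bullet> a)) *\<^sub>R a)"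
    unfolding sum_negf[symmetric] by (intro sum.cong) (simp_all add: inner_reflection_prod_Dp)
  finally show ?thesis by (simp add: reflection_prod_Dp)
qed

lemma reflection_prod_Dp_single:
  assumes "a \<in> Dp" "\<And>b. b \<in> Dp \<Longrightarrow> b \<noteq> a \<Longrightarrow> x \<bullet> b = 0"
  shows "reflection_prod Dp x = reflection a x"
proof -
  have "(\<Sum>b\<in>Dp. (2 * (x \<bullet> b) / (b \<bullet> b)) *\<^sub>R b) = (\<Sum>b\<in>{a}. (2 * (x \<bullet> b) / (b \<bullet> b)) *\<^sub>R b)"
    using assms finite_basis by (intro sum.mono_neutral_right) auto
  then show ?thesis by (simp add: reflection_prod_Dp reflection_def)
qed

lemma reflection_prod_Dp_none:
  assumes "\<And>b. b \<in> Dp \<Longrightarrow> x \<bullet> b = 0"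
  shows "reflection_prod Dp x = x"
  using assms by (simp add: reflection_prod_Dp)

lemma reflection_prod_Dp_basis: "a \<in> Dp \<Longrightarrow> reflection_prod Dp a = - a"
  using orth_p by (subst reflection_prod_Dp_single[of a]) (auto simp: reflection_self)

lemma reflection_prod_Dp_displacement: "reflection_prod Dp x - x \<in> span Dp"
  by (auto simp: reflection_prod_Dp intro!: span_neg span_sum span_scale intro: span_base)

lemma representation_minus_basis:
  assumes "a \<in> Dp \<union> Dm"
  shows "representation (Dp \<union> Dm) (- a) = (\<lambda>b. if b = a then -1 else 0)"
  using assms by (auto simp: representation_neg[OF indep span_base] representation_basis[OF indep])

end

text \<open>The orbit as a descending list \<open>x 0\<close>, ..., \<open>x (h - 1)\<close> with
  steps \<open>t i *\<^sub>R s i\<close>. \<open>e\<close> tells whether \<open>s 0\<close> belongs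
  to \<open>Dp\<close>. By \<open>moved\<close>, a simple reflection can move an element only to a
  neighbour; by \<open>positive\<close>, every positive root is visible as a difference in the
  list.\<close>

locale zigzag_orbit = bipartite_basis Dp Dm for Dp Dm :: "'a::euclidean_space set" +
  fixes \<Phi> :: "'a set" and x s :: "nat \<Rightarrow> 'a" and t :: "nat \<Rightarrow> real" and h :: nat and e :: bool
  assumes basis_roots: "Dp \<union> Dm \<subseteq> \<Phi>"
    and roots_span: "\<Phi> \<subseteq> span (Dp \<union> Dm)"
    and stable: "a \<in> Dp \<union> Dm \<Longrightarrow> b \<in> \<Phi> \<Longrightarrow> reflection a b \<in> \<Phi>"
    and root_nonzero: "0 \<notin> \<Phi>"
    and reduced: "b \<in> \<Phi> \<Longrightarrow> k *\<^sub>R b \<in> \<Phi> \<Longrightarrow> 0 < k \<Longrightarrow> k = 1"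
    and h: "3 \<le> h"
    and norm_x: "i < h \<Longrightarrow> norm (x i) = norm (x 0)"
    and step: "Suc i < h \<Longrightarrow> x i - x (Suc i) = t i *\<^sub>R s i"
    and t_pos: "Suc i < h \<Longrightarrow> 0 < t i"
    and s_part: "Suc i < h \<Longrightarrow> s i \<in> (if even i = e then Dp else Dm)"
    and moved: "a \<in> Dp \<union> Dm \<Longrightarrow> i < h \<Longrightarrow> x i \<bullet> a \<noteq> 0 \<Longrightarrow>
      Suc i < h \<and> s i = a \<or> 0 < i \<and> s (i - 1) = a"
    and positive: "b \<in> positive_roots \<Phi> (Dp \<union> Dm) \<Longrightarrow>
      \<exists>i j k. i < j \<and> j < h \<and> 0 < k \<and> x i - x j = k *\<^sub>R b"
begin

abbreviation "\<Delta> \<equiv> Dp \<union> Dm"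
abbreviation "pos \<equiv> positive_roots \<Phi> \<Delta>"
abbreviation "apos \<equiv> almost_positive_roots \<Phi> \<Delta>"

lemma swap: "zigzag_orbit Dm Dp \<Phi> x s t h (\<not> e)"
proof (intro zigzag_orbit.intro zigzag_orbit_axioms.intro)
  show "bipartite_basis Dm Dp" by (rule swap)
  show "Dm \<union> Dp \<subseteq> \<Phi>" "\<Phi> \<subseteq> span (Dm \<union> Dp)"
    using basis_roots roots_span by (simp_all add: Un_commute)
  show "reflection a b \<in> \<Phi>" if "a \<in> Dm \<union> Dp" "b \<in> \<Phi>" for a b
    using stable that by blast
  show "Suc i < h \<and> s i = a \<or> 0 < i \<and> s (i - 1) = a"
    if "a \<in> Dm \<union> Dp" "i < h" "x i \<bullet> a \<noteq> 0" for a i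
    using moved that by blast
  show "\<exists>i j k. i < j \<and> j < h \<and> 0 < k \<and> x i - x j = k *\<^sub>R b"
    if "b \<in> positive_roots \<Phi> (Dm \<union> Dp)" for b
    using positive that by (simp add: Un_commute)
  show "s i \<in> (if even i = (\<not> e) then Dm else Dp)" if "Suc i < h" for i
    using s_part[OF that] by (auto split: if_splits)
qed (fact root_nonzero reduced h norm_x step t_pos)+

lemma s_basis: "Suc i < h \<Longrightarrow> s i \<in> \<Delta>"
  using s_part[of i] by (auto split: if_splits)

lemma x_diff:
  assumes "i \<le> j" "j < h"
  shows "x i - x j = (\<Sum>k\<in>{i..<j}. t k *\<^sub>R s k)"
  using assms
proof (induction j rule: dec_induct)
  case (step n)
  have "x i - x (Suc n) = (x i - x n) + (x n - x (Suc n))" by simp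
  also have "\<dots> = (\<Sum>k\<in>{i..<n}. t k *\<^sub>R s k) + t n *\<^sub>R s n"
    using step zigzag_orbit.step[OF zigzag_orbit_axioms, of n] by simp
  finally show ?case using step by (simp add: sum.atLeastLessThan_Suc)
qed simp

lemma rep_x_diff:
  assumes "i \<le> j" "j < h"
  shows "representation \<Delta> (x i - x j) a = (\<Sum>k\<in>{i..<j}. if s k = a then t k else 0)"
proof -
  have s: "s k \<in> \<Delta>" if "k \<in> {i..<j}" for k using that assms s_basis by auto
  have "representation \<Delta> (x i - x j) a = (\<Sum>k\<in>{i..<j}. representation \<Delta> (t k *\<^sub>R s k) a)"
    unfolding x_diff[OF assms]
    by (subst representation_sum[OF indep]) (auto intro: span_scale[OF span_base[OF s]])
  also have "\<dots> = (\<Sum>k\<in>{i..<j}. if s k = a then t k else 0)"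
    using s by (intro sum.cong)
      (auto simp: representation_scale[OF indep span_base] representation_basis[OF indep])
  finally show ?thesis .
qed

lemma rep_x_diff_nonneg: "i \<le> j \<Longrightarrow> j < h \<Longrightarrow> 0 \<le> representation \<Delta> (x i - x j) a"
  unfolding rep_x_diff using t_pos by (intro sum_nonneg) (auto simp: less_imp_le)

text \<open>All steps have positive coefficients, so nothing cancels.\<close>

lemma rep_x_diff_eq_0_iff:
  assumes "i \<le> j" "j < h"
  shows "representation \<Delta> (x i - x j) a = 0 \<longleftrightarrow> (\<forall>k\<in>{i..<j}. s k \<noteq> a)"
proof -
  have t: "0 < t k" if "k \<in> {i..<j}" for k using that assms t_pos by auto
  then have "representation \<Delta> (x i - x j) a = 0 \<longleftrightarrow> (\<forall>k\<in>{i..<j}. (if s k = a then t k else 0) = 0)"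
    unfolding rep_x_diff[OF assms] by (intro sum_nonneg_eq_0_iff) (auto simp: less_imp_le)
  then show ?thesis using t by fastforce
qed

lemma x_distinct:
  assumes "i < j" "j < h"
  shows "x i \<noteq> x j"
proof
  assume "x i = x j"
  then have "representation \<Delta> (x i - x j) (s i) = 0" by (simp add: representation_zero)
  then show False using rep_x_diff_eq_0_iff[of i j "s i"] assms by auto
qed

lemma pos_root: "b \<in> pos \<Longrightarrow> b \<in> \<Phi>" "b \<in> pos \<Longrightarrow> b \<in> span \<Delta>"
  using roots_span by (auto simp: positive_roots_def)

lemma pos_rep_nonneg: "b \<in> pos \<Longrightarrow> a \<in> \<Delta> \<Longrightarrow> 0 \<le> representation \<Delta> b a"
  by (simp add: positive_roots_def)

lemma pos_nonzero: "b \<in> pos \<Longrightarrow> b \<noteq> 0"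
  using pos_root root_nonzero by auto

lemma basis_pos: "a \<in> \<Delta> \<Longrightarrow> a \<in> pos"
  using basis_roots representation_basis[OF indep] by (auto simp: positive_roots_def)

lemma minus_basis_not_pos: "a \<in> \<Delta> \<Longrightarrow> - a \<notin> pos"
  using representation_minus_basis[of a] by (force simp: positive_roots_def)

lemma proportional_pos_eq:
  assumes "b \<in> pos" "c \<in> pos" "k *\<^sub>R b = l *\<^sub>R c" "0 < k" "0 < l"
  shows "b = c"
proof -
  have "c = (k / l) *\<^sub>R b"
    by (metis assms(3,5) divide_inverse_commute less_irrefl pth_5 real_vector_affinity_eq scaleR_one
        scaleR_scaleR left_inverse)
  then show ?thesis using reduced[of b "k / l"] pos_root assms by auto
qed

lemma pos_rep_eq_0_iff:
  assumes "b \<in> pos" "i < j" "j < h" "0 < k" "x i - x j = k *\<^sub>R b"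
  shows "representation \<Delta> b a = 0 \<longleftrightarrow> (\<forall>k\<in>{i..<j}. s k \<noteq> a)"
  using rep_x_diff_eq_0_iff[of i j a] assms
  by (simp add: representation_scale[OF indep pos_root(2)])

text \<open>Two consecutive steps are multiples of simple roots from different parts, so they never add up
  to a multiple of a single simple root.\<close>

lemma basis_difference:
  assumes "a \<in> \<Delta>" "i < j" "j < h" "0 < k" "x i - x j = k *\<^sub>R a"
  shows "j = Suc i \<and> s i = a"
proof -
  have s: "s m = a" if "m \<in> {i..<j}" for m
  proof (rule ccontr)
    assume "s m \<noteq> a"
    then have "representation \<Delta> a (s m) = 0"
      using assms(1) by (simp add: representation_basis[OF indep])
    then show False using pos_rep_eq_0_iff[OF basis_pos[OF assms(1)] assms(2-5)] that by auto
  qed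
  have "j = Suc i"
  proof (rule ccontr)
    assume "j \<noteq> Suc i"
    then have "s i = a" "s (Suc i) = a" using s assms(2) by auto
    then show False
      using s_part[of i] s_part[of "Suc i"] \<open>j \<noteq> Suc i\<close> assms(2,3) disjoint by (auto split: if_splits)
  qed
  then show ?thesis using s by auto
qed

lemma reflection_x:
  assumes "Suc i < h"
  shows "reflection (s i) (x i) = x (Suc i)" "reflection (s i) (x (Suc i)) = x i"
proof -
  show "reflection (s i) (x i) = x (Suc i)"
    using reflection_swap[of "x i" "x (Suc i)" "t i" "s i"] norm_x[of i] norm_x[of "Suc i"]
      step[of i] t_pos[of i] assms by simp
  then show "reflection (s i) (x (Suc i)) = x i" by (metis reflection_involution)
qed

text \<open>The steps alternate between the parts, so at most one of the two steps at
  \<open>x i\<close> is along a root of \<open>Dp\<close>. At most one factor of the product then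
  moves \<open>x i\<close>, namely to the neighbour across that step; an end without such a
  neighbour is fixed.\<close>

lemma reflection_prod_x:
  assumes i: "i < h"
  shows "reflection_prod Dp (x i) = x (zigzag_swap (h - 1) e i)"
proof (cases "even i = e")
  case True
  have other: "Suc i < h \<and> a = s i" if "a \<in> Dp" "x i \<bullet> a \<noteq> 0" for a
  proof (rule ccontr)
    assume "\<not> (Suc i < h \<and> a = s i)"
    then have "0 < i" "s (i - 1) = a" using moved[of a i] that i by auto
    then show False using s_part[of "i - 1"] True i that(1) disjoint by (auto split: if_splits)
  qed
  show ?thesis
  proof (cases "Suc i < h")
    case True
    then have "reflection_prod Dp (x i) = reflection (s i) (x i)"
      using other s_part[of i] \<open>even i = e\<close> by (intro reflection_prod_Dp_single) auto
    then show ?thesis using True \<open>even i = e\<close> by (simp add: zigzag_swap_def reflection_x)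
  next
    case False
    then have "Suc i = h" using i by simp
    then show ?thesis using other False \<open>even i = e\<close>
      by (subst reflection_prod_Dp_none) (auto simp: zigzag_swap_def min_def)
  qed
next
  case False
  have other: "0 < i \<and> a = s (i - 1)" if "a \<in> Dp" "x i \<bullet> a \<noteq> 0" for a
  proof (rule ccontr)
    assume "\<not> (0 < i \<and> a = s (i - 1))"
    then have "Suc i < h" "s i = a" using moved[of a i] that i by auto
    then show False using s_part[of i] False i that(1) disjoint by (auto split: if_splits)
  qed
  show ?thesis
  proof (cases i)
    case 0
    then show ?thesis using other False
      by (subst reflection_prod_Dp_none) (auto simp: zigzag_swap_def)
  next
    case (Suc m)
    then have "reflection_prod Dp (x i) = reflection (s m) (x i)"
      using other s_part[of m] False i by (intro reflection_prod_Dp_single) auto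
    then show ?thesis using Suc False i by (simp add: zigzag_swap_def reflection_x)
  qed
qed

lemma reflection_prod_root: "b \<in> \<Phi> \<Longrightarrow> reflection_prod Dp b \<in> \<Phi>"
  using stable by (intro reflection_prod_stable[OF finite_basis(1) orth_p]) auto

lemma zigzag_swap_le: "i < h \<Longrightarrow> zigzag_swap (h - 1) e i < h"
  by (auto simp: zigzag_swap_def)

text \<open>Indices move by at most one, and indices at distance two keep their order since they
  have the same parity. Only an exchanged pair is reversed.\<close>

lemma zigzag_swap_less:
  assumes "i < j" "j < h" "\<not> (j = Suc i \<and> even i = e)"
  shows "zigzag_swap (h - 1) e i < zigzag_swap (h - 1) e j"
proof -
  consider "j = Suc i" | "j = Suc (Suc i)" | "j > Suc (Suc i)" using assms(1) by linarith
  then show ?thesis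
    using assms by cases (auto simp: zigzag_swap_def min_def)
qed

lemma adjacent_pos_in_Dp:
  assumes "b \<in> pos" "Suc i < h" "even i = e" "0 < k" "x i - x (Suc i) = k *\<^sub>R b"
  shows "b \<in> Dp"
proof -
  have "s i \<in> Dp" using s_part[of i] assms by auto
  then have "b = s i"
    using proportional_pos_eq[OF assms(1) basis_pos, of "s i" k "t i"] assms t_pos step[of i] by auto
  then show ?thesis using \<open>s i \<in> Dp\<close> by simp
qed

text \<open>Reversal would need \<open>i\<close> and \<open>j\<close> to be exchanged neighbours,
  whose difference is a multiple of a root of \<open>Dp\<close>; \<open>b\<close> is not such a
  root.\<close>

lemma pos_image_difference:
  assumes "b \<in> pos" "b \<notin> Dp" "i < j" "j < h" "0 < k" "x i - x j = k *\<^sub>R b"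
  shows "zigzag_swap (h - 1) e i < zigzag_swap (h - 1) e j"
    and "x (zigzag_swap (h - 1) e i) - x (zigzag_swap (h - 1) e j) = k *\<^sub>R reflection_prod Dp b"
proof -
  have "\<not> (j = Suc i \<and> even i = e)" using adjacent_pos_in_Dp assms by blast
  then show "zigzag_swap (h - 1) e i < zigzag_swap (h - 1) e j"
    using zigzag_swap_less assms by blast
  show "x (zigzag_swap (h - 1) e i) - x (zigzag_swap (h - 1) e j) = k *\<^sub>R reflection_prod Dp b"
    using assms reflection_prod_x[of i] reflection_prod_x[of j]
    by (metis linear_diff linear_reflection_prod_Dp linear_scale less_trans)
qed

text \<open>The image is again proportional to a descending difference, so its coefficients are
  nonnegative. If it were in \<open>Dp\<close>, the involution would make \<open>b\<close> the
  negative of a simple root.\<close>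

lemma reflection_prod_pos:
  assumes "b \<in> pos" "b \<notin> Dp"
  shows "reflection_prod Dp b \<in> pos" "reflection_prod Dp b \<notin> Dp"
proof -
  obtain i j k where ijk: "i < j" "j < h" "0 < k" "x i - x j = k *\<^sub>R b"
    using positive[OF assms(1)] by blast
  let ?i = "zigzag_swap (h - 1) e i" and ?j = "zigzag_swap (h - 1) e j"
  have c: "reflection_prod Dp b \<in> \<Phi>" using reflection_prod_root pos_root assms by blast
  have "0 \<le> representation \<Delta> (reflection_prod Dp b) a" for a
  proof -
    have "0 \<le> representation \<Delta> (k *\<^sub>R reflection_prod Dp b) a"
      using rep_x_diff_nonneg[of ?i ?j a] pos_image_difference[OF assms ijk] zigzag_swap_le[of j] ijk
      by simp
    moreover have "reflection_prod Dp b \<in> span \<Delta>" using c roots_span by auto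
    ultimately show ?thesis
      using \<open>0 < k\<close> by (simp add: representation_scale[OF indep] zero_le_mult_iff)
  qed
  then show "reflection_prod Dp b \<in> pos" using c by (auto simp: positive_roots_def)
  show "reflection_prod Dp b \<notin> Dp"
  proof
    assume "reflection_prod Dp b \<in> Dp"
    then have "b = - reflection_prod Dp b"
      by (metis reflection_prod_Dp_basis reflection_prod_Dp_involution)
    then show False
      using minus_basis_not_pos[of "reflection_prod Dp b"] \<open>reflection_prod Dp b \<in> Dp\<close> assms(1) by auto
  qed
qed

section \<open>The involutions on the almost positive roots\<close>

lemma tau_cases:
  assumes "b \<in> apos"
  obtains (fixed) a where "a \<in> Dm" "b = - a" "tau Dp Dm b = b"
  | (negative) a where "a \<in> Dp" "b = - a" "tau Dp Dm b = a"
  | (simple) "b \<in> Dp" "tau Dp Dm b = - b"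
  | (positive) "b \<in> pos" "b \<notin> Dp" "tau Dp Dm b = reflection_prod Dp b"
      "reflection_prod Dp b \<in> pos" "reflection_prod Dp b \<notin> Dp"
proof -
  have pos_not: "b \<notin> uminus ` Dm" if "b \<in> pos" for b using that minus_basis_not_pos by auto
  consider "b \<in> uminus ` Dm" | "b \<in> uminus ` Dp" | "b \<in> Dp" | "b \<in> pos" "b \<notin> Dp"
    using assms by (auto simp: almost_positive_roots_def)
  then show thesis
  proof cases
    case 1
    then show thesis using fixed by (auto simp: tau_def)
  next
    case 2
    then obtain a where a: "a \<in> Dp" "b = - a" by auto
    then have "b \<notin> uminus ` Dm" using disjoint by auto
    then have "tau Dp Dm b = a"
      using a by (simp add: tau_def reflection_prod_Dp_basis linear_neg[OF linear_reflection_prod_Dp])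
    then show thesis using negative a by blast
  next
    case 3
    then have "b \<notin> uminus ` Dm" using pos_not basis_pos by blast
    then have "tau Dp Dm b = - b" using 3 by (simp add: tau_def reflection_prod_Dp_basis)
    then show thesis using simple 3 by blast
  next
    case 4
    then show thesis using positive reflection_prod_pos pos_not by (simp add: tau_def)
  qed
qed

lemma tau_apos: "b \<in> apos \<Longrightarrow> tau Dp Dm b \<in> apos"
  by (erule tau_cases) (use basis_pos in \<open>auto simp: almost_positive_roots_def\<close>)

lemma tau_involution: "b \<in> apos \<Longrightarrow> tau Dp Dm (tau Dp Dm b) = b"
proof -
  assume "b \<in> apos"
  then show ?thesis
  proof (cases b rule: tau_cases)
    case (negative a)
    have "a \<notin> uminus ` Dm" using negative(1) basis_pos[of a] minus_basis_not_pos by auto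
    then show ?thesis using negative by (simp add: tau_def reflection_prod_Dp_basis)
  next
    case simple
    have "- b \<notin> uminus ` Dm" using simple(1) disjoint by auto
    then show ?thesis
      using simple by (simp add: tau_def reflection_prod_Dp_basis linear_neg[OF linear_reflection_prod_Dp])
  next
    case positive
    have "reflection_prod Dp b \<notin> uminus ` Dm" using positive(4) minus_basis_not_pos by auto
    then show ?thesis using positive by (simp add: tau_def reflection_prod_Dp_involution)
  qed simp
qed

end

section \<open>Explicit diagrams\<close>

context zigzag_orbit
begin

text \<open>\<open>z 0\<close> and \<open>z (h + 1)\<close> are the two new vertices, and
  \<open>x i\<close> sits at \<open>z (i + 1)\<close>. The chord for a positive root therefore
  starts one place before \<open>x i\<close> and ends one place after \<open>x j\<close>, just as
  \<open>\<tau>\<close> widens the chord from \<open>i + 1\<close> to \<open>i + 2\<close> into the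
  one from \<open>i\<close> to \<open>i + 3\<close>.\<close>

definition diagram :: "(nat \<Rightarrow> complex) \<Rightarrow> 'a \<Rightarrow> complex set set" where
  "diagram z b =
    (if b \<in> uminus ` \<Delta> then {closed_segment (z (i + 1)) (z (i + 2)) | i. Suc i < h \<and> s i = - b}
     else {closed_segment (z i) (z (j + 2)) | i j. i < j \<and> j < h \<and> (\<exists>k>0. x i - x j = k *\<^sub>R b)})"

lemma diagram_negative:
  "a \<in> \<Delta> \<Longrightarrow> diagram z (- a) = {closed_segment (z (i + 1)) (z (i + 2)) | i. Suc i < h \<and> s i = a}"
  by (simp add: diagram_def)

lemma diagram_positive:
  "b \<in> pos \<Longrightarrow> diagram z b =
    {closed_segment (z i) (z (j + 2)) | i j. i < j \<and> j < h \<and> (\<exists>k>0. x i - x j = k *\<^sub>R b)}"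
  using minus_basis_not_pos by (auto simp: diagram_def)

text \<open>For a fixed root the swap exchanges the ends of each chord. Between a root of
  \<open>Dp\<close> and its negative it widens or narrows the chords by one place at both ends. For
  the other positive roots both ends move like the orbit elements.\<close>

lemma diagram_tau_subset:
  assumes b: "b \<in> apos"
    and f: "\<And>i j. i \<le> Suc h \<Longrightarrow> j \<le> Suc h \<Longrightarrow> f (closed_segment (z i) (z j)) =
      closed_segment (z (zigzag_swap (Suc h) e i)) (z (zigzag_swap (Suc h) e j))"
  shows "f ` diagram z b \<subseteq> diagram z (tau Dp Dm b)"
  using b
proof (cases b rule: tau_cases)
  case (fixed a)
  have "f (closed_segment (z (i + 1)) (z (i + 2))) = closed_segment (z (i + 1)) (z (i + 2))"
    if "Suc i < h" "s i = a" for i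
  proof -
    have "even i \<noteq> e" using s_part[of i] that fixed disjoint by (auto split: if_splits)
    then show ?thesis using f[of "i + 1" "i + 2"] that(1)
      by (simp add: zigzag_swap_def closed_segment_commute)
  qed
  then show ?thesis using fixed by (auto simp: diagram_negative)
next
  case (negative a)
  have "f (closed_segment (z (i + 1)) (z (i + 2))) \<in> diagram z a" if "Suc i < h" "s i = a" for i
  proof -
    have "even i = e" using s_part[of i] that negative disjoint by (auto split: if_splits)
    then have "f (closed_segment (z (i + 1)) (z (i + 2))) = closed_segment (z i) (z (Suc i + 2))"
      using f[of "i + 1" "i + 2"] that(1) by (auto simp: zigzag_swap_def)
    moreover have "\<exists>k>0. x i - x (Suc i) = k *\<^sub>R a"
      using step[of i] t_pos[of i] that by blast
    ultimately show ?thesis using negative basis_pos[of a] that by (auto simp: diagram_positive)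
  qed
  then show ?thesis using negative by (auto simp: diagram_negative)
next
  case simple
  have "f (closed_segment (z i) (z (j + 2))) \<in> diagram z (- b)"
    if "i < j" "j < h" "0 < k" "x i - x j = k *\<^sub>R b" for i j k
  proof -
    have ij: "j = Suc i" "s i = b" using basis_difference[of b] simple that by auto
    then have "even i = e" using s_part[of i] that simple disjoint by (auto split: if_splits)
    then have "f (closed_segment (z i) (z (j + 2))) = closed_segment (z (i + 1)) (z (i + 2))"
      using f[of i "j + 2"] that ij by (auto simp: zigzag_swap_def)
    then show ?thesis using simple ij that by (auto simp: diagram_negative)
  qed
  then show ?thesis using simple basis_pos[of b] by (auto simp: diagram_positive)
next
  case positive
  have "f (closed_segment (z i) (z (j + 2))) \<in> diagram z (reflection_prod Dp b)"
    if "i < j" "j < h" "0 < k" "x i - x j = k *\<^sub>R b" for i j k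
  proof -
    let ?i = "zigzag_swap (h - 1) e i" and ?j = "zigzag_swap (h - 1) e j"
    \<comment> \<open>The two swaps are clamped at different top ends. They agree because
      \<open>i\<close> is not the last index, and the shift by 2 is harmless because
      \<open>j\<close> is not the first.\<close>
    have "zigzag_swap (Suc h) e i = ?i" "zigzag_swap (Suc h) e (j + 2) = ?j + 2"
      using that(1,2) by (auto simp: zigzag_swap_def min_def)
    then have "f (closed_segment (z i) (z (j + 2))) = closed_segment (z ?i) (z (?j + 2))"
      using f[of i "j + 2"] that(1,2) by simp
    moreover have "?i < ?j" "?j < h" "x ?i - x ?j = k *\<^sub>R reflection_prod Dp b"
      using pos_image_difference[OF positive(1,2) that] zigzag_swap_le that by auto
    ultimately show ?thesis using \<open>0 < k\<close> unfolding diagram_positive[OF positive(4)] by blast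
  qed
  then show ?thesis using positive by (auto simp: diagram_positive)
qed

text \<open>Both the reflection and \<open>\<tau>\<close> are involutions, so the inclusion for
  \<open>tau Dp Dm b\<close> yields the reverse inclusion for \<open>b\<close>.\<close>

lemma diagram_tau:
  assumes b: "b \<in> apos"
    and f: "\<And>i. i \<le> Suc h \<Longrightarrow> line_reflection \<theta> (z i) = z (zigzag_swap (Suc h) e i)"
  shows "diagram z (tau Dp Dm b) = (\<lambda>s. line_reflection \<theta> ` s) ` diagram z b"
proof
  let ?f = "\<lambda>s. line_reflection \<theta> ` s"
  have inv: "?f (?f s) = s" for s
    by (simp add: image_image line_reflection_def flip: mult.assoc cis_cnj)
       (simp add: cis_cnj cis_mult flip: mult.assoc)
  have sub: "?f ` diagram z b \<subseteq> diagram z (tau Dp Dm b)" if "b \<in> apos" for b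
    by (rule diagram_tau_subset[OF that]) (simp add: line_reflection_segment f)
  show "?f ` diagram z b \<subseteq> diagram z (tau Dp Dm b)" by (rule sub[OF b])
  have "?f ` diagram z (tau Dp Dm b) \<subseteq> diagram z b"
    using sub[OF tau_apos[OF b]] tau_involution[OF b] by simp
  then have "?f ` ?f ` diagram z (tau Dp Dm b) \<subseteq> ?f ` diagram z b" by blast
  then show "diagram z (tau Dp Dm b) \<subseteq> ?f ` diagram z b"
    by (simp add: image_image[of ?f ?f] inv)
qed

subsection \<open>The Coxeter element\<close>

abbreviation "cox \<equiv> coxeter_element Dp Dm"

end

context zigzag_orbit
begin

interpretation m: zigzag_orbit Dm Dp \<Phi> x s t h "\<not> e" by (rule swap)

lemma apos_swap: "almost_positive_roots \<Phi> (Dm \<union> Dp) = apos"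
  by (simp add: Un_commute)

lemma diagram_swap: "m.diagram = diagram"
  by (intro ext) (simp add: diagram_def m.diagram_def Un_commute)

lemma tau_m_apos: "b \<in> apos \<Longrightarrow> tau Dm Dp b \<in> apos"
  using m.tau_apos by (simp add: apos_swap)

lemma tau_m_involution: "b \<in> apos \<Longrightarrow> tau Dm Dp (tau Dm Dp b) = b"
  using m.tau_involution by (simp add: apos_swap)

lemma linear_cox: "linear cox"
  unfolding coxeter_element_def
  by (rule linear_compose[OF linear_reflection_prod_Dp m.linear_reflection_prod_Dp])

lemma linear_cox_power: "linear (cox ^^ k)"
proof (induction k)
  case (Suc k)
  then show ?case using linear_compose[OF Suc linear_cox] by (simp add: comp_def)
qed (simp add: linear_id[unfolded id_def] id_def)

lemma inner_cox_power: "(cox ^^ k) y \<bullet> (cox ^^ k) z = y \<bullet> z"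
  by (induction k)
    (simp_all add: coxeter_element_def reflection_prod_isometry[OF finite_basis(1) orth_p]
      reflection_prod_isometry[OF finite_basis(2) orth_m])

lemma cox_power_displacement: "(cox ^^ k) y - y \<in> span \<Delta>"
proof (induction k)
  case (Suc k)
  let ?z = "(cox ^^ k) y"
  have "reflection_prod Dp ?z - ?z \<in> span \<Delta>"
    using reflection_prod_Dp_displacement span_mono[of Dp \<Delta>] by auto
  moreover have "cox ?z - reflection_prod Dp ?z \<in> span \<Delta>"
    using m.reflection_prod_Dp_displacement span_mono[of Dm \<Delta>] by (auto simp: coxeter_element_def)
  ultimately have "(cox ?z - reflection_prod Dp ?z) + ((reflection_prod Dp ?z - ?z) + (?z - y)) \<in> span \<Delta>"
    using Suc span_add by blast
  then show ?case by simp
qed (simp add: span_zero)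

lemma basis_eq_s: "a \<in> \<Delta> \<Longrightarrow> \<exists>i. Suc i < h \<and> s i = a"
  using positive[OF basis_pos] basis_difference by blast

text \<open>Fixing the list pointwise, the power fixes all steps and hence all simple roots, and it
  displaces vectors only within their span.\<close>

lemma cox_power_id:
  assumes "\<And>i. i < h \<Longrightarrow> (cox ^^ k) (x i) = x i"
  shows "cox ^^ k = id"
proof (rule isometry_trivial)
  fix a assume "a \<in> \<Delta>"
  then obtain i where i: "Suc i < h" "s i = a" using basis_eq_s by blast
  have "t i *\<^sub>R (cox ^^ k) a = (cox ^^ k) (x i - x (Suc i))"
    using step[of i] i linear_scale[OF linear_cox_power] by simp
  also have "\<dots> = x i - x (Suc i)" using assms[of i] assms[of "Suc i"] i by (simp add: linear_diff[OF linear_cox_power])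
  also have "\<dots> = t i *\<^sub>R a" using step[of i] i by simp
  finally show "(cox ^^ k) a = a" using t_pos[of i] i by simp
qed (rule inner_cox_power cox_power_displacement)+

lemma cox_x:
  assumes "i < h"
  shows "\<exists>j<h. cox (x i) = x j"
  using assms reflection_prod_x[OF assms] m.reflection_prod_x zigzag_swap_le m.zigzag_swap_le
  by (auto simp: coxeter_element_def)

lemma cox_power_x: "i < h \<Longrightarrow> \<exists>j<h. (cox ^^ k) (x i) = x j"
  using cox_x by (induction k) auto

lemma cox_finite_order: "\<exists>k>0. cox ^^ k = id"
proof -
  have "inj cox"
    by (rule inj_on_inverseI[of _ "reflection_prod Dp \<circ> reflection_prod Dm"])
      (simp add: coxeter_element_def reflection_prod_Dp_involution m.reflection_prod_Dp_involution)
  moreover have "cox ` x ` {..<h} \<subseteq> x ` {..<h}" using cox_x by fastforce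
  ultimately obtain k where "0 < k" "\<And>y. y \<in> x ` {..<h} \<Longrightarrow> (cox ^^ k) y = y"
    by (metis inj_finite_orbit_power finite_imageI finite_lessThan)
  then show ?thesis using cox_power_id[of k] by auto
qed

text \<open>The two products displace a fixed vector equally. The displacements lie in the spans of
  disjoint parts of a basis, so both vanish, and \<open>y\<close> is orthogonal to every simple
  root.\<close>

lemma cox_fixed_eq_0:
  assumes "y \<in> span \<Delta>" "cox y = y"
  shows "y = 0"
proof -
  let ?d = "\<lambda>D. (\<Sum>a\<in>D. (2 * (y \<bullet> a) / (a \<bullet> a)) *\<^sub>R a)"
  have "reflection_prod Dp y = reflection_prod Dm y"
    using arg_cong[OF assms(2), of "reflection_prod Dm"]
    by (simp add: coxeter_element_def m.reflection_prod_Dp_involution)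
  then have eq: "?d Dp = ?d Dm" by (simp add: reflection_prod_Dp m.reflection_prod_Dp)
  have d: "?d Dp \<in> span Dp" "?d Dm \<in> span Dm" by (auto intro!: span_sum span_scale intro: span_base)
  have "representation \<Delta> (?d Dp) = representation Dp (?d Dp)"
    "representation \<Delta> (?d Dm) = representation Dm (?d Dm)"
    using d by (auto intro!: representation_extend[OF indep])
  then have "representation Dp (?d Dp) = representation Dm (?d Dm)" using eq by simp
  then have "representation Dp (?d Dp) a = 0" for a
    using representation_ne_zero[of Dp "?d Dp" a] representation_ne_zero[of Dm "?d Dm" a] disjoint by auto
  then have "?d Dp = 0"
    using sum_representation_eq[of Dp "?d Dp" Dp] independent_mono[OF indep, of Dp] d finite_basis
    by simp
  then have "reflection_prod Dp y = y" "reflection_prod Dm y = y"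
    using eq by (simp_all add: reflection_prod_Dp m.reflection_prod_Dp)
  then have "y \<bullet> a = 0" if "a \<in> \<Delta>" for a
    using that inner_reflection_prod_Dp[of a y] m.inner_reflection_prod_Dp[of a y] by auto
  then show ?thesis using orthogonal_to_basis_eq_0[OF assms(1)] by blast
qed

text \<open>Every orbit of \<open>\<tau>\<^sub>+\<close> and \<open>\<tau>\<^sub>-\<close> contains a negative simple root: otherwise the sum over a
  \<open>c\<close>-orbit of positive roots would be a nonzero vector fixed by \<open>c\<close>.\<close>

lemma orbit_induct:
  assumes neg: "\<And>a. a \<in> \<Delta> \<Longrightarrow> Q (- a)"
    and tau_p: "\<And>b. b \<in> apos \<Longrightarrow> Q (tau Dp Dm b) \<Longrightarrow> Q b"
    and tau_m: "\<And>b. b \<in> apos \<Longrightarrow> Q (tau Dm Dp b) \<Longrightarrow> Q b"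
    and b: "b \<in> apos"
  shows "Q b"
proof (rule ccontr)
  assume nQ: "\<not> Q b"
  \<comment> \<open>Negative simple roots satisfy \<open>Q\<close>, and so do the roots that
    \<open>\<tau>\<close> sends to them. On the roots outside \<open>Q\<close>,
    \<open>\<tau>\<close> is thus the bare product of reflections.\<close>
  have p: "reflection_prod Dp b \<in> apos \<and> \<not> Q (reflection_prod Dp b)" if "b \<in> apos" "\<not> Q b" for b
    using that(1)
  proof (cases b rule: tau_cases)
    case simple
    then show ?thesis using neg[of b] tau_p[of b] that by auto
  qed (use neg tau_p[of b] tau_apos[of b] that in auto)
  have m: "reflection_prod Dm b \<in> apos \<and> \<not> Q (reflection_prod Dm b)" if "b \<in> apos" "\<not> Q b" for b
  proof -
    have "b \<in> almost_positive_roots \<Phi> (Dm \<union> Dp)" using that by (simp add: apos_swap)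
    then show ?thesis
    proof (cases b rule: m.tau_cases)
      case simple
      then show ?thesis using neg[of b] tau_m[of b] that by auto
    qed (use neg tau_m[of b] tau_m_apos[of b] that in auto)
  qed
  have orbit: "(cox ^^ k) b \<in> apos \<and> \<not> Q ((cox ^^ k) b)" for k
    using b nQ by (induction k) (use p m in \<open>auto simp: coxeter_element_def\<close>)
  then have pos: "(cox ^^ k) b \<in> pos" for k
    using neg by (fastforce simp: almost_positive_roots_def)
  obtain K where K: "0 < K" "cox ^^ K = id" using cox_finite_order by blast
  define v where "v = (\<Sum>k<K. (cox ^^ k) b)"
  have "cox v = (\<Sum>k<K. (cox ^^ Suc k) b)"
    unfolding v_def by (simp add: linear_sum[OF linear_cox])
  also have "\<dots> = v"
    using sum.lessThan_Suc_shift[of "\<lambda>k. (cox ^^ k) b" K] sum.lessThan_Suc[of "\<lambda>k. (cox ^^ k) b" K] K(2)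
    by (simp add: v_def)
  finally have "v = 0"
    using pos pos_root by (intro cox_fixed_eq_0) (auto simp: v_def intro!: span_sum)
  have "representation \<Delta> b a = 0" if "a \<in> \<Delta>" for a
  proof -
    have "(\<Sum>k<K. representation \<Delta> ((cox ^^ k) b) a) = representation \<Delta> v a"
      unfolding v_def using pos pos_root by (simp add: representation_sum[OF indep])
    then have "(\<Sum>k<K. representation \<Delta> ((cox ^^ k) b) a) = 0"
      using \<open>v = 0\<close> by (simp add: representation_zero)
    then have "\<forall>k\<in>{..<K}. representation \<Delta> ((cox ^^ k) b) a = 0"
      using pos pos_rep_nonneg[OF _ that] by (subst (asm) sum_nonneg_eq_0_iff) auto
    then show ?thesis using K(1) by force
  qed
  then have "b = 0"
    using sum_representation_eq[OF indep, of b \<Delta>] pos[of 0] pos_root finite_basis by simp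
  then show False using pos_nonzero[OF pos[of 0]] by simp
qed

subsection \<open>Projection of the orbit\<close>

text \<open>Angles of the projected orbit in units of \<theta>, which is later shown to be \<pi>/h.
  They are centred around 0 rather than taken from 1 to 2h.\<close>

definition orbit_angle :: "nat \<Rightarrow> real" where
  "orbit_angle i = (if even i = e then - real i else real i + 1)"

context
  fixes c :: "'a \<Rightarrow> real"
  assumes eigenvector: "coxeter_eigenvector \<Delta> c"
begin

abbreviation "pp \<equiv> plane_projection Dp Dm c"

lemma parts_nonempty: "Dp \<noteq> {}" "Dm \<noteq> {}"
  using s_part[of 0] s_part[of 1] h by (auto split: if_splits)

lemma eigen_exists: "\<exists>l. gram_eigen \<Delta> c l" and c_pos: "a \<in> \<Delta> \<Longrightarrow> 0 < c a"
  using eigenvector by (auto simp: coxeter_eigenvector_def)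

lemma linear_pp: "linear pp"
  using eigen_exists linear_plane_projection c_pos parts_nonempty by blast

text \<open>One reflection fixes \<open>x 0\<close>, and alternating the two produces all further
  elements, so all angles are known multiples of \<theta>. Positivity of the simple roots bounds
  \<open>(h - 1) * \<theta>\<close> by \<pi>, and the fixed last element makes
  \<open>h * \<theta>\<close> a multiple of \<pi>; hence it equals \<pi>.\<close>

lemma projection_orbit:
  obtains r where "0 < r" "\<And>i. i < h \<Longrightarrow> pp (x i) = rcis r (orbit_angle i * pi / real h)"
    "\<And>y. pp (cox y) = cis (- 2 * pi / real h) * pp y"
proof -
  obtain l where l: "gram_eigen \<Delta> c l" using eigen_exists by blast
  obtain \<theta> where \<theta>: "0 < \<theta>" "\<theta> < pi"
    and pm: "\<And>y. pp (reflection_prod Dm y) = cnj (pp y)"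
    and pp: "\<And>y. pp (reflection_prod Dp y) = cis (2 * \<theta>) * cnj (pp y)"
    and Re_p: "\<And>a. a \<in> Dp \<Longrightarrow> 0 < Re (pp a)"
    and Re_m: "\<And>a. a \<in> Dm \<Longrightarrow> 0 < Re (pp a * cis (- \<theta>))"
    using coxeter_plane_angle[OF l c_pos parts_nonempty] by blast
  \<comment> \<open>A signed radius: \<open>x 0\<close> lies on the axis of the reflection that
    fixes it, but on which half is settled only through \<open>cos_diff\<close>.\<close>
  define r where "r = Re (pp (x 0) * cis (- orbit_angle 0 * \<theta>))"
  have "h > 0" using h by simp
  have angle0: "orbit_angle 0 = (if e then 0 else 1)" by (simp add: orbit_angle_def)
  have "Im (pp (x 0) * cis (- orbit_angle 0 * \<theta>)) = 0"
  proof (cases e)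
    case True
    then have "reflection_prod Dm (x 0) = x 0"
      using m.reflection_prod_x[of 0] h by (simp add: zigzag_swap_def)
    then have "pp (x 0) = cnj (pp (x 0))" using pm[of "x 0"] by simp
    then show ?thesis unfolding angle0 using True by (simp add: complex_eq_iff)
  next
    case False
    then have "reflection_prod Dp (x 0) = x 0"
      using reflection_prod_x[of 0] h by (simp add: zigzag_swap_def)
    then have "pp (x 0) = cis (2 * \<theta>) * cnj (pp (x 0))" using pp[of "x 0"] by simp
    then have "pp (x 0) * cis (- \<theta>) = cis (2 * \<theta>) * cis (- \<theta>) * cnj (pp (x 0))" by (simp add: algebra_simps)
    also have "\<dots> = cnj (pp (x 0) * cis (- \<theta>))" by (simp add: cis_mult cis_cnj mult.commute)
    finally show ?thesis unfolding angle0 using False by (simp add: complex_eq_iff mult.commute)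
  qed
  then have "pp (x 0) * cis (- orbit_angle 0 * \<theta>) = of_real r"
    by (simp add: r_def complex_eq_iff)
  then have "pp (x 0) = of_real r * cis (orbit_angle 0 * \<theta>)"
    by (metis cis_divide cis_neq_zero cis_zero diff_self divide_divide_eq_right eq_divide_eq mult_minus_left
        minus_diff_eq cis_inverse divide_inverse inverse_inverse_eq mult.right_neutral)
  then have z0: "pp (x 0) = rcis r (orbit_angle 0 * \<theta>)" by (simp add: rcis_def)
  have cnj_rcis: "cnj (rcis r a) = rcis r (- a)" "cis b * rcis r a = rcis r (b + a)" for a b
    by (simp_all add: rcis_def cis_cnj cis_mult mult.left_commute)
  have z: "pp (x i) = rcis r (orbit_angle i * \<theta>)" if "i < h" for i
    using that
  proof (induction i)
    case (Suc i)
    then have IH: "pp (x i) = rcis r (orbit_angle i * \<theta>)" by simp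
    show ?case
    proof (cases "even i = e")
      case True
      then have "x (Suc i) = reflection_prod Dp (x i)"
        using reflection_prod_x[of i] Suc.prems by (simp add: zigzag_swap_def)
      then show ?thesis
        using True by (simp add: pp IH cnj_rcis orbit_angle_def algebra_simps)
    next
      case False
      then have "x (Suc i) = reflection_prod Dm (x i)"
        using m.reflection_prod_x[of i] Suc.prems by (simp add: zigzag_swap_def)
      then show ?thesis
        using False by (simp add: pm IH cnj_rcis orbit_angle_def algebra_simps)
    qed
  qed (rule z0)
  \<comment> \<open>The step at \<open>i\<close> is a positive multiple of a root in one part, and
    such a root projects positively onto the corresponding vector, \<open>\<lambda>\<close> or
    \<open>\<mu>\<close>.\<close>
  have cos_diff: "0 < r * (cos (real i * \<theta>) - cos (real (i + 2) * \<theta>))" if i: "Suc i < h" for i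
  proof (cases "even i = e")
    case True
    have "0 < t i * Re (pp (s i))" using Re_p[of "s i"] s_part[OF i] t_pos[OF i] True by simp
    also have "\<dots> = Re (pp (x i - x (Suc i)))" using step[OF i] linear_scale[OF linear_pp] by simp
    also have "\<dots> = Re (rcis r (orbit_angle i * \<theta>)) - Re (rcis r (orbit_angle (Suc i) * \<theta>))"
      using z[of i] z[of "Suc i"] i by (simp add: linear_diff[OF linear_pp])
    finally show ?thesis using True by (simp add: orbit_angle_def algebra_simps)
  next
    case False
    have "0 < t i * Re (pp (s i) * cis (- \<theta>))" using Re_m[of "s i"] s_part[OF i] t_pos[OF i] False by simp
    also have "\<dots> = Re (pp (x i - x (Suc i)) * cis (- \<theta>))"
      using step[OF i] linear_scale[OF linear_pp] by (simp add: algebra_simps)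
    also have "\<dots> = Re (cis (- \<theta>) * rcis r (orbit_angle i * \<theta>)) - Re (cis (- \<theta>) * rcis r (orbit_angle (Suc i) * \<theta>))"
      using z[of i] z[of "Suc i"] i by (simp add: linear_diff[OF linear_pp] algebra_simps)
    also have "\<dots> = r * cos (real i * \<theta>) - r * cos (- (real (i + 2) * \<theta>))"
      using False unfolding cnj_rcis Re_rcis orbit_angle_def by (simp add: algebra_simps minus_diff_commute)
    finally show ?thesis by (simp add: right_diff_distrib)
  qed
  have cos_sin: "cos (real i * \<theta>) - cos (real (i + 2) * \<theta>) = 2 * sin (real (Suc i) * \<theta>) * sin \<theta>" for i
    by (simp add: cos_diff_cos algebra_simps add_divide_distrib flip: minus_divide_left)
  have sin_pos: "sin \<theta> > 0" using \<theta> by (rule sin_gt_zero)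
  have "0 < r"
    using cos_diff[of 0] h sin_pos unfolding cos_sin by (simp add: zero_less_mult_iff)
  have sin_mult: "sin (real (Suc i) * \<theta>) > 0" if "Suc i < h" for i
    using cos_diff[OF that] sin_pos \<open>0 < r\<close> unfolding cos_sin by (simp add: zero_less_mult_iff)
  \<comment> \<open>One more \<theta> keeps the angle below \<open>2 * pi\<close>, and there a
    positive sine forces it below \<open>pi\<close>.\<close>
  have less_pi: "real (Suc i) * \<theta> < pi" if "Suc i < h" for i
    using that
  proof (induction i)
    case (Suc i)
    then have "real (Suc (Suc i)) * \<theta> < 2 * pi" using \<theta> by (simp add: algebra_simps)
    moreover have "0 < sin (real (Suc (Suc i)) * \<theta>)" using sin_mult Suc by blast
    ultimately show ?case
      using sin_le_zero[of "real (Suc (Suc i)) * \<theta>"] by (meson not_le)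
  qed (use \<theta> in simp)
  obtain m where m: "h = Suc m" using \<open>h > 0\<close> by (cases h) auto
  \<comment> \<open>The last element \<open>x m\<close> is fixed by the reflection that offers it no
    partner, so its angle equals its mirror image up to full turns.\<close>
  have "cis (2 * (real h * \<theta>)) = 1"
  proof (cases "even m = e")
    case True
    then have "pp (x m) = cis (2 * \<theta>) * cnj (pp (x m))"
      using pp[of "x m"] reflection_prod_x[of m] m by (simp add: zigzag_swap_def)
    then have "rcis r (orbit_angle m * \<theta>) = rcis r (2 * \<theta> - orbit_angle m * \<theta>)"
      using z[of m] m by (simp add: cnj_rcis)
    then have "cis (orbit_angle m * \<theta>) = cis (2 * \<theta> - orbit_angle m * \<theta>)"
      using \<open>0 < r\<close> by (simp add: rcis_def)
    then have "cis (2 * \<theta> - orbit_angle m * \<theta>) / cis (orbit_angle m * \<theta>) = 1" by simp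
    then show ?thesis using True m by (simp add: cis_divide orbit_angle_def algebra_simps)
  next
    case False
    then have "pp (x m) = cnj (pp (x m))"
      using pm[of "x m"] m.reflection_prod_x[of m] m by (simp add: zigzag_swap_def)
    then have "rcis r (orbit_angle m * \<theta>) = rcis r (- (orbit_angle m * \<theta>))"
      using z[of m] m by (simp add: cnj_rcis)
    then have "cis (orbit_angle m * \<theta>) = cis (- (orbit_angle m * \<theta>))"
      using \<open>0 < r\<close> by (simp add: rcis_def)
    then have "cis (orbit_angle m * \<theta>) / cis (- (orbit_angle m * \<theta>)) = 1" by simp
    then show ?thesis using False m by (simp add: cis_divide orbit_angle_def algebra_simps)
  qed
  then have "cos (2 * (real h * \<theta>)) = 1" by (simp add: complex_eq_iff)
  then have sin0: "sin (real h * \<theta>) = 0" by (simp add: cos_double_sin)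
  obtain m' where m': "m = Suc m'" using m h by (cases m) auto
  have "real h * \<theta> < 2 * pi"
    using less_pi[of m'] m m' \<theta> by (simp add: algebra_simps)
  moreover have "0 < real h * \<theta>" using \<theta> \<open>h > 0\<close> by simp
  ultimately have "real h * \<theta> = pi"
    using sin0 sin_gt_zero[of "real h * \<theta>"] sin_lt_zero[of "real h * \<theta>"] by (cases "real h * \<theta>" pi rule: linorder_cases) auto
  then have th: "\<theta> = pi / real h" using \<open>h > 0\<close> by (simp add: field_simps)
  have "pp (cox y) = cis (- 2 * pi / real h) * pp y" for y
    by (simp add: coxeter_element_def pm pp th cis_cnj)
  then show thesis using that[OF \<open>0 < r\<close>] z th by simp
qed

end

end

text \<open>The admissible angles fill at most one full turn, excluding 0 and including
  \<open>2 * pi\<close>, so the index \<open>k\<close> is unique.\<close>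

lemma enlarge_rcis:
  assumes "0 < r" "1 \<le> k" "k \<le> 2 * h"
  shows "enlarge h (rcis r (real k * pi / real h)) =
    rcis r (real (if k \<le> h then k + 2 else k + 4) * pi / real (h + 2))"
proof -
  have h: "h > 0" using assms by auto
  have "(THE k'::nat. 1 \<le> k' \<and> k' \<le> 2 * h \<and>
      rcis r (real k * pi / real h) = rcis r (real k' * pi / real h)) = k"
  proof (rule the_equality)
    fix k' assume k': "1 \<le> k' \<and> k' \<le> 2 * h \<and>
      rcis r (real k * pi / real h) = rcis r (real k' * pi / real h)"
    \<comment> \<open>Negation shifts the angles by \<open>pi\<close>, into the range of
      \<open>Arg\<close>.\<close>
    have *: "Arg (- cis (real m * pi / real h)) = real m * pi / real h - pi" if "1 \<le> m" "m \<le> 2 * h" for m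
    proof -
      have "0 < real m * pi / real h" using that h by simp
      moreover have "real m * pi / real h \<le> 2 * pi"
        using that h mult_right_mono[of "real m" "real (2 * h)" pi] by (simp add: field_simps)
      moreover have "- cis (real m * pi / real h) = cis (real m * pi / real h - pi)"
        by (simp add: complex_eq_iff)
      ultimately show ?thesis by (simp add: Arg_cis)
    qed
    have "cis (real k * pi / real h) = cis (real k' * pi / real h)"
      using k' assms(1) by (simp add: rcis_def)
    then have "real k * pi / real h - pi = real k' * pi / real h - pi"
      using *[of k] *[of k'] k' assms by metis
    then show "k' = k" using h by simp
  qed (use assms in auto)
  then show ?thesis using assms by (simp add: enlarge_def)
qed

section \<open>The Coxeter number and the orbit on the enlarged polygon\<close>

context zigzag_orbit
begin

context
  fixes c :: "'a \<Rightarrow> real"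
  assumes eigenvector: "coxeter_eigenvector \<Delta> c"
begin

text \<open>\<open>cox\<close> turns the plane by \<open>- 2 * pi / h\<close>, so no smaller power
  is the identity. The power \<open>h\<close> preserves projections, and orbit elements have
  distinct projections, so it fixes the orbit.\<close>

lemma coxeter_number_eq: "coxeter_number Dp Dm = h"
proof -
  obtain r where r: "0 < r" "\<And>i. i < h \<Longrightarrow> plane_projection Dp Dm c (x i) = rcis r (orbit_angle i * pi / real h)"
    and cox: "\<And>y. plane_projection Dp Dm c (cox y) = cis (- 2 * pi / real h) * plane_projection Dp Dm c y"
    using projection_orbit[OF eigenvector] by metis
  have h0: "h > 0" using h by simp
  have power: "plane_projection Dp Dm c ((cox ^^ k) y) = cis (- 2 * pi * real k / real h) * plane_projection Dp Dm c y" for k y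
  proof (induction k)
    case (Suc k)
    have "- 2 * pi * real (Suc k) / real h = - 2 * pi / real h + - 2 * pi * real k / real h"
      using h0 by (simp add: field_simps)
    then have "cis (- 2 * pi / real h) * cis (- 2 * pi * real k / real h) = cis (- 2 * pi * real (Suc k) / real h)"
      by (simp only: cis_mult)
    moreover have "plane_projection Dp Dm c ((cox ^^ Suc k) y) =
        cis (- 2 * pi / real h) * cis (- 2 * pi * real k / real h) * plane_projection Dp Dm c y"
      by (simp add: cox Suc)
    ultimately show ?case by simp
  qed simp
  have Arg: "Arg (rcis r (orbit_angle i * pi / real h)) = orbit_angle i * pi / real h" if "i < h" for i
  proof -
    have "- real h < orbit_angle i" "orbit_angle i \<le> real h" using that by (auto simp: orbit_angle_def)
    then have "- pi < orbit_angle i * pi / real h" "orbit_angle i * pi / real h \<le> pi"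
      using h0 mult_strict_right_mono[of "- real h" "orbit_angle i" pi]
        mult_right_mono[of "orbit_angle i" "real h" pi] by (auto simp: field_simps)
    then show ?thesis using \<open>0 < r\<close> by (simp add: rcis_def Arg_times_of_real2 Arg_cis)
  qed
  have inj: "i = j" if "i < h" "j < h" "plane_projection Dp Dm c (x i) = plane_projection Dp Dm c (x j)" for i j
  proof -
    have "orbit_angle i * pi / real h = orbit_angle j * pi / real h"
      using that r(2) Arg by metis
    then have "orbit_angle i = orbit_angle j" using h0 by simp
    then show ?thesis by (auto simp: orbit_angle_def split: if_splits)
  qed
  show ?thesis
    unfolding coxeter_number_def
  proof (rule map_order_eqI[OF h0])
    have "cis (- 2 * pi * real h / real h) = 1" using h0 by (simp add: complex_eq_iff)
    show "cox ^^ h = id"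
    proof (rule cox_power_id)
      fix i assume i: "i < h"
      then obtain j where j: "j < h" "(cox ^^ h) (x i) = x j" using cox_power_x by blast
      then have "plane_projection Dp Dm c (x j) = plane_projection Dp Dm c (x i)"
        using power[of h "x i"] \<open>cis _ = 1\<close> by simp
      then show "(cox ^^ h) (x i) = x i" using inj i j by metis
    qed
  next
    fix k assume k: "0 < k" "cox ^^ k = id"
    show "h \<le> k"
    proof (rule ccontr)
      assume "\<not> h \<le> k"
      have "plane_projection Dp Dm c (x 0) \<noteq> 0" using r(2)[OF h0] r(1) by simp
      then have "cis (- 2 * pi * real k / real h) = 1" using power[of k "x 0"] k(2) by simp
      moreover define u where "u = pi * real k / real h"
      ultimately have "cos (2 * u) = 1" by (auto simp: complex_eq_iff mult.assoc)
      then have "sin (pi * real k / real h) = 0" unfolding u_def[symmetric] by (simp add: cos_double_sin)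
      moreover have "0 < sin (pi * real k / real h)"
        using k(1) \<open>\<not> h \<le> k\<close> h0 by (intro sin_gt_zero) (auto simp: field_simps)
      ultimately show False by simp
    qed
  qed
qed

text \<open>An angle \<open>i + 1\<close> is at most \<open>h\<close> and becomes
  \<open>i + 3\<close>. An angle \<open>- i\<close> is first written as \<open>2 * h - i\<close>,
  exceeds \<open>h\<close>, and becomes \<open>2 * h - i + 4\<close>, which is \<open>- i\<close> up
  to a full turn of \<open>2 * (h + 2)\<close> units.\<close>

lemma hat_orbit:
  obtains r where "0 < r" "\<And>i. i < h \<Longrightarrow> hat Dp Dm c (x i) = zigzag_vertex r h e (i + 1)"
proof -
  obtain r where r: "0 < r" "\<And>i. i < h \<Longrightarrow> plane_projection Dp Dm c (x i) = rcis r (orbit_angle i * pi / real h)"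
    using projection_orbit[OF eigenvector] by metis
  have "hat Dp Dm c (x i) = zigzag_vertex r h e (i + 1)" if i: "i < h" for i
  proof (cases "even i = e")
    case True
    have angle: "orbit_angle i = - real i" unfolding orbit_angle_def using True by simp
    have "rcis r (orbit_angle i * pi / real h) = rcis r (orbit_angle i * pi / real h + 2 * pi)"
      by (simp add: rcis_add_2pi)
    also have "orbit_angle i * pi / real h + 2 * pi = real (2 * h - i) * pi / real h"
      unfolding angle using i by (simp add: field_simps of_nat_diff)
    finally have "rcis r (orbit_angle i * pi / real h) = rcis r (real (2 * h - i) * pi / real h)" .
    moreover have "\<not> 2 * h - i \<le> h" using i by simp
    ultimately have "hat Dp Dm c (x i) = rcis r (real (2 * h - i + 4) * pi / real (h + 2))"
      using i r enlarge_rcis[of r "2 * h - i" h] \<open>\<not> 2 * h - i \<le> h\<close>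
      by (simp add: hat_def coxeter_number_eq)
    moreover have "zigzag_angle e (i + 1) = - real i" unfolding zigzag_angle_def using True by simp
    then have "real (2 * h - i + 4) * pi / real (h + 2) = zigzag_angle e (i + 1) * pi / real (h + 2) + 2 * pi"
      using i by (simp add: field_simps of_nat_diff)
    ultimately show ?thesis by (simp only: rcis_add_2pi zigzag_vertex_def)
  next
    case False
    have "orbit_angle i = real (i + 1)" using False by (simp add: orbit_angle_def)
    then have "hat Dp Dm c (x i) = rcis r (real (i + 1 + 2) * pi / real (h + 2))"
      using i r enlarge_rcis[of r "i + 1" h] by (simp add: hat_def coxeter_number_eq)
    also have "real (i + 1 + 2) = zigzag_angle e (i + 1)" using False by (simp add: zigzag_angle_def)
    finally show ?thesis by (simp only: zigzag_vertex_def)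
  qed
  then show thesis using that r by blast
qed

lemma negative_simple_diagram_eq:
  assumes "\<And>i. i < h \<Longrightarrow> hat Dp Dm c (x i) = z (i + 1)" and a: "a \<in> \<Delta>"
  shows "negative_simple_diagram Dp Dm c (x ` {..<h}) a = diagram z (- a)"
proof
  have "a \<noteq> 0" using a basis_nonzero by blast
  show "negative_simple_diagram Dp Dm c (x ` {..<h}) a \<subseteq> diagram z (- a)"
  proof
    fix S assume "S \<in> negative_simple_diagram Dp Dm c (x ` {..<h}) a"
    then obtain i where i: "i < h" "reflection a (x i) \<noteq> x i"
      "S = closed_segment (hat Dp Dm c (x i)) (hat Dp Dm c (reflection a (x i)))"
      by (auto simp: negative_simple_diagram_def)
    then have "x i \<bullet> a \<noteq> 0" using reflection_fixed by blast
    then have "Suc i < h \<and> s i = a \<or> 0 < i \<and> s (i - 1) = a"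
      using moved[OF a i(1)] by blast
    then consider "Suc i < h" "s i = a" | j where "i = Suc j" "s j = a"
      by (cases i) auto
    then show "S \<in> diagram z (- a)"
    proof cases
      case 1
      then have "S = closed_segment (z (i + 1)) (z (i + 2))"
        using i assms(1)[of i] assms(1)[of "Suc i"] reflection_x(1)[of i] by simp
      then show ?thesis using 1 a by (auto simp: diagram_negative)
    next
      case 2
      then have "S = closed_segment (z (j + 2)) (z (j + 1))"
        using i assms(1)[of i] assms(1)[of j] reflection_x(2)[of j] by simp
      then show ?thesis using 2 a i(1) by (auto simp: diagram_negative closed_segment_commute)
    qed
  qed
  show "diagram z (- a) \<subseteq> negative_simple_diagram Dp Dm c (x ` {..<h}) a"
  proof
    fix S assume "S \<in> diagram z (- a)"
    then obtain i where i: "Suc i < h" "s i = a" "S = closed_segment (z (i + 1)) (z (i + 2))"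
      using a by (auto simp: diagram_negative)
    then have "S = closed_segment (hat Dp Dm c (x i)) (hat Dp Dm c (reflection a (x i)))"
      using assms(1)[of i] assms(1)[of "Suc i"] reflection_x(1)[of i] by simp
    moreover have "reflection a (x i) \<noteq> x i"
      using reflection_x(1)[of i] x_distinct[of i "Suc i"] i by auto
    ultimately show "S \<in> negative_simple_diagram Dp Dm c (x ` {..<h}) a"
      using i(1) by (auto simp: negative_simple_diagram_def)
  qed
qed

end

section \<open>Uniqueness of the compatibility relation and of the diagrams\<close>

lemma minus_basis_apos: "a \<in> \<Delta> \<Longrightarrow> - a \<in> apos"
  by (auto simp: almost_positive_roots_def)

lemma compatibility_eqI:
  assumes R: "is_compatibility \<Phi> Dp Dm R"
  shows "compatibility \<Phi> Dp Dm = R"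
  unfolding compatibility_def
proof (rule the_equality, rule R)
  fix R' assume R': "is_compatibility \<Phi> Dp Dm R'"
  \<comment> \<open>The first component is quantified inside the induction, because each
    \<open>\<tau>\<close> moves it along with the second.\<close>
  have "\<forall>b\<in>apos. (b, g) \<in> R \<longleftrightarrow> (b, g) \<in> R'" if "g \<in> apos" for g
    using _ _ _ that
  proof (rule orbit_induct)
    show "\<forall>b\<in>apos. (b, - a) \<in> R \<longleftrightarrow> (b, - a) \<in> R'" if "a \<in> \<Delta>" for a
      using R R' that unfolding is_compatibility_def Let_def by blast
    show "\<forall>b\<in>apos. (b, g) \<in> R \<longleftrightarrow> (b, g) \<in> R'"
      if "g \<in> apos" "\<forall>b\<in>apos. (b, tau Dp Dm g) \<in> R \<longleftrightarrow> (b, tau Dp Dm g) \<in> R'" for g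
      using R R' that tau_apos by (simp add: is_compatibility_def Let_def) metis
    show "\<forall>b\<in>apos. (b, g) \<in> R \<longleftrightarrow> (b, g) \<in> R'"
      if "g \<in> apos" "\<forall>b\<in>apos. (b, tau Dm Dp g) \<in> R \<longleftrightarrow> (b, tau Dm Dp g) \<in> R'" for g
      using R R' that tau_m_apos by (simp add: is_compatibility_def Let_def) metis
  qed
  moreover have "R \<subseteq> apos \<times> apos" "R' \<subseteq> apos \<times> apos"
    using R R' by (simp_all add: is_compatibility_def Let_def)
  ultimately show "R' = R" by auto
qed

text \<open>The same induction, with injectivity of the line reflections on collections of segments;
  extensionality settles the values off the almost positive roots.\<close>

lemma root_diagram_eqI:
  assumes F: "is_root_diagram \<Phi> Dp Dm c orb F"
  shows "root_diagram \<Phi> Dp Dm c orb = F"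
  unfolding root_diagram_def
proof (rule the_equality, rule F)
  fix F' assume F': "is_root_diagram \<Phi> Dp Dm c orb F'"
  have inj: "inj (\<lambda>S. (\<lambda>s. line_reflection \<theta> ` s) ` S)" for \<theta>
    by (intro injI) (metis inj_image_eq_iff inj_line_reflection inj_def)
  have "F b = F' b" if "b \<in> apos" for b
    using _ _ _ that
  proof (rule orbit_induct)
    show "F (- a) = F' (- a)" if "a \<in> \<Delta>" for a
      using F F' that unfolding is_root_diagram_def Let_def by simp
    show "F b = F' b" if "b \<in> apos" "F (tau Dp Dm b) = F' (tau Dp Dm b)" for b
      using F F' that unfolding is_root_diagram_def Let_def by (metis injD[OF inj])
    show "F b = F' b" if "b \<in> apos" "F (tau Dm Dp b) = F' (tau Dm Dp b)" for b
      using F F' that unfolding is_root_diagram_def Let_def by (metis injD[OF inj])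
  qed
  moreover have "F \<in> extensional apos" "F' \<in> extensional apos"
    using F F' by (simp_all add: is_root_diagram_def Let_def)
  ultimately show "F' = F" by (metis extensionalityI)
qed

theorem compatible_iff_not_crossing:
  assumes eigenvector: "coxeter_eigenvector \<Delta> c"
    and b: "b \<in> apos" and g: "g \<in> apos" and "b \<noteq> g"
  shows "(b, g) \<in> compatibility \<Phi> Dp Dm \<longleftrightarrow>
    (\<forall>S \<in> root_diagram \<Phi> Dp Dm c (x ` {..<h}) b. \<forall>T \<in> root_diagram \<Phi> Dp Dm c (x ` {..<h}) g. \<not> crosses S T)"
proof -
  interpret m: zigzag_orbit Dm Dp \<Phi> x s t h "\<not> e" by (rule swap)
  obtain r where r: "0 < r" "\<And>i. i < h \<Longrightarrow> hat Dp Dm c (x i) = zigzag_vertex r h e (i + 1)"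
    using hat_orbit[OF eigenvector] by blast
  define z where "z = zigzag_vertex r h e"
  define F where "F = restrict (diagram z) apos"
  let ?p = "\<lambda>s. line_reflection (pi / real (h + 2)) ` s"
  let ?m = "\<lambda>s. line_reflection (2 * pi / real (h + 2)) ` s"
  have tau_p: "diagram z (tau Dp Dm b) = ?p ` diagram z b" if "b \<in> apos" for b
    using line_reflection_zigzag(1) by (intro diagram_tau[OF that]) (simp add: z_def)
  have tau_m: "diagram z (tau Dm Dp b) = ?m ` diagram z b" if "b \<in> apos" for b
    using m.diagram_tau[of b "2 * pi / real (h + 2)" z] that line_reflection_zigzag(2)
    by (simp add: z_def diagram_swap apos_swap)
  have F: "is_root_diagram \<Phi> Dp Dm c (x ` {..<h}) F"
    unfolding is_root_diagram_def Let_def coxeter_number_eq[OF eigenvector]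
    using tau_p tau_m tau_apos tau_m_apos minus_basis_apos
      negative_simple_diagram_eq[OF eigenvector, of z] r(2)
    by (auto simp: F_def z_def)
  \<comment> \<open>The axioms exclude the pair of \<open>- a\<close> with itself, whose coefficient
    at \<open>a\<close> is -1; the condition \<open>b \<noteq> g\<close> builds this in and is
    preserved by the involutions.\<close>
  define R where "R = {(b, g). b \<in> apos \<and> g \<in> apos \<and> b \<noteq> g \<and>
    (\<forall>S \<in> diagram z b. \<forall>T \<in> diagram z g. \<not> crosses S T)}"
  have crossing: "(b, - a) \<in> R \<longleftrightarrow> representation \<Delta> b a = 0" if a: "a \<in> \<Delta>" and b: "b \<in> apos" for a b
  proof (cases "b \<in> uminus ` \<Delta>")
    case True
    then obtain a' where a': "a' \<in> \<Delta>" "b = - a'" by auto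
    have "\<not> crosses S T" if "a' \<noteq> a" "S \<in> diagram z (- a')" "T \<in> diagram z (- a)" for S T
      using that a a' zigzag_steps_not_crosses[OF r(1)] by (auto simp: diagram_negative z_def)
    then show ?thesis
      using a a' b minus_basis_apos[OF a] by (auto simp: R_def representation_minus_basis)
  next
    case False
    then have pos: "b \<in> pos" using b by (auto simp: almost_positive_roots_def)
    have cross: "crosses (closed_segment (z i) (z (j + 2))) (closed_segment (z (k + 1)) (z (k + 2))) \<longleftrightarrow> i \<le> k \<and> k < j"
      if "i < j" "j < h" "Suc k < h" for i j k
      unfolding z_def by (rule zigzag_crosses_iff[OF r(1) that(3) that(1,2)])
    \<comment> \<open>One chord of \<open>b\<close> suffices to detect a crossing. For the converse
      all chords are examined, and each runs over exactly the simple roots in the support of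
      \<open>b\<close>.\<close>
    obtain i j l where ij: "i < j" "j < h" "0 < l" "x i - x j = l *\<^sub>R b" using positive[OF pos] by blast
    show ?thesis
    proof
      assume "(b, - a) \<in> R"
      have "s k \<noteq> a" if k: "k \<in> {i..<j}" for k
      proof
        assume "s k = a"
        have "Suc k < h" using k ij by auto
        then have "closed_segment (z (k + 1)) (z (k + 2)) \<in> diagram z (- a)"
          using \<open>s k = a\<close> by (auto simp: diagram_negative[OF a])
        moreover have "closed_segment (z i) (z (j + 2)) \<in> diagram z b"
          using ij by (auto simp: diagram_positive[OF pos])
        ultimately show False
          using \<open>(b, - a) \<in> R\<close> cross[OF ij(1,2) \<open>Suc k < h\<close>] k by (auto simp: R_def)
      qed
      then show "representation \<Delta> b a = 0" using pos_rep_eq_0_iff[OF pos ij] by blast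
    next
      assume rep: "representation \<Delta> b a = 0"
      have "\<not> crosses S T" if S: "S \<in> diagram z b" and T: "T \<in> diagram z (- a)" for S T
      proof -
        obtain i j l where i: "S = closed_segment (z i) (z (j + 2))" "i < j" "j < h" "0 < l" "x i - x j = l *\<^sub>R b"
          using S by (auto simp: diagram_positive[OF pos])
        obtain k where k: "T = closed_segment (z (k + 1)) (z (k + 2))" "Suc k < h" "s k = a"
          using T by (auto simp: diagram_negative[OF a])
        have "k \<notin> {i..<j}" using pos_rep_eq_0_iff[OF pos i(2-5)] rep k(3) by blast
        then show ?thesis using cross[of i j k] i k by auto
      qed
      moreover have "b \<noteq> - a" using False a by auto
      ultimately show "(b, - a) \<in> R" using b minus_basis_apos[OF a] by (auto simp: R_def)
    qed
  qed
  have "is_compatibility \<Phi> Dp Dm R"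
    unfolding is_compatibility_def Let_def
  proof (intro conjI ballI)
    show "R \<subseteq> apos \<times> apos" by (auto simp: R_def)
    show "(tau Dp Dm b, tau Dp Dm g) \<in> R \<longleftrightarrow> (b, g) \<in> R" if "b \<in> apos" "g \<in> apos" for b g
      using that tau_apos tau_involution[of b] tau_involution[of g]
      by (auto simp: R_def tau_p crosses_line_reflection)
    show "(tau Dm Dp b, tau Dm Dp g) \<in> R \<longleftrightarrow> (b, g) \<in> R" if "b \<in> apos" "g \<in> apos" for b g
      using that tau_m_apos tau_m_involution[of b] tau_m_involution[of g]
      by (auto simp: R_def tau_m crosses_line_reflection)
  qed (rule crossing)
  then have "compatibility \<Phi> Dp Dm = R" by (rule compatibility_eqI)
  moreover have "root_diagram \<Phi> Dp Dm c (x ` {..<h}) = F" using F by (rule root_diagram_eqI)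
  ultimately show ?thesis using b g \<open>b \<noteq> g\<close> by (simp add: R_def F_def)
qed

end

subsection \<open>Orbits in which all chords are normal to reflecting hyperplanes\<close>

text \<open>The common ground of the three types. \<open>chord\<close> makes differences of orbit
  elements proportional to roots, which yields a total order; \<open>faithful\<close> ensures that
  every root is such a difference up to scaling.\<close>

locale reflecting_orbit =
  fixes W :: "('a::euclidean_space \<Rightarrow> 'a) set" and \<Phi> \<Delta> Dp Dm orb :: "'a set"
  assumes roots: "root_system W \<Phi>" and simple: "simple_roots \<Phi> \<Delta>"
    and bipartite: "bipartition \<Delta> Dp Dm"
    and stable_orb: "w \<in> W \<Longrightarrow> y \<in> orb \<Longrightarrow> w y \<in> orb"
    and card_orb: "3 \<le> card orb"
    and norm_orb: "y \<in> orb \<Longrightarrow> z \<in> orb \<Longrightarrow> norm y = norm z"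
    and chord: "y \<in> orb \<Longrightarrow> z \<in> orb \<Longrightarrow> y \<noteq> z \<Longrightarrow> reflection (y - z) \<in> W"
    and faithful: "b \<noteq> 0 \<Longrightarrow> reflection b \<in> W \<Longrightarrow> \<exists>y\<in>orb. y \<bullet> b \<noteq> 0"
begin

lemma finite_orb: "finite orb"
  using card_orb by (metis card.infinite not_numeral_le_zero)

lemma root: "b \<in> \<Phi> \<Longrightarrow> b \<noteq> 0" "b \<in> \<Phi> \<Longrightarrow> reflection b \<in> W"
  using roots by (auto simp: root_system_def)

lemma reflection_root: "a \<in> \<Phi> \<Longrightarrow> b \<in> \<Phi> \<Longrightarrow> reflection a b \<in> \<Phi>"
  using roots by (auto simp: root_system_def)

lemma minus_root: "b \<in> \<Phi> \<Longrightarrow> - b \<in> \<Phi>"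
  using reflection_root[of b b] by (simp add: reflection_self)

lemma root_line: "b \<noteq> 0 \<Longrightarrow> reflection b \<in> W \<Longrightarrow> \<exists>a. \<Phi> \<inter> span {b} = {a, - a}"
  using roots by (auto simp: root_system_def)

lemma root_multiple:
  assumes "b \<in> \<Phi>" "k *\<^sub>R b \<in> \<Phi>" "0 < k"
  shows "k = 1"
proof -
  obtain a where a: "\<Phi> \<inter> span {b} = {a, - a}"
    using root_line root assms(1) by blast
  have "b \<in> {a, - a}" "k *\<^sub>R b \<in> {a, - a}"
    using assms(1,2) unfolding a[symmetric] by (auto intro: span_base span_scale)
  then have "k *\<^sub>R b = b \<or> k *\<^sub>R b = - b" by auto
  then have "(k - 1) *\<^sub>R b = 0 \<or> (k + 1) *\<^sub>R b = 0" by (auto simp: algebra_simps)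
  then show ?thesis using root(1)[OF assms(1)] assms(3) by auto
qed

lemma indep: "independent \<Delta>" and finite_simple: "finite \<Delta>" and simple_subset: "\<Delta> \<subseteq> \<Phi>"
  and roots_span: "\<Phi> \<subseteq> span \<Delta>" and parts: "\<Delta> = Dp \<union> Dm" "Dp \<inter> Dm = {}"
  using simple bipartite independent_imp_finite by (auto simp: simple_roots_def bipartition_def)

section \<open>The order on the orbit\<close>

definition nonneg :: "'a \<Rightarrow> bool" where
  "nonneg v \<longleftrightarrow> v \<in> span \<Delta> \<and> (\<forall>a\<in>\<Delta>. 0 \<le> representation \<Delta> v a)"

lemma root_sign: "b \<in> \<Phi> \<Longrightarrow> b \<in> positive_roots \<Phi> \<Delta> \<or> - b \<in> positive_roots \<Phi> \<Delta>"
proof -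
  assume b: "b \<in> \<Phi>"
  then have "representation \<Delta> (- b) a = - representation \<Delta> b a" for a
    using roots_span by (simp add: representation_neg[OF indep subsetD])
  moreover have "(\<forall>a\<in>\<Delta>. 0 \<le> representation \<Delta> b a) \<or> (\<forall>a\<in>\<Delta>. representation \<Delta> b a \<le> 0)"
    using simple b by (auto simp: simple_roots_def)
  ultimately show ?thesis using b minus_root[OF b] by (auto simp: positive_roots_def)
qed

lemma positive_root_nonneg: "b \<in> positive_roots \<Phi> \<Delta> \<Longrightarrow> nonneg b"
  using roots_span by (auto simp: positive_roots_def nonneg_def)

lemma sum_representation: "v \<in> span \<Delta> \<Longrightarrow> (\<Sum>a\<in>\<Delta>. representation \<Delta> v a *\<^sub>R a) = v"
  using sum_representation_eq[OF indep _ finite_simple] by blast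

text \<open>On \<open>span \<Delta>\<close> the sum of the simple coefficients. Differences in the
  orbit are multiples of roots, so on the orbit comparing heights amounts to comparing by
  \<open>nonneg\<close>.\<close>

definition height :: "'a \<Rightarrow> real" where
  "height = (SOME f. linear f \<and> (\<forall>a\<in>\<Delta>. f a = 1))"

lemma height: "linear height" "a \<in> \<Delta> \<Longrightarrow> height a = 1"
proof -
  have "\<exists>f. linear f \<and> (\<forall>a\<in>\<Delta>. f a = (1::real))"
    by (rule linear_independent_extend[OF indep])
  from someI_ex[OF this] show "linear height" "a \<in> \<Delta> \<Longrightarrow> height a = 1"
    by (auto simp: height_def)
qed

lemma height_pos:
  assumes "b \<in> positive_roots \<Phi> \<Delta>"
  shows "0 < height b"
proof -
  have b: "b \<in> span \<Delta>" "\<And>a. a \<in> \<Delta> \<Longrightarrow> 0 \<le> representation \<Delta> b a" "b \<noteq> 0"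
    using assms roots_span root(1) by (auto simp: positive_roots_def)
  have "height b = (\<Sum>a\<in>\<Delta>. height (representation \<Delta> b a *\<^sub>R a))"
    using arg_cong[OF sum_representation[OF b(1)], of height] by (simp add: linear_sum[OF height(1)])
  also have "\<dots> = (\<Sum>a\<in>\<Delta>. representation \<Delta> b a)"
    by (simp add: linear_scale[OF height(1)] height(2))
  finally have *: "height b = (\<Sum>a\<in>\<Delta>. representation \<Delta> b a)" .
  have "height b \<noteq> 0"
  proof
    assume "height b = 0"
    then have "\<forall>a\<in>\<Delta>. representation \<Delta> b a = 0"
      using * b(2) finite_simple by (simp add: sum_nonneg_eq_0_iff)
    then show False using sum_representation[OF b(1)] b(3) by simp
  qed
  moreover have "0 \<le> height b" using * b(2) by (simp add: sum_nonneg)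
  ultimately show ?thesis by simp
qed

lemma orb_difference:
  assumes "y \<in> orb" "z \<in> orb" "y \<noteq> z"
  shows "\<exists>k b. k \<noteq> 0 \<and> b \<in> positive_roots \<Phi> \<Delta> \<and> y - z = k *\<^sub>R b"
proof -
  obtain a where a: "\<Phi> \<inter> span {y - z} = {a, - a}"
    using root_line[of "y - z"] chord[OF assms] assms(3) by auto
  then have "a \<in> \<Phi>" "a \<in> span {y - z}" by auto
  then obtain k where k: "a = k *\<^sub>R (y - z)" by (auto simp: span_singleton)
  have "k \<noteq> 0" using k root(1)[OF \<open>a \<in> \<Phi>\<close>] by auto
  then have "y - z = (1 / k) *\<^sub>R a" "y - z = (- (1 / k)) *\<^sub>R (- a)" using k by auto
  moreover have "1 / k \<noteq> 0" "- (1 / k) \<noteq> 0" using \<open>k \<noteq> 0\<close> by auto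
  ultimately show ?thesis using root_sign[OF \<open>a \<in> \<Phi>\<close>] by metis
qed

lemma height_less:
  assumes "y \<in> orb" "z \<in> orb" "height z < height y"
  shows "\<exists>k b. 0 < k \<and> b \<in> positive_roots \<Phi> \<Delta> \<and> y - z = k *\<^sub>R b"
proof -
  have "y \<noteq> z" using assms by auto
  then obtain k b where kb: "k \<noteq> 0" "b \<in> positive_roots \<Phi> \<Delta>" "y - z = k *\<^sub>R b"
    using orb_difference assms by blast
  have "height y - height z = k * height b"
    using arg_cong[OF kb(3), of height] by (simp add: linear_diff[OF height(1)] linear_scale[OF height(1)])
  then have "0 < k" using assms(3) height_pos[OF kb(2)] by (metis diff_gt_0_iff_gt zero_less_mult_pos2)
  then show ?thesis using kb by blast
qed

lemma height_inj: "inj_on height orb"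
proof (rule inj_onI, rule ccontr)
  fix y z assume yz: "y \<in> orb" "z \<in> orb" "height y = height z" "y \<noteq> z"
  then obtain k b where kb: "k \<noteq> 0" "b \<in> positive_roots \<Phi> \<Delta>" "y - z = k *\<^sub>R b"
    using orb_difference by blast
  have "height y - height z = k * height b"
    using arg_cong[OF kb(3), of height] by (simp add: linear_diff[OF height(1)] linear_scale[OF height(1)])
  then show False using yz(3) kb(1) height_pos[OF kb(2)] by simp
qed

lemma nonneg_difference:
  assumes "y \<in> orb" "z \<in> orb" "height z \<le> height y"
  shows "nonneg (y - z)"
proof (cases "y = z")
  case True
  then show ?thesis by (simp add: nonneg_def span_zero representation_zero)
next
  case False
  then have "height z < height y" using height_inj assms by (metis inj_onD less_le)
  then obtain k b where "0 < k" "b \<in> positive_roots \<Phi> \<Delta>" "y - z = k *\<^sub>R b"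
    using height_less assms by blast
  then show ?thesis
    using positive_root_nonneg[of b] by (auto simp: nonneg_def span_scale representation_scale[OF indep])
qed

text \<open>The coefficients of \<open>v\<close> and \<open>q *\<^sub>R a - v\<close> at
  \<open>a'\<close> are both nonnegative and add up to 0.\<close>

lemma nonneg_summand:
  assumes "nonneg v" "nonneg (q *\<^sub>R a - v)" "a \<in> \<Delta>" "a' \<in> \<Delta>" "a' \<noteq> a"
  shows "representation \<Delta> v a' = 0"
proof -
  have "q *\<^sub>R a \<in> span \<Delta>" using assms(3) by (simp add: span_scale span_base)
  then have "0 \<le> - representation \<Delta> v a'"
    using assms unfolding nonneg_def
    by (auto simp: representation_diff[OF indep] representation_scale[OF indep] span_base
        representation_basis[OF indep])
  then show ?thesis using assms by (auto simp: nonneg_def)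
qed

lemma positive_root_simple:
  assumes b: "b \<in> positive_roots \<Phi> \<Delta>" and a: "a \<in> \<Delta>"
    and "\<And>a'. a' \<in> \<Delta> \<Longrightarrow> a' \<noteq> a \<Longrightarrow> representation \<Delta> b a' = 0"
  shows "b = a"
proof -
  have span: "b \<in> span \<Delta>" "b \<in> \<Phi>" "0 \<le> representation \<Delta> b a"
    using b a roots_span by (auto simp: positive_roots_def)
  have "b = (\<Sum>a'\<in>\<Delta>. representation \<Delta> b a' *\<^sub>R a')" using sum_representation[OF span(1)] by simp
  also have "\<dots> = (\<Sum>a'\<in>{a}. representation \<Delta> b a' *\<^sub>R a')"
    using assms finite_simple by (intro sum.mono_neutral_right) auto
  finally have *: "b = representation \<Delta> b a *\<^sub>R a" by simp
  then have "representation \<Delta> b a \<noteq> 0" using root(1)[OF span(2)] by auto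
  then have "representation \<Delta> b a = 1"
    using root_multiple[of a "representation \<Delta> b a"] a simple_subset span * by auto
  then show ?thesis using * by simp
qed

lemma reflection_orb: "b \<in> \<Phi> \<Longrightarrow> y \<in> orb \<Longrightarrow> reflection b y \<in> orb"
  using stable_orb root by blast

text \<open>A simple reflection whose root has positive inner product with \<open>y - z\<close> lowers \<open>y\<close> to \<open>z\<close> or
  below, or raises \<open>z\<close> to \<open>y\<close> or above. This bounds \<open>y - z\<close> by a multiple of that simple root.\<close>

lemma adjacent_difference:
  assumes y: "y \<in> orb" and z: "z \<in> orb" and less: "height z < height y"
    and adjacent: "\<And>u. u \<in> orb \<Longrightarrow> height u \<le> height z \<or> height y \<le> height u"
  shows "\<exists>k b. 0 < k \<and> b \<in> \<Delta> \<and> y - z = k *\<^sub>R b"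
proof -
  obtain k b where kb: "0 < k" "b \<in> positive_roots \<Phi> \<Delta>" "y - z = k *\<^sub>R b"
    using height_less[OF y z less] by blast
  have b: "b \<in> span \<Delta>" "b \<in> \<Phi>" "\<And>a. a \<in> \<Delta> \<Longrightarrow> 0 \<le> representation \<Delta> b a"
    using kb(2) roots_span by (auto simp: positive_roots_def)
  \<comment> \<open>Otherwise expanding one factor of \<open>b \<bullet> b\<close> in simple roots,
    with nonnegative coefficients, would give at most 0.\<close>
  have "\<exists>a\<in>\<Delta>. 0 < b \<bullet> a"
  proof (rule ccontr)
    assume "\<not> (\<exists>a\<in>\<Delta>. 0 < b \<bullet> a)"
    then have "(\<Sum>a\<in>\<Delta>. representation \<Delta> b a * (b \<bullet> a)) \<le> 0"
      using b(3) by (intro sum_nonpos mult_nonneg_nonpos) (auto simp: not_less)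
    also have "(\<Sum>a\<in>\<Delta>. representation \<Delta> b a * (b \<bullet> a)) = b \<bullet> (\<Sum>a\<in>\<Delta>. representation \<Delta> b a *\<^sub>R a)"
      by (simp add: inner_sum_right)
    also have "\<dots> = b \<bullet> b" by (simp only: sum_representation[OF b(1)])
    finally show False using root(1)[OF b(2)] inner_gt_zero_iff[of b] by linarith
  qed
  then obtain a where a: "a \<in> \<Delta>" "0 < b \<bullet> a" by blast
  have "a \<in> \<Phi>" "a \<noteq> 0" using a(1) simple_subset root(1) by auto
  have "0 < (y - z) \<bullet> a" using kb a by simp
  then have "0 < y \<bullet> a \<or> z \<bullet> a < 0" by (auto simp: inner_diff_left)
  then have "\<exists>q. nonneg (q *\<^sub>R a - k *\<^sub>R b)"
  proof
    assume "0 < y \<bullet> a"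
    define q where "q = 2 * (y \<bullet> a) / (a \<bullet> a)"
    have q: "0 < q" "reflection a y = y - q *\<^sub>R a"
      using \<open>0 < y \<bullet> a\<close> \<open>a \<noteq> 0\<close> by (auto simp: q_def reflection_def)
    then have "height (reflection a y) < height y"
      using height(2)[OF a(1)] by (simp add: linear_diff[OF height(1)] linear_scale[OF height(1)])
    then have "nonneg (z - reflection a y)"
      using adjacent[of "reflection a y"] reflection_orb[OF \<open>a \<in> \<Phi>\<close> y] z
      by (intro nonneg_difference) auto
    moreover have "z - reflection a y = q *\<^sub>R a - k *\<^sub>R b" using q(2) kb(3) by (simp add: algebra_simps)
    ultimately show ?thesis by auto
  next
    assume "z \<bullet> a < 0"
    define q where "q = - (2 * (z \<bullet> a) / (a \<bullet> a))"
    have q: "0 < q" "reflection a z = z + q *\<^sub>R a"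
      using \<open>z \<bullet> a < 0\<close> \<open>a \<noteq> 0\<close> by (auto simp: q_def reflection_def divide_neg_pos)
    then have "height z < height (reflection a z)"
      using height(2)[OF a(1)] by (simp add: linear_add[OF height(1)] linear_scale[OF height(1)])
    then have "nonneg (reflection a z - y)"
      using adjacent[of "reflection a z"] reflection_orb[OF \<open>a \<in> \<Phi>\<close> z] y
      by (intro nonneg_difference) auto
    moreover have "reflection a z - y = q *\<^sub>R a - k *\<^sub>R b" using q(2) kb(3) by (simp add: algebra_simps)
    ultimately show ?thesis by auto
  qed
  then obtain q where q: "nonneg (q *\<^sub>R a - k *\<^sub>R b)" by blast
  have "nonneg (k *\<^sub>R b)" using positive_root_nonneg[OF kb(2)] kb(1)
    by (auto simp: nonneg_def span_scale representation_scale[OF indep])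
  then have "representation \<Delta> b a' = 0" if "a' \<in> \<Delta>" "a' \<noteq> a" for a'
    using nonneg_summand[OF _ q a(1) that] kb(1) b(1) by (simp add: representation_scale[OF indep])
  then have "b = a" using positive_root_simple[OF kb(2) a(1)] by blast
  then show ?thesis using kb a by blast
qed

section \<open>Orthogonality within each part\<close>

lemma simple_not_parallel:
  assumes "a \<in> \<Delta>" "b \<in> \<Delta>" "a \<noteq> b"
  shows "b \<notin> span {a}"
proof
  assume "b \<in> span {a}"
  then have "b \<in> span (\<Delta> - {b})" using span_mono[of "{a}" "\<Delta> - {b}"] assms by auto
  then show False using indep assms(2) by (auto simp: dependent_def)
qed

text \<open>The product permutes the finite orbit, so a power fixes it pointwise. That power fixes
  \<open>a\<close> and \<open>b\<close>, which are proportional to differences of orbit elements,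
  and displaces vectors only within their span. Thus the minimum in \<open>map_order\<close> is
  attained.\<close>

lemma reflections_finite_order:
  assumes "a \<in> \<Delta>" "b \<in> \<Delta>"
  shows "\<exists>k>0. (reflection a \<circ> reflection b) ^^ k = id"
proof -
  define f where "f = reflection a \<circ> reflection b"
  have f: "f y = reflection a (reflection b y)" for y by (simp add: f_def)
  have ab: "a \<in> \<Phi>" "b \<in> \<Phi>" using assms simple_subset by auto
  have "inj f" by (rule inj_on_inverseI[of _ "reflection b \<circ> reflection a"]) (simp add: f reflection_involution)
  moreover have "f ` orb \<subseteq> orb" using reflection_orb ab by (auto simp: f)
  ultimately obtain k where k: "0 < k" "\<And>y. y \<in> orb \<Longrightarrow> (f ^^ k) y = y"
    using inj_finite_orbit_power[OF _ finite_orb] by metis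
  have lin: "linear (f ^^ n)" for n
  proof (induction n)
    case (Suc n)
    show ?case
      using linear_compose[OF Suc linear_compose[OF linear_reflection linear_reflection, of a b]]
      by (simp only: funpow.simps f_def)
  qed (simp add: linear_id[unfolded id_def] id_def)
  have "f ^^ k = id"
  proof (rule isometry_trivial)
    show "(f ^^ k) y \<bullet> (f ^^ k) z = y \<bullet> z" for y z
      by (induction k) (simp_all add: f reflection_inner)
    have disp: "reflection c y - y \<in> span {a, b}" if "c \<in> {a, b}" for c y
      using that by (simp add: reflection_def span_neg span_scale span_base)
    show "(f ^^ k) y - y \<in> span {a, b}" for y
    proof (induction k)
      case (Suc k)
      obtain z where z: "z = (f ^^ k) y" by blast
      have "(reflection a (reflection b z) - reflection b z) + ((reflection b z - z) + (z - y)) \<in> span {a, b}"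
        unfolding z by (intro span_add disp Suc) simp_all
      then have "f z - y \<in> span {a, b}" using f[of z] by simp
      then show ?case by (simp add: z)
    qed (simp add: span_zero)
    fix c assume "c \<in> {a, b}"
    then have c: "c \<in> \<Phi>" "c \<noteq> 0" using ab root(1) by auto
    then obtain y where y: "y \<in> orb" "y \<bullet> c \<noteq> 0" using faithful root(2) by blast
    define q where "q = 2 * (y \<bullet> c) / (c \<bullet> c)"
    have "q \<noteq> 0" "q *\<^sub>R c = y - reflection c y" using y c by (auto simp: q_def reflection_def)
    then have "q *\<^sub>R (f ^^ k) c = (f ^^ k) (y - reflection c y)"
      using linear_scale[OF lin] by metis
    also have "\<dots> = q *\<^sub>R c"
      using k(2) y(1) reflection_orb[OF c(1) y(1)] \<open>q *\<^sub>R c = _\<close> by (simp add: linear_diff[OF lin])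
    finally show "(f ^^ k) c = c" using \<open>q \<noteq> 0\<close> by simp
  qed
  then show ?thesis using k(1) f_def by blast
qed

text \<open>The product has order 1 or 2, so the reflections commute; distinct simple roots are not
  parallel.\<close>

lemma no_edge_orthogonal:
  assumes "a \<in> \<Delta>" "b \<in> \<Delta>" "a \<noteq> b" "\<not> coxeter_edge a b"
  shows "a \<bullet> b = 0"
proof -
  let ?f = "reflection a \<circ> reflection b"
  obtain k where "0 < k" "?f ^^ k = id" using reflections_finite_order assms by blast
  then have "0 < map_order ?f" "?f ^^ map_order ?f = id" using map_order_finite by blast+
  moreover have "map_order ?f < 3" using assms(4) by (simp add: coxeter_edge_def)
  ultimately have "?f ^^ 1 = id \<or> ?f ^^ 2 = id"
    by (metis One_nat_def Suc_1 less_2_cases less_Suc_eq less_irrefl numeral_3_eq_3)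
  then have "?f = reflection b \<circ> reflection a"
  proof
    assume "?f ^^ 1 = id"
    then have "reflection a (reflection b y) = y" for y by (simp add: fun_eq_iff)
    then have "reflection b y = reflection a y" for y by (metis reflection_involution)
    then show ?thesis by (simp add: fun_eq_iff)
  next
    assume "?f ^^ 2 = id"
    then have "reflection a (reflection b (reflection a (reflection b y))) = y" for y
      by (simp add: fun_eq_iff numeral_2_eq_2)
    then have "reflection a (reflection b y) = reflection b (reflection a y)" for y
      by (metis reflection_involution)
    then show ?thesis by (simp add: fun_eq_iff)
  qed
  then show ?thesis using commuting_reflections simple_not_parallel assms by blast
qed

lemma bipartite_basis: "bipartite_basis Dp Dm"
proof
  show "independent (Dp \<union> Dm)" "Dp \<inter> Dm = {}" using indep parts by auto
  show "a \<bullet> b = 0" if "a \<in> Dp" "b \<in> Dp" "a \<noteq> b" for a b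
    using no_edge_orthogonal[of a b] that parts bipartite by (auto simp: bipartition_def)
  show "a \<bullet> b = 0" if "a \<in> Dm" "b \<in> Dm" "a \<noteq> b" for a b
    using no_edge_orthogonal[of a b] that parts bipartite by (auto simp: bipartition_def)
qed

section \<open>Enumeration of the orbit along the zigzag\<close>

lemma inner_swapped:
  assumes "norm y = norm z" "y - z = t *\<^sub>R a" "0 < t" "a \<noteq> 0"
  shows "0 < y \<bullet> a" "z \<bullet> a < 0"
proof -
  have "reflection a y = z" using reflection_swap assms by blast
  then have "(2 * (y \<bullet> a) / (a \<bullet> a) - t) *\<^sub>R a = 0"
    using assms(2) by (auto simp: reflection_def algebra_simps)
  then have y: "2 * (y \<bullet> a) = t * (a \<bullet> a)" using assms(4) by (simp add: field_simps)
  then show "0 < y \<bullet> a" using assms(3,4) by (metis inner_gt_zero_iff mult_pos_pos zero_less_mult_pos zero_less_numeral)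
  have "z \<bullet> a = y \<bullet> a - t * (a \<bullet> a)" using assms(2) by (metis diff_diff_eq2 diff_add_cancel add_diff_cancel_left' inner_diff_left inner_scaleR_left)
  then show "z \<bullet> a < 0" using y \<open>0 < y \<bullet> a\<close> by simp
qed

lemma zigzag_enumeration:
  obtains x s t e where "zigzag_orbit Dp Dm \<Phi> x s t (card orb) e" "orb = x ` {..<card orb}"
proof -
  define h where "h = card orb"
  \<comment> \<open>Sorting is upward, whereas the list is wanted with descending heights; hence the
    sign.\<close>
  define L where "L = sorted_list_of_set ((\<lambda>y. - height y) ` orb)"
  have inj: "inj_on (\<lambda>y. - height y) orb" using height_inj by (simp add: inj_on_def)
  have L: "set L = (\<lambda>y. - height y) ` orb" "distinct L" "sorted_wrt (<) L" "length L = h"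
    using finite_orb inj by (simp_all add: L_def card_image h_def)
  define x where "x = inv_into orb (\<lambda>y. - height y) \<circ> (!) L"
  have "bij_betw ((!) L) {..<h} ((\<lambda>y. - height y) ` orb)"
    using bij_betw_nth[OF L(2), of "{..<h}"] L by simp
  then have bij: "bij_betw x {..<h} orb"
    unfolding x_def using bij_betw_inv_into[OF inj_on_imp_bij_betw[OF inj]] by (rule bij_betw_trans)
  then have orb: "orb = x ` {..<h}" by (simp add: bij_betw_def)
  have x_orb: "x i \<in> orb" if "i < h" for i using that orb by auto
  have "- height (x i) = L ! i" if "i < h" for i
    unfolding x_def comp_def
    using f_inv_into_f[of "L ! i" "\<lambda>y. - height y" orb] nth_mem[of i L] that L by simp
  then have mono: "height (x j) < height (x i)" if "i < j" "j < h" for i j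
    using sorted_wrt_nth_less[OF L(3) that(1)] that L(4) by (metis neg_less_iff_less less_trans)
  have le: "height (x j) \<le> height (x i)" if "i \<le> j" "j < h" for i j
    using mono[of i j] that by (cases "i = j") auto
  have less_index: "i < j" if "height (x j) < height (x i)" "i < h" for i j
    using le[of j i] that by (meson not_le)
  have "\<exists>k b. 0 < k \<and> b \<in> \<Delta> \<and> x i - x (Suc i) = k *\<^sub>R b" if i: "Suc i < h" for i
  proof (rule adjacent_difference)
    fix u assume "u \<in> orb"
    then obtain j where "j < h" "u = x j" using orb by auto
    then show "height u \<le> height (x (Suc i)) \<or> height (x i) \<le> height u"
      using le[of "Suc i" j] le[of j i] i by (cases "j \<le> i") auto
  qed (use x_orb mono[of i "Suc i"] i in auto)
  then obtain t s where st: "\<And>i. Suc i < h \<Longrightarrow> 0 < t i \<and> s i \<in> \<Delta> \<and> x i - x (Suc i) = t i *\<^sub>R s i"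
    by metis
  have norm_x: "norm (x i) = norm (x j)" if "i < h" "j < h" for i j
    using norm_orb x_orb that by blast
  have s0: "s i \<noteq> 0" if "Suc i < h" for i using st[OF that] simple_subset root(1) by auto
  have only: "s i = a" if "Suc i < h" "a \<in> \<Delta>" "nonneg (q *\<^sub>R a - t i *\<^sub>R s i)" for i a q
  proof (rule ccontr)
    assume "s i \<noteq> a"
    have si: "s i \<in> span \<Delta>" using st[OF that(1)] by (simp add: span_base)
    have "nonneg (t i *\<^sub>R s i)"
      using st[OF that(1)] si
      by (auto simp: nonneg_def span_scale representation_scale[OF indep] representation_basis[OF indep])
    then have "representation \<Delta> (t i *\<^sub>R s i) (s i) = 0"
      using nonneg_summand[OF _ that(3,2)] st[OF that(1)] \<open>s i \<noteq> a\<close> by blast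
    then show False
      using st[OF that(1)] si by (simp add: representation_scale[OF indep] representation_basis[OF indep])
  qed
  \<comment> \<open>The reflection takes \<open>x i\<close> to some \<open>x j\<close>. The step
    next to \<open>i\<close> in the direction of \<open>j\<close> is bounded by the whole
    difference, a multiple of \<open>a\<close>, so by \<open>only\<close> it is itself along
    \<open>a\<close>.\<close>
  have moved: "Suc i < h \<and> s i = a \<or> 0 < i \<and> s (i - 1) = a"
    if a: "a \<in> \<Delta>" and i: "i < h" and nz: "x i \<bullet> a \<noteq> 0" for a i
  proof -
    have "a \<in> \<Phi>" "a \<noteq> 0" using a simple_subset root(1) by auto
    define q where "q = 2 * (x i \<bullet> a) / (a \<bullet> a)"
    have q: "q \<noteq> 0" using nz \<open>a \<noteq> 0\<close> by (simp add: q_def)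
    obtain j where j: "j < h" "reflection a (x i) = x j"
      using reflection_orb[OF \<open>a \<in> \<Phi>\<close> x_orb[OF i]] orb by auto
    have diff: "x i - x j = q *\<^sub>R a" using j(2)[symmetric] by (simp add: q_def reflection_def)
    then have "i \<noteq> j" using q \<open>a \<noteq> 0\<close> by auto
    then consider "i < j" | "j < i" by linarith
    then show ?thesis
    proof cases
      case 1
      have "x (Suc i) - x j = q *\<^sub>R a - t i *\<^sub>R s i"
        using diff st[of i] 1 j by (simp add: algebra_simps)
      then have "nonneg (q *\<^sub>R a - t i *\<^sub>R s i)"
        using nonneg_difference[of "x (Suc i)" "x j"] x_orb le[of "Suc i" j] 1 j by simp
      then show ?thesis using only[of i a] 1 j a by auto
    next
      case 2
      then obtain m where m: "i = Suc m" by (cases i) auto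
      have "x j - x m = (- q) *\<^sub>R a - t m *\<^sub>R s m"
        using diff st[of m] m i by (simp add: algebra_simps)
      then have "nonneg ((- q) *\<^sub>R a - t m *\<^sub>R s m)"
        using nonneg_difference[of "x j" "x m"] x_orb le[of j m] 2 j m i by simp
      then show ?thesis using only[of m a "- q"] m i a by auto
    qed
  qed
  \<comment> \<open>Equal roots would give \<open>x (Suc i)\<close> inner products of both signs. If
    the roots were orthogonal, \<open>x i\<close> would share the positive inner product of
    \<open>x (Suc i)\<close> with \<open>s (Suc i)\<close>; by \<open>moved\<close> the step before
    \<open>x i\<close> would be along that root, making the product negative.\<close>
  have nonorth: "s i \<noteq> s (Suc i) \<and> s i \<bullet> s (Suc i) \<noteq> 0" if i: "Suc (Suc i) < h" for i
  proof
    have st_i: "0 < t i" "s i \<in> \<Delta>" "x i - x (Suc i) = t i *\<^sub>R s i"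
      and st_Suc: "0 < t (Suc i)" "s (Suc i) \<in> \<Delta>" "x (Suc i) - x (Suc (Suc i)) = t (Suc i) *\<^sub>R s (Suc i)"
      using st[of i] st[of "Suc i"] i by auto
    have pos: "0 < x (Suc i) \<bullet> s (Suc i)"
      using inner_swapped(1)[OF norm_x st_Suc(3,1)] s0[of "Suc i"] i by simp
    show "s i \<noteq> s (Suc i)"
      using inner_swapped(2)[OF norm_x st_i(3,1)] s0[of i] i pos by auto
    show "s i \<bullet> s (Suc i) \<noteq> 0"
    proof
      assume orth: "s i \<bullet> s (Suc i) = 0"
      have "x i = x (Suc i) + t i *\<^sub>R s i" using st_i(3) by (simp add: algebra_simps)
      then have eq: "x i \<bullet> s (Suc i) = x (Suc i) \<bullet> s (Suc i)" using orth by (simp add: inner_add_left)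
      then have "0 < i \<and> s (i - 1) = s (Suc i)"
        using moved[of "s (Suc i)" i] st_Suc(2) pos i \<open>s i \<noteq> s (Suc i)\<close> by auto
      then obtain m where m: "i = Suc m" "s m = s (Suc i)" by (cases i) auto
      then have "x i \<bullet> s (Suc i) < 0"
        using inner_swapped(2)[OF norm_x, of m i "t m" "s m"] st[of m] s0[of m] i by auto
      then show False using eq pos by simp
    qed
  qed
  interpret bipartite_basis Dp Dm by (rule bipartite_basis)
  define e where "e = (s 0 \<in> Dp)"
  have s_part: "s i \<in> (if even i = e then Dp else Dm)" if "Suc i < h" for i
    using that
  proof (induction i)
    case 0
    then show ?case using st[of 0] parts by (auto simp: e_def)
  next
    case (Suc i)
    then have IH: "s i \<in> (if even i = e then Dp else Dm)" by simp
    have "s (Suc i) \<in> Dp \<union> Dm" using st[of "Suc i"] Suc parts by auto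
    then show ?case using IH nonorth[of i] Suc.prems orth_p[of "s i" "s (Suc i)"] orth_m[of "s i" "s (Suc i)"]
      by (auto split: if_splits)
  qed
  have positive: "\<exists>i j k. i < j \<and> j < h \<and> 0 < k \<and> x i - x j = k *\<^sub>R b"
    if b: "b \<in> positive_roots \<Phi> (Dp \<union> Dm)" for b
  proof -
    have b': "b \<in> positive_roots \<Phi> \<Delta>" using b parts by simp
    then have "b \<in> \<Phi>" "b \<noteq> 0" using root(1) by (auto simp: positive_roots_def)
    then obtain y where y: "y \<in> orb" "y \<bullet> b \<noteq> 0" using faithful root(2) by blast
    define q where "q = 2 * (y \<bullet> b) / (b \<bullet> b)"
    have q: "q \<noteq> 0" using y \<open>b \<noteq> 0\<close> by (simp add: q_def)
    obtain i j where ij: "i < h" "j < h" "y = x i" "reflection b y = x j"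
      using y(1) reflection_orb[OF \<open>b \<in> \<Phi>\<close> y(1)] orb by auto
    have diff: "x i - x j = q *\<^sub>R b" using ij(3) ij(4)[symmetric] by (simp add: q_def reflection_def)
    have "height (x i) - height (x j) = q * height b"
      using arg_cong[OF diff, of height] by (simp add: linear_diff[OF height(1)] linear_scale[OF height(1)])
    then have hd: "height (x i) = height (x j) + q * height b" by simp
    show ?thesis
    proof (cases "0 < q")
      case True
      then have "i < j" using hd height_pos[OF b'] less_index ij by simp
      then show ?thesis using True diff ij by blast
    next
      case False
      then have "q * height b < 0" using q height_pos[OF b'] by (simp add: mult_neg_pos)
      then have "j < i" using hd less_index ij by simp
      moreover have "x j - x i = (- q) *\<^sub>R b" using diff by (simp add: algebra_simps)
      ultimately show ?thesis using False q ij by (metis neg_0_less_iff_less linorder_neqE_linordered_idom)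
    qed
  qed
  have "zigzag_orbit Dp Dm \<Phi> x s t h e"
  proof
    show "Dp \<union> Dm \<subseteq> \<Phi>" "\<Phi> \<subseteq> span (Dp \<union> Dm)" using simple_subset roots_span parts by auto
    show "reflection a b \<in> \<Phi>" if "a \<in> Dp \<union> Dm" "b \<in> \<Phi>" for a b
      using reflection_root simple_subset parts that by auto
    show "0 \<notin> \<Phi>" using root(1) by blast
    show "3 \<le> h" using card_orb h_def by simp
    show "norm (x i) = norm (x 0)" if "i < h" for i using norm_x[of i 0] that by simp
    show "Suc i < h \<and> s i = a \<or> 0 < i \<and> s (i - 1) = a"
      if "a \<in> Dp \<union> Dm" "i < h" "x i \<bullet> a \<noteq> 0" for a i
      using moved that parts by simp
    show "k = 1" if "b \<in> \<Phi>" "k *\<^sub>R b \<in> \<Phi>" "0 < k" for b k by (rule root_multiple[OF that])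
    show "x i - x (Suc i) = t i *\<^sub>R s i" "0 < t i" if "Suc i < h" for i using st[OF that] by simp_all
    show "s i \<in> (if even i = e then Dp else Dm)" if "Suc i < h" for i by (rule s_part[OF that])
    show "\<exists>i j k. i < j \<and> j < h \<and> 0 < k \<and> x i - x j = k *\<^sub>R b"
      if "b \<in> positive_roots \<Phi> (Dp \<union> Dm)" for b
      by (rule positive[OF that])
  qed
  then show thesis using that orb unfolding h_def by blast
qed

theorem compatible_iff_not_crossing:
  assumes "coxeter_eigenvector \<Delta> c"
    and "b \<in> almost_positive_roots \<Phi> \<Delta>" "g \<in> almost_positive_roots \<Phi> \<Delta>" "b \<noteq> g"
  shows "(b, g) \<in> compatibility \<Phi> Dp Dm \<longleftrightarrow>
    (\<forall>S \<in> root_diagram \<Phi> Dp Dm c orb b. \<forall>T \<in> root_diagram \<Phi> Dp Dm c orb g. \<not> crosses S T)"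
proof -
  obtain x s t e where zigzag: "zigzag_orbit Dp Dm \<Phi> x s t (card orb) e" and orb: "orb = x ` {..<card orb}"
    using zigzag_enumeration by blast
  show ?thesis
    by (rule zigzag_orbit.compatible_iff_not_crossing[OF zigzag, folded parts(1) orb]) (fact assms)+
qed

end

subsection \<open>Type A\<close>

lemma bij_transpose_if: "bij (\<lambda>k. if k = i then j else if k = j then i else k)"
  by (rule o_bij[of "\<lambda>k. if k = i then j else if k = j then i else k"]) (auto simp: fun_eq_iff)

lemma inner_axis_1: "x \<bullet> axis i (1::real) = x $ i"
  by (simp add: inner_axis)

text \<open>The reflection in \<open>v i - v j\<close> transposes two coordinates. A vector
  orthogonal to all \<open>v i\<close> has equal coordinates, so every permutation fixes it, while
  its own reflection would negate it.\<close>

lemma type_A_reflecting_orbit: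
  fixes W :: "(real^'n \<Rightarrow> real^'n) set"
  assumes type: "type_A n W orb" "2 \<le> n"
    and "root_system W \<Phi>" "simple_roots \<Phi> \<Delta>" "bipartition \<Delta> Dp Dm"
  shows "reflecting_orbit W \<Phi> \<Delta> Dp Dm orb"
proof
  define v :: "'n \<Rightarrow> real^'n" where "v i = axis i 1 - vec (1 / real (n + 1))" for i
  have card: "CARD('n) = n + 1" and W: "W = {\<lambda>x. \<chi> i. x $ p i | p. bij p}" and orb: "orb = range v"
    using type(1) by (auto simp: type_A_def v_def)
  have v_nth: "v i $ k = (if k = i then 1 else 0) - 1 / real (n + 1)" for i k
    by (simp add: v_def axis_def)
  have v_diff: "v i - v j = axis i 1 - axis j 1" for i j by (simp add: v_def)
  have inj: "inj v"
    using v_diff by (intro injI) (metis axis_eq_axis eq_iff_diff_eq_0 zero_neq_one)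
  show "w y \<in> orb" if "w \<in> W" "y \<in> orb" for w y
  proof -
    obtain p j where p: "bij p" "w = (\<lambda>x. \<chi> i. x $ p i)" "y = v j" using \<open>w \<in> W\<close> \<open>y \<in> orb\<close> W orb by auto
    \<comment> \<open>Composing coordinates with \<open>p\<close> carries the unit vector at
      \<open>j\<close> to the one at \<open>inv p j\<close>.\<close>
    have "p i = j \<longleftrightarrow> i = inv p j" for i
      using p(1) by (metis bij_inv_eq_iff)
    then have "w y = v (inv p j)" using p by (simp add: vec_eq_iff v_nth)
    then show ?thesis using orb by simp
  qed
  show "3 \<le> card orb" using type(2) card inj by (simp add: orb card_image)
  show "norm y = norm z" if "y \<in> orb" "z \<in> orb" for y z
  proof -
    have "v i \<bullet> v i = 1 - 2 / real (n + 1) + vec (1 / real (n + 1)) \<bullet> (vec (1 / real (n + 1)) :: real^'n)" for i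
      by (simp add: v_def inner_diff_left inner_diff_right inner_axis_1 inner_commute[of "axis i 1"])
    then show ?thesis using that by (auto simp: orb norm_eq_sqrt_inner)
  qed
  show "reflection (y - z) \<in> W" if yz: "y \<in> orb" "z \<in> orb" "y \<noteq> z" for y z
  proof -
    obtain i j where ij: "y = v i" "z = v j" "i \<noteq> j" using yz orb by auto
    define a :: "real^'n" where "a = axis i 1 - axis j 1"
    have a: "x \<bullet> a = x $ i - x $ j" for x by (simp add: a_def inner_diff_right inner_axis_1)
    have "a \<bullet> a = 2" using ij(3) by (simp add: a) (simp add: a_def axis_def)
    then have "reflection a = (\<lambda>x. \<chi> k. x $ (if k = i then j else if k = j then i else k))"
      using ij(3) by (auto simp: fun_eq_iff vec_eq_iff reflection_def a) (auto simp: a_def axis_def field_simps)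
    then show ?thesis unfolding W ij v_diff a_def[symmetric]
      by (intro CollectI exI[of _ "\<lambda>k. if k = i then j else if k = j then i else k"] conjI bij_transpose_if)
  qed
  show "\<exists>y\<in>orb. y \<bullet> b \<noteq> 0" if b: "b \<noteq> 0" "reflection b \<in> W" for b
  proof (rule ccontr)
    assume "\<not> (\<exists>y\<in>orb. y \<bullet> b \<noteq> 0)"
    then have "b \<bullet> v i = 0" for i by (auto simp: orb inner_commute)
    then have b_nth: "b $ i = b \<bullet> vec (1 / real (n + 1))" for i
      by (simp add: v_def inner_diff_right inner_axis_1)
    obtain p where "reflection b = (\<lambda>x. \<chi> i. x $ p i)" using b(2) W by auto
    then have "- b = (\<chi> i. b $ p i)" using reflection_self[of b] by simp
    also have "\<dots> = b" using b_nth by (metis (no_types, lifting) vec_eq_iff vec_lambda_beta)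
    finally show False using b(1) by (metis add.right_inverse scaleR_2 scaleR_eq_0_iff zero_neq_numeral)
  qed
qed (fact assms)+

subsection \<open>Type B\<close>

text \<open>Opposite elements differ by a multiple of a unit vector, whose reflection changes one
  sign; all other differences give signed transpositions.\<close>

lemma type_B_reflecting_orbit:
  fixes W :: "(real^'n \<Rightarrow> real^'n) set"
  assumes type: "type_B n W orb" "2 \<le> n"
    and "root_system W \<Phi>" "simple_roots \<Phi> \<Delta>" "bipartition \<Delta> Dp Dm"
  shows "reflecting_orbit W \<Phi> \<Delta> Dp Dm orb"
proof
  have card: "CARD('n) = n"
    and W: "W = {\<lambda>x. \<chi> i. f i * x $ p i | p f. bij p \<and> (\<forall>i. f i \<in> {1, -1})}"
    and orb': "orb = {axis i 1 | i. True} \<union> {- axis i 1 | i. True}"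
    using type(1) by (auto simp: type_B_def)
  have orb: "orb = {r *\<^sub>R axis i 1 | r i. r \<in> {1, -1}}"
  proof
    show "orb \<subseteq> {r *\<^sub>R axis i 1 | r i. r \<in> {1, -1}}"
    proof
      fix y assume "y \<in> orb"
      then obtain i where "y = 1 *\<^sub>R axis i 1 \<or> y = (-1) *\<^sub>R axis i 1" by (auto simp: orb')
      then show "y \<in> {r *\<^sub>R axis i 1 | r i. r \<in> {1, -1}}" by blast
    qed
  qed (auto simp: orb')
  show "w y \<in> orb" if "w \<in> W" "y \<in> orb" for w y
  proof -
    obtain p f r j where p: "bij p" "\<And>i. f i \<in> {1, -1}" "w = (\<lambda>x. \<chi> i. f i * x $ p i)"
      and y: "y = r *\<^sub>R axis j 1" "r \<in> {1, -1}"
      using \<open>w \<in> W\<close> \<open>y \<in> orb\<close> W orb by auto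
    have "p i = j \<longleftrightarrow> i = inv p j" for i
      using p(1) by (metis bij_inv_eq_iff)
    then have "w y = (f (inv p j) * r) *\<^sub>R axis (inv p j) 1" using p y by (auto simp: vec_eq_iff axis_def)
    moreover have "f (inv p j) * r \<in> {1, -1}" using p(2)[of "inv p j"] y(2) by auto
    ultimately show ?thesis using orb by blast
  qed
  show "3 \<le> card orb"
  proof -
    have "orb = range (\<lambda>i. axis i 1) \<union> range (\<lambda>i. - axis i 1)" unfolding orb' by auto
    then have "finite orb" by simp
    obtain i j :: 'n where "i \<noteq> j"
      using card type(2) by (metis (full_types) UNIV_I card_le_Suc0_iff_eq finite not_less_eq_eq numeral_2_eq_2)
    have "axis i (1::real) $ i \<noteq> axis j 1 $ i" "axis i (1::real) $ i \<noteq> (- axis i 1) $ i"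
      "axis j (1::real) $ j \<noteq> (- axis i 1) $ j"
      using \<open>i \<noteq> j\<close> by (auto simp: axis_def)
    then have "axis i (1::real) \<noteq> axis j 1" "axis i (1::real) \<noteq> - axis i 1" "axis j (1::real) \<noteq> - axis i 1"
      by metis+
    then have "card {axis i 1, axis j 1, - axis i (1::real)} = 3" unfolding card_3_iff by blast
    then show ?thesis
      using card_mono[OF \<open>finite orb\<close>, of "{axis i 1, axis j 1, - axis i 1}"] orb' by auto
  qed
  show "norm y = norm z" if "y \<in> orb" "z \<in> orb" for y z
    using that by (auto simp: orb' norm_axis_1)
  show "reflection (y - z) \<in> W" if yz: "y \<in> orb" "z \<in> orb" "y \<noteq> z" for y z
  proof -
    obtain r i q j where rq: "y = r *\<^sub>R axis i 1" "z = q *\<^sub>R axis j 1" "r \<in> {1, -1}" "q \<in> {1, -1}"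
      using yz orb by auto
    define a where "a = y - z"
    have a: "x \<bullet> a = r * x $ i - q * x $ j" for x by (simp add: a_def rq inner_diff_right inner_axis_1)
    show ?thesis
    proof (cases "i = j")
      case True
      then have "q = - r" using rq yz(3) by auto
      then have "y - z = (2 * r) *\<^sub>R axis i 1" using rq True by (simp flip: scaleR_add_left)
      moreover have "2 * r \<noteq> 0" using rq by auto
      ultimately have "reflection (y - z) = reflection (axis i 1)" by (metis reflection_scaleR)
      also have "\<dots> = (\<lambda>x. \<chi> k. (if k = i then -1 else 1) * x $ id k)"
        by (auto simp: fun_eq_iff vec_eq_iff reflection_def inner_axis_1) (auto simp: axis_def)
      finally show ?thesis
        unfolding W using bij_id by (intro CollectI exI[of _ id] exI[of _ "\<lambda>k. if k = i then -1 else 1"]) auto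
    next
      case False
      have "a \<bullet> a = 2" using rq False by (simp add: a) (auto simp: a_def rq axis_def)
      \<comment> \<open>Both exchanged coordinates carry the sign \<open>r * q\<close>, since
        \<open>r\<close> and \<open>q\<close> have square 1.\<close>
      then have "reflection a x = (\<chi> k. (if k = i \<or> k = j then r * q else 1) *
          x $ (if k = i then j else if k = j then i else k))" for x
        using rq(3,4) False
        by (auto simp: vec_eq_iff reflection_def a) (auto simp: a_def rq(1,2) axis_def field_simps)
      then have "reflection a = (\<lambda>x. \<chi> k. (if k = i \<or> k = j then r * q else 1) *
          x $ (if k = i then j else if k = j then i else k))" by blast
      moreover have "(if k = i \<or> k = j then r * q else 1) \<in> {1, -1}" for k using rq(3,4) by auto
      ultimately show ?thesis
        unfolding a_def[symmetric] W
        by (intro CollectI exI[of _ "\<lambda>k. if k = i then j else if k = j then i else k"]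
            exI[of _ "\<lambda>k. if k = i \<or> k = j then r * q else 1"] conjI bij_transpose_if allI)
    qed
  qed
  show "\<exists>y\<in>orb. y \<bullet> b \<noteq> 0" if b: "b \<noteq> 0" "reflection b \<in> W" for b
  proof -
    obtain i where "b $ i \<noteq> 0" using b(1) by (auto simp: vec_eq_iff)
    then have "axis i 1 \<bullet> b \<noteq> 0" by (simp add: inner_commute[of _ b] inner_axis_1)
    then show ?thesis using orb' by auto
  qed
qed (fact assms)+

subsection \<open>Type I\<close>

lemma generated_linear: "w \<in> generated_by_reflections A \<Longrightarrow> linear w"
proof (induction rule: generated_by_reflections.induct)
  case (step a w)
  then show ?case using linear_compose linear_reflection by blast
qed (simp add: linear_id[unfolded id_def] id_def)

lemma generated_inner: "w \<in> generated_by_reflections A \<Longrightarrow> w y \<bullet> w z = y \<bullet> z"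
  by (induction arbitrary: y z rule: generated_by_reflections.induct) (simp_all add: reflection_inner)

lemma generated_comp:
  assumes "w \<in> generated_by_reflections A" "v \<in> generated_by_reflections A"
  shows "w \<circ> v \<in> generated_by_reflections A"
  using assms
  by (induction rule: generated_by_reflections.induct)
    (auto simp: comp_assoc intro: generated_by_reflections.intros)

lemma generated_inverse:
  assumes "w \<in> generated_by_reflections A"
  shows "\<exists>v\<in>generated_by_reflections A. \<forall>y. v (w y) = y"
  using assms
proof (induction rule: generated_by_reflections.induct)
  case (step a w)
  then obtain v where v: "v \<in> generated_by_reflections A" "\<forall>y. v (w y) = y" by blast
  have "reflection a \<in> generated_by_reflections A"
    using generated_by_reflections.step[OF step(1) generated_by_reflections.id] by simp
  then have "v \<circ> reflection a \<in> generated_by_reflections A" using generated_comp v(1) by blast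
  then show ?case using v(2) by (intro bexI[of _ "v \<circ> reflection a"]) (simp_all add: reflection_involution)
qed (intro bexI[of _ id], simp_all add: generated_by_reflections.id)

lemma plane_decomposition:
  fixes u v :: "'a::euclidean_space"
  assumes dim: "DIM('a) = 2" and "u \<noteq> 0" "v \<noteq> 0" "u \<bullet> v = 0"
  obtains p q where "x = p *\<^sub>R u + q *\<^sub>R v"
proof -
  have "pairwise orthogonal {u, v}" "0 \<notin> {u, v}"
    using assms by (auto simp: pairwise_insert orthogonal_def inner_commute)
  then have "independent {u, v}" by (rule pairwise_orthogonal_independent)
  moreover have "u \<noteq> v" using assms by auto
  then have "card {u, v} = 2" by simp
  ultimately have "UNIV \<subseteq> span {u, v}"
    using dim by (intro card_ge_dim_independent) auto
  then have "x \<in> span {u, v}" by auto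
  then obtain p where "x - p *\<^sub>R u \<in> span {v}" using span_breakdown_eq by blast
  then obtain q where "x - p *\<^sub>R u = q *\<^sub>R v" by (auto simp: span_singleton)
  then have "x = p *\<^sub>R u + q *\<^sub>R v" by (simp add: algebra_simps)
  then show thesis by (rule that)
qed

lemma plane_orthogonal_unique:
  fixes z :: "'a::euclidean_space"
  assumes dim: "DIM('a) = 2" and "z \<noteq> 0" "p \<bullet> z = 0" "q \<bullet> z = 0" "p \<bullet> p = q \<bullet> q"
  shows "q = p \<or> q = - p"
proof (cases "p = 0")
  case True
  then show ?thesis using assms by simp
next
  case False
  obtain k l where q: "q = k *\<^sub>R z + l *\<^sub>R p"
    using plane_decomposition[OF dim \<open>z \<noteq> 0\<close> False] assms(3) by (metis inner_commute)
  have "k * (z \<bullet> z) = 0" using assms(3,4) unfolding q by (simp add: inner_add_left)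
  then have "k = 0" using assms(2) by simp
  then have "l * l * (p \<bullet> p) = p \<bullet> p" using assms(5) q by simp
  then have "l * l = 1" using False by simp
  then have "l = 1 \<or> l = -1" by (simp add: square_eq_1_iff)
  then show ?thesis using q \<open>k = 0\<close> by auto
qed

text \<open>For \<open>chord\<close>, some \<open>w\<close> in the group takes \<open>y\<close> to
  \<open>z\<close>, and some nontrivial \<open>t\<close> fixes \<open>y\<close>. In the plane just
  two linear isometries take \<open>y\<close> to \<open>z\<close>; they are \<open>w\<close> and
  \<open>w \<circ> t\<close>, and the reflection in \<open>y - z\<close> is one of them.\<close>

lemma type_I2_reflecting_orbit:
  fixes W :: "(real^'n \<Rightarrow> real^'n) set"
  assumes type: "type_I2 m W orb" "3 \<le> m"
    and "root_system W \<Phi>" "simple_roots \<Phi> \<Delta>" "bipartition \<Delta> Dp Dm"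
  shows "reflecting_orbit W \<Phi> \<Delta> Dp Dm orb"
proof
  have dim: "DIM(real^'n) = 2" using type(1) by (simp add: type_I2_def)
  obtain a b x0 u v where W: "W = generated_by_reflections {a, b}" and card_W: "card W = 2 * m"
    and orb: "orb = (\<lambda>w. w x0) ` W"
    and uv: "norm u = norm v" "u \<noteq> 0" "u \<bullet> v = 0"
    and polygon: "orb = {cos (2 * pi * real k / real m) *\<^sub>R u + sin (2 * pi * real k / real m) *\<^sub>R v | k. k < m}"
    using type(1) unfolding type_I2_def regular_polygon_vertices_def by blast
  have "v \<noteq> 0" using uv by auto
  have "finite W" using card_W type(2) by (metis card.infinite mult_eq_0_iff not_numeral_le_zero zero_neq_numeral)
  have stable: "w y \<in> orb" if wy: "w \<in> W" "y \<in> orb" for w y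
  proof -
    obtain w' where "w' \<in> W" "y = w' x0" using wy orb by auto
    then have "w \<circ> w' \<in> W" "w y = (w \<circ> w') x0" using wy W generated_comp by auto
    then show ?thesis using orb by blast
  qed
  show "w y \<in> orb" if "w \<in> W" "y \<in> orb" for w y using stable that by blast
  define \<alpha> where "\<alpha> = 2 * pi / real m"
  have \<alpha>: "0 < \<alpha>" "\<alpha> < pi" using type(2) by (auto simp: \<alpha>_def field_simps)
  have sin_pos: "sin \<alpha> > 0" using \<alpha> by (rule sin_gt_zero)
  define f where "f k = cos (real k * \<alpha>) *\<^sub>R u + sin (real k * \<alpha>) *\<^sub>R v" for k :: nat
  have f_orb: "orb = f ` {..<m}"
    unfolding polygon f_def \<alpha>_def by (auto simp: mult.commute mult.left_commute image_iff)
  have f_eq: "cos (real k * \<alpha>) = cos (real l * \<alpha>) \<and> sin (real k * \<alpha>) = sin (real l * \<alpha>)" if "f k = f l" for k l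
  proof -
    have "f k \<bullet> u = f l \<bullet> u" "f k \<bullet> v = f l \<bullet> v" using that by auto
    then show ?thesis
      using uv \<open>v \<noteq> 0\<close> by (simp add: f_def inner_add_left inner_commute[of v u])
  qed
  have "finite orb" by (simp add: f_orb)
  show card_orb: "3 \<le> card orb"
  proof -
    have "f 0 \<noteq> f 1" using f_eq[of 0 1] sin_pos by auto
    moreover have "f 0 \<noteq> f 2"
    proof
      assume "f 0 = f 2"
      then have "cos (2 * \<alpha>) = 1" using f_eq[of 0 2] by simp
      then show False using sin_pos by (simp add: cos_double_sin)
    qed
    moreover have "f 1 \<noteq> f 2"
    proof
      assume "f 1 = f 2"
      then have eq: "cos \<alpha> = cos (2 * \<alpha>)" "sin \<alpha> = sin (2 * \<alpha>)" using f_eq[of 1 2] by auto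
      then have "cos \<alpha> = 1 / 2" using sin_pos by (simp add: sin_double)
      moreover have "cos (2 * \<alpha>) = 2 * (1 / 2)\<^sup>2 - 1" unfolding cos_double_cos \<open>cos \<alpha> = 1 / 2\<close> ..
      ultimately show False using eq(1) by (simp add: power2_eq_square)
    qed
    ultimately have "card {f 0, f 1, f 2} = 3" by (auto simp: card_insert_if)
    then show ?thesis
      using card_mono[OF \<open>finite orb\<close>, of "{f 0, f 1, f 2}"] type(2) f_orb by auto
  qed
  have inner: "w y \<bullet> w z = y \<bullet> z" and linear: "linear w" if "w \<in> W" for w y z
    using generated_inner generated_linear that W by auto
  show norm: "norm y = norm z" if "y \<in> orb" "z \<in> orb" for y z
    using that inner by (auto simp: orb norm_eq_sqrt_inner)
  show "reflection (y - z) \<in> W" if yz: "y \<in> orb" "z \<in> orb" "y \<noteq> z" for y z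
  proof -
    have "f 0 \<noteq> 0" using uv by (simp add: f_def)
    moreover have "f 0 \<in> orb" unfolding f_orb using type(2) by simp
    then have "norm y = norm (f 0)" "norm z = norm (f 0)" using norm yz(1,2) by blast+
    ultimately have "y \<noteq> 0" "z \<noteq> 0" by auto
    obtain w where w: "w \<in> W" "w y = z"
    proof -
      obtain w1 w2 where w12: "w1 \<in> W" "w2 \<in> W" "y = w1 x0" "z = w2 x0" using yz orb by auto
      obtain w1' where "w1' \<in> W" "\<forall>x. w1' (w1 x) = x" using generated_inverse w12(1) W by metis
      then show thesis using that[of "w2 \<circ> w1'"] w12 W generated_comp by auto
    qed
    \<comment> \<open>Pigeonhole: \<open>2 * m\<close> group elements send \<open>y\<close> to at
      most \<open>m\<close> places, so two of them agree at \<open>y\<close>.\<close>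
    obtain t where t: "t \<in> W" "t y = y" "t \<noteq> id"
    proof -
      have "(\<lambda>w. w y) ` W \<subseteq> orb" using stable yz by auto
      then have "card ((\<lambda>w. w y) ` W) \<le> card orb" using card_mono \<open>finite orb\<close> by blast
      also have "\<dots> \<le> m" unfolding f_orb using card_image_le[of "{..<m}" f] by simp
      also have "\<dots> < card W" using card_W type(2) by simp
      finally have "\<not> inj_on (\<lambda>w. w y) W" using card_image by fastforce
      then obtain w1 w2 where w12: "w1 \<in> W" "w2 \<in> W" "w1 y = w2 y" "w1 \<noteq> w2" by (auto simp: inj_on_def)
      obtain w1' where w1': "w1' \<in> W" "\<forall>x. w1' (w1 x) = x" using generated_inverse w12(1) W by metis
      have "w1' \<circ> w2 \<noteq> id"
      proof
        assume "w1' \<circ> w2 = id"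
        then have "w1' (w2 x) = w1' (w1 x)" for x using w1'(2) by (metis comp_apply id_apply)
        moreover have "inj w1'"
        proof (rule injI)
          fix p q assume "w1' p = w1' q"
          then have "w1' (p - q) \<bullet> w1' (p - q) = 0" using linear_diff[OF linear[OF w1'(1)]] by simp
          then show "p = q" using inner[OF w1'(1)] by simp
        qed
        ultimately have "w2 = w1" by (auto simp: inj_eq)
        then show False using w12 by simp
      qed
      then show thesis using that[of "w1' \<circ> w2"] w1' w12 W generated_comp by (metis comp_apply)
    qed
    obtain y' where y': "y' \<noteq> 0" "y' \<bullet> y = 0"
      using orthogonal_to_vector_exists[of y] dim by (auto simp: orthogonal_def inner_commute)
    have agree: "g = g'" if "linear g" "linear g'" "g y = g' y" "g y' = g' y'" for g g' :: "real^'n \<Rightarrow> real^'n"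
    proof
      fix x
      obtain p q where "x = p *\<^sub>R y + q *\<^sub>R y'"
        using plane_decomposition[OF dim \<open>y \<noteq> 0\<close> y'(1)] y'(2) by (metis inner_commute)
      then show "g x = g' x"
        using that by (simp add: linear_add linear_scale)
    qed
    let ?r = "reflection (y - z)"
    have r: "?r y = z" using reflection_swap[OF norm[OF yz(1,2)], of 1 "y - z"] by simp
    have "t y' = y' \<or> t y' = - y'"
      using inner[OF t(1), of y' y] inner[OF t(1), of y' y'] t(2) y'
      by (intro plane_orthogonal_unique[OF dim \<open>y \<noteq> 0\<close>]) auto
    then have t': "t y' = - y'" using agree[of t id] linear[OF t(1)] t linear_id by auto
    have "?r y' = w y' \<or> ?r y' = - w y'"
      using inner[OF w(1), of y' y] inner[OF w(1), of y' y'] w(2) y'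
        reflection_inner[of "y - z" y' y] reflection_inner[of "y - z" y' y'] r
      by (intro plane_orthogonal_unique[OF dim \<open>z \<noteq> 0\<close>]) auto
    then show ?thesis
    proof
      assume "?r y' = w y'"
      then have "?r = w" using agree linear_reflection linear[OF w(1)] r w(2) by metis
      then show ?thesis using w(1) by simp
    next
      assume "?r y' = - w y'"
      then have "?r y' = (w \<circ> t) y'" using t' linear_neg[OF linear[OF w(1)]] by simp
      moreover have "?r y = (w \<circ> t) y" using r w(2) t(2) by simp
      ultimately have "?r = w \<circ> t"
        by (intro agree linear_reflection linear_compose linear w t)
      then show ?thesis using w(1) t(1) W generated_comp by auto
    qed
  qed
  show "\<exists>y\<in>orb. y \<bullet> b \<noteq> 0" if b: "b \<noteq> 0" "reflection b \<in> W" for b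
  proof (rule ccontr)
    assume "\<not> (\<exists>y\<in>orb. y \<bullet> b \<noteq> 0)"
    \<comment> \<open>\<open>f 0\<close> is \<open>u\<close>, and \<open>f 1\<close> has the nonzero
      component \<open>sin \<alpha>\<close> along \<open>v\<close>.\<close>
    then have "f 0 \<bullet> b = 0" "f 1 \<bullet> b = 0" using f_orb type(2) by auto
    then have "u \<bullet> b = 0" "v \<bullet> b = 0" using sin_pos by (auto simp: f_def inner_add_left)
    moreover obtain p q where "b = p *\<^sub>R u + q *\<^sub>R v"
      using plane_decomposition[OF dim uv(2) \<open>v \<noteq> 0\<close> uv(3)] by metis
    ultimately have "b \<bullet> b = 0" by (metis add.right_neutral inner_add_left inner_scaleR_left mult_zero_right)
    then show False using b(1) by simp
  qed
qed (fact assms)+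

theorem mainTheorem3:
  fixes W :: "(real^'n \<Rightarrow> real^'n) set"
    and orb \<Phi> \<Delta> Dp Dm :: "(real^'n) set"
    and c :: "real^'n \<Rightarrow> real"
    and \<beta> \<gamma> :: "real^'n"
  assumes type: "(\<exists>n\<ge>2. type_A n W orb) \<or> (\<exists>n\<ge>2. type_B n W orb) \<or> (\<exists>m\<ge>3. type_I2 m W orb)"
    and roots: "root_system W \<Phi>"
    and simple: "simple_roots \<Phi> \<Delta>"
    and bipartite: "bipartition \<Delta> Dp Dm"
    and eigenvector: "coxeter_eigenvector \<Delta> c"
    and almost_positive: "\<beta> \<in> almost_positive_roots \<Phi> \<Delta>" "\<gamma> \<in> almost_positive_roots \<Phi> \<Delta>"
    and distinct: "\<beta> \<noteq> \<gamma>"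
  shows "(\<beta>, \<gamma>) \<in> compatibility \<Phi> Dp Dm \<longleftrightarrow>
    (\<forall>s \<in> root_diagram \<Phi> Dp Dm c orb \<beta>. \<forall>t \<in> root_diagram \<Phi> Dp Dm c orb \<gamma>. \<not> crosses s t)"
proof -
  have "reflecting_orbit W \<Phi> \<Delta> Dp Dm orb"
    using type type_A_reflecting_orbit type_B_reflecting_orbit type_I2_reflecting_orbit
      roots simple bipartite by metis
  then show ?thesis
    using eigenvector almost_positive distinct by (rule reflecting_orbit.compatible_iff_not_crossing)
qed

end
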